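(* Let $(M,g)$, $(\hat M,g_{\rm cone})$, $S$, $\hat S$, $\hat{\mathcal B}$, $\gamma_{\rm cone}$, $r$, $\theta$, $\kappa$, $\Delta$, $f$, $F$, the operators $\hat D$, $\hat Q$, the truncated product $\diamond_+$ on $\Omega^<(\hat M)=\oplus_{k=0}^4\Omega^k(\hat M)$, the generalized products $\bigtriangleup_k$, the contractions $\iota$ and the Hodge operator $\ast$ be as in the context. Assume that the space $\mathcal K(\hat D,\hat Q)$ of sections $\hat\xi\in\Gamma(\hat M,\hat S)$ satisfying the constrained generalized Killing pinor equations $\hat D_a\hat\xi=0$ ($a=1,\dots,9$), $\hat Q\hat\xi=0$ on the cone has dimension $2$ over $\mathbb R$, and let $\hat\xi_1,\hat\xi_2$ be a $\hat{\mathcal B}$-orthonormal basis of it: $\hat{\mathcal B}(\hat\xi_i,\hat\xi_j)=\delta_{ij}$. Let $V_3,K,\Psi,\Phi_3$ be the forms on $\hat M$ of ranks $1,2,3,4$ with components $$V_3^a=\hat{\mathcal B}(\hat\xi_1,\hat\gamma^a\hat\xi_2),\quad K^{ab}=\hat{\mathcal B}(\hat\xi_1,\hat\gamma^{ab}\hat\xi_2),\quad \Psi^{abc}=\hat{\mathcal B}(\hat\xi_1,\hat\gamma^{abc}\hat\xi_2),\quad \Phi_3^{abce}=\hat{\mathcal B}(\hat\xi_1,\hat\gamma^{abce}\hat\xi_2),$$ let $\check E^<_{12}=\frac1{32}(V_3+K+\Psi+\Phi_3)$, and let $$\check Q=\tfrac12 r\,d\Delta-\tfrac16 f\wedge\theta-\tfrac1{12}F-\kappa\theta,\qquad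 \hat\tau(\check Q)=\tfrac12 r\,d\Delta+\tfrac16 f\wedge\theta-\tfrac1{12}F-\kappa\theta ,$$ so that $\hat Q=\gamma_{\rm cone}(\check Q)$. The algebraic constraints $\hat Q\hat\xi_i=0$ amount to the two relations $$\check Q\,\diamond_+\,\check E^<_{12}\mp\check E^<_{12}\,\diamond_+\,\hat\tau(\check Q)=0$$ for $\check E^<_{12}$. When separated on ranks: (i) the relation with the minus sign amounts to the system $$\iota_{f\wedge\theta}K=0,$$ $$r\,\iota_{d\Delta}K+\tfrac13\iota_{f\wedge\theta}\Psi-\tfrac16\iota_\Psi F-2\kappa\,\iota_\theta K=0,$$ $$\tfrac13\iota_{f\wedge\theta}\Phi_3-\tfrac16F\bigtriangleup_3\Phi_3+r\,d\Delta\wedge V_3+2\kappa\,V_3\wedge\theta=0,$$ $$r\,\iota_{d\Delta}\Phi_3-\tfrac13V_3\wedge f\wedge\theta+\tfrac16\iota_{V_3}F-\tfrac16{\ast}(F\bigtriangleup_1\Phi_3)+\tfrac13{\ast}(f\wedge\theta\wedge\Phi_3)-2\kappa\,\iota_\theta\Phi_3=0,$$ $$r\,d\Delta\wedge\Psi-\tfrac13f\wedge\theta\wedge K-\tfrac16K\bigtriangleup_1F-\tfrac13{\ast}(f\wedge\theta\wedge\Psi)+\tfrac16{\ast}(\Psi\bigtriangleup_1F)+2\kappa\,\Psi\wedge\theta=0;$$ (ii) the relation with the plus sign amounts to the system $$-\tfrac16\iota_F\Phi_3+r\,\iota_{d\Delta}V_3-2\kappa\,\iota_\theta V_3=0,$$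 $$\tfrac13\iota_{V_3}(f\wedge\theta)-\tfrac16{\ast}(F\wedge\Phi_3)=0,$$ $$r\,\iota_{d\Delta}\Psi+\tfrac13(f\wedge\theta)\bigtriangleup_1K+\tfrac16\iota_KF+\tfrac16{\ast}(F\wedge\Psi)-2\kappa\,\iota_\theta\Psi=0,$$ $$\tfrac13(f\wedge\theta)\bigtriangleup_1\Psi+\tfrac16\Psi\bigtriangleup_2F+\tfrac16{\ast}(K\wedge F)+r\,d\Delta\wedge K-2\kappa\,K\wedge\theta=0,$$ $$\tfrac13(f\wedge\theta)\bigtriangleup_1\Phi_3+\tfrac16F\bigtriangleup_2\Phi_3-\tfrac16{\ast}(F\wedge V_3)+{\ast}(r\,d\Delta\wedge\Phi_3)-2\kappa\,{\ast}(\Phi_3\wedge\theta)=0.$$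
   Context: Geometry. $(M,g)$ is an oriented Riemannian 8-manifold with a real pinor bundle $S$ (a real vector bundle of rank 16 carrying a fiberwise representation $\gamma$ of $\mathrm{Cl}(8,0)$ for which $\gamma:(\wedge T^*M,\diamond)\to\mathrm{End}(S)$ is an isomorphism of bundles of algebras; $\gamma^m=\gamma(e^m)$ for a local oriented orthonormal coframe $e^m$, $\gamma^{(9)}=\gamma^1\cdots\gamma^8$, and $\gamma^{m_1\dots m_k}$ is the antisymmetrized product). $\mathcal B$ is a symmetric, positive-definite fiberwise bilinear pairing on $S$, admissible in the usual sense, for which all $\gamma^m$ are self-adjoint. The metric cone is $\hat M=(0,\infty)\times M$, $g_{\rm cone}=dr^2+r^2g$, with projection $\Pi:\hat M\to M$, $\theta=dr$, local orthonormal coframe $e^m_{\rm cone}=r\,\Pi^*e^m$ ($m=1,\dots,8$), $e^9_{\rm cone}=\theta$, and volume form $\nu=e^1_{\rm cone}\wedge\dots\wedge e^8_{\rm cone}\wedge\theta$. One sets $\hat S=\Pi^*S$, $\hat{\mathcal B}=\Pi^*\mathcal B$, $\hat\gamma^m=\Pi^*\gamma^m$, $\hat\gamma^9=\Pi^*\gamma^{(9)}$; this defines the pinor representation $\gamma_{\rm cone}$ of the Clifford (Kähler–Atiyah) bundle of the cone, with $\gamma_{\rm cone}(e^a_{\rm cone})=\hat\gamma^a$ and $\gamma_{\rm cone}(\nu)=+\mathrm{id}$ (signature $+1$). All $\hat\gamma^a$ are $\hat{\mathcal B}$-self-adjoint, and $\hat\gamma^{a_1\dots a_k}$ is the antisymmetrized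 product (with weight one). A $k$-form with components $\omega_{a_1\dots a_k}$ is $\frac1{k!}\omega_{a_1\dots a_k}e^{a_1}_{\rm cone}\wedge\dots\wedge e^{a_k}_{\rm cone}$. Data and Killing equations. $\kappa$ is a positive real parameter, $\Delta$ a smooth function on $M$ (also denoting its pullback to $\hat M$), $f=f_me^m\in\Omega^1(M)$, $F=\frac1{4!}F_{mnpq}e^{mnpq}\in\Omega^4(M)$. On $M$ the constrained generalized Killing pinor equations are $D_m\xi=0$, $Q\xi=0$ for $\xi\in\Gamma(M,S)$, where, with $\nabla^S$ the connection on $S$ induced by the Levi-Civita connection of $g$, $$D_m=\nabla^S_m+\tfrac14f_p\gamma_m{}^p\gamma^{(9)}+\tfrac1{24}F_{mpqr}\gamma^{pqr}+\kappa\gamma_m\gamma^{(9)},$$ $$Q=\tfrac12\gamma^m\partial_m\Delta-\tfrac1{288}F_{mpqr}\gamma^{mpqr}-\tfrac16f_p\gamma^p\gamma^{(9)}-\kappa\gamma^{(9)}.$$ $\hat D$ and $\hat Q$ are the lifts (pullbacks through $\Pi$) of $D$ and $Q$ to $\hat S$; the equations $\hat D_a\hat\xi=\hat Q\hat\xi=0$ on the cone are equivalent with the equations on $M$. In the claim the symbols $f$ and $F$ stand for the cone lifts $r\,\Pi^*f$ and $r^4\,\Pi^*F$. Products (all with respect to the cone metric). Contracted wedge products: $\omega\wedge_0\eta=\omega\wedge\eta$ and $\omega\wedge_{k+1}\eta=\sum_{a=1}^9(\iota_{e_a}\omega)\wedge_k(\iota_{e_a}\eta)$ for a local orthonormal frame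 $e_a$; generalized products: $\bigtriangleup_k=\frac1{k!}\wedge_k$. The grading automorphism $\pi$ acts as $(-1)^k$ on $k$-forms, and the reversion $\hat\tau$ acts as $(-1)^{k(k-1)/2}$ on $k$-forms. The geometric (Clifford) product, with $d=9$, is $$\omega\diamond\eta=\sum_{k=0}^{[d/2]}\frac{(-1)^k}{(2k)!}\,\omega\wedge_{2k}\eta+\sum_{k=0}^{[(d-1)/2]}\frac{(-1)^{k+1}}{(2k+1)!}\,\pi(\omega)\wedge_{2k+1}\eta$$ (the product on $\wedge T^*M$ is given by the same formula with $d=8$ and the metric $g$). For forms $\omega,\eta$, the interior product $\iota_\omega\eta$ is defined by $\langle\iota_\omega\eta,\rho\rangle=\langle\eta,\omega\wedge\rho\rangle$ for all $\rho$, where $\langle\cdot,\cdot\rangle$ is the metric on forms for which the $e^{a_1}\wedge\dots\wedge e^{a_k}$, $a_1<\dots<a_k$, are orthonormal. $\ast$ is the ordinary Hodge operator of $(\hat M,g_{\rm cone},\nu)$, with $\omega\wedge{\ast}\eta=\langle\omega,\eta\rangle\nu$ for forms of equal rank. Truncated model. The twisted Hodge operator is $\tilde\ast\omega=\omega\diamond\nu$; $P_+=\frac12(1+\tilde\ast)$; $P_<$ is the projection of $\Omega(\hat M)$ onto $\Omega^<(\hat M)=\oplus_{k=0}^4\Omega^k(\hat M)$. The product on $\Omega^<(\hat M)$ is $\omega\,\diamond_+\,\eta=2P_<\big(P_+(\omega)\diamond P_+(\eta)\big)$. *)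

theory Defs
  imports "HOL-Analysis.Analysis" "HOL-Library.Function_Algebras" "HOL-Library.Numeral_Type"
begin

section \<open>Smooth manifolds, tangent vectors, forms\<close>

text \<open>Sets of functions with values in a real vector space (tangent vectors as derivations,
  sections of bundles) are treated as sets in the vector space of all functions; addition is the
  pointwise one of \<^theory>\<open>HOL-Library.Function_Algebras\<close>.\<close>

definition fscale :: "real \<Rightarrow> ('a \<Rightarrow> 'b::real_vector) \<Rightarrow> 'a \<Rightarrow> 'b" where
  "fscale a f = (\<lambda>x. a *\<^sub>R f x)"

interpretation fun_vs: vector_space "fscale :: real \<Rightarrow> ('a \<Rightarrow> 'b::real_vector) \<Rightarrow> 'a \<Rightarrow> 'b"
  by standard (auto simp: fscale_def fun_eq_iff scaleR_add_right scaleR_add_left)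

primrec cont_diff :: "nat \<Rightarrow> 'e::euclidean_space set \<Rightarrow> ('e \<Rightarrow> real) \<Rightarrow> bool" where
  "cont_diff 0 W h \<longleftrightarrow> continuous_on W h"
| "cont_diff (Suc k) W h \<longleftrightarrow> (\<forall>z\<in>W. h differentiable (at z)) \<and>
     (\<forall>b\<in>Basis. cont_diff k W (\<lambda>z. frechet_derivative h (at z) b))"

definition C_infinity :: "'e::euclidean_space set \<Rightarrow> ('e \<Rightarrow> real) \<Rightarrow> bool" where
  "C_infinity W h \<longleftrightarrow> (\<forall>k. cont_diff k W h)"

type_synonym ('p, 'e) atlas = "('p set \<times> ('p \<Rightarrow> 'e)) set"

definition points :: "('p, 'e) atlas \<Rightarrow> 'p set" where
  "points A = \<Union> (fst ` A)"

locale smooth_manifold =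
  fixes A :: "('p::{t2_space, second_countable_topology}, 'e::euclidean_space) atlas"
  assumes chart_open: "(U, \<phi>) \<in> A \<Longrightarrow> open U \<and> open (\<phi> ` U)"
    and chart_homeomorphism: "(U, \<phi>) \<in> A \<Longrightarrow> homeomorphism U (\<phi> ` U) \<phi> (inv_into U \<phi>)"
    and transition_smooth: "\<lbrakk>(U, \<phi>) \<in> A; (V, \<psi>) \<in> A; b \<in> Basis\<rbrakk> \<Longrightarrow>
      C_infinity (\<phi> ` (U \<inter> V)) (\<lambda>z. \<psi> (inv_into U \<phi> z) \<bullet> b)"

definition smooth_fun_on :: "('p, 'e::euclidean_space) atlas \<Rightarrow> 'p set \<Rightarrow> ('p \<Rightarrow> real) \<Rightarrow> bool" where
  "smooth_fun_on A W h \<longleftrightarrow>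
     (\<forall>(U, \<phi>)\<in>A. C_infinity (\<phi> ` (U \<inter> W)) (\<lambda>z. h (inv_into U \<phi> z)))"

abbreviation smooth_fun :: "('p, 'e::euclidean_space) atlas \<Rightarrow> ('p \<Rightarrow> real) \<Rightarrow> bool" where
  "smooth_fun A \<equiv> smooth_fun_on A (points A)"

text \<open>Tangent vectors are derivations of the algebra of smooth functions; the value at non-smooth
  arguments is fixed to be 0, so that two tangent vectors are equal as soon as they agree on smooth
  functions.\<close>

type_synonym 'p vec = "('p \<Rightarrow> real) \<Rightarrow> real"

definition tangent :: "('p, 'e::euclidean_space) atlas \<Rightarrow> 'p \<Rightarrow> 'p vec set" where
  "tangent A p = {v.
     (\<forall>h. \<not> smooth_fun A h \<longrightarrow> v h = 0) \<and>
     (\<forall>h k a b. smooth_fun A h \<longrightarrow> smooth_fun A k \<longrightarrow>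
        v (\<lambda>q. a * h q + b * k q) = a * v h + b * v k \<and>
        v (\<lambda>q. h q * k q) = h p * v k + k p * v h)}"

definition vector_field :: "('p, 'e::euclidean_space) atlas \<Rightarrow> ('p \<Rightarrow> 'p vec) \<Rightarrow> bool" where
  "vector_field A X \<longleftrightarrow> (\<forall>p\<in>points A. X p \<in> tangent A p) \<and>
     (\<forall>h. smooth_fun A h \<longrightarrow> smooth_fun A (\<lambda>p. X p h))"

definition lie_bracket :: "('p \<Rightarrow> 'p vec) \<Rightarrow> ('p \<Rightarrow> 'p vec) \<Rightarrow> 'p \<Rightarrow> 'p vec" where
  "lie_bracket X Y = (\<lambda>p h. X p (\<lambda>q. Y q h) - Y p (\<lambda>q. X q h))"

text \<open>A k-form is a function of the point and of a list of k tangent vectors at that point.\<close>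

definition differential_form ::
  "('p, 'e::euclidean_space) atlas \<Rightarrow> nat \<Rightarrow> ('p \<Rightarrow> 'p vec list \<Rightarrow> real) \<Rightarrow> bool" where
  "differential_form A k \<alpha> \<longleftrightarrow>
     (\<forall>p\<in>points A. \<forall>vs. length vs = k \<longrightarrow> set vs \<subseteq> tangent A p \<longrightarrow>
        (\<forall>i<k. \<forall>u\<in>tangent A p. \<forall>w\<in>tangent A p. \<forall>a b.
           \<alpha> p (vs[i := fscale a u + fscale b w]) = a * \<alpha> p (vs[i := u]) + b * \<alpha> p (vs[i := w])) \<and>
        (\<forall>i<k. \<forall>j<k. i \<noteq> j \<longrightarrow> vs ! i = vs ! j \<longrightarrow> \<alpha> p vs = 0)) \<and>
     (\<forall>Xs. length Xs = k \<longrightarrow> (\<forall>X\<in>set Xs. vector_field A X) \<longrightarrow>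
        smooth_fun A (\<lambda>p. \<alpha> p (map (\<lambda>X. X p) Xs)))"

definition d_fun :: "('p \<Rightarrow> real) \<Rightarrow> 'p \<Rightarrow> 'p vec list \<Rightarrow> real" where
  "d_fun h p vs = hd vs h"


section \<open>Oriented Riemannian 8-manifolds and pinor bundles\<close>

text \<open>Frame indices have the type 9, whose elements are ordered as 0 < ... < 8. The indices of M are
  the elements of \<open>{..<8}\<close> (that is, 0, ..., 7), and 8 is the radial direction of the cone.\<close>

lemma index_cases: "c < 8 \<or> c = 8" for c :: 9
proof (cases c)
  case (of_int z)
  then have "z \<in> {0, 1, 2, 3, 4, 5, 6, 7, 8}" by auto
  then show ?thesis
    unfolding of_int(1) by (auto simp: less_bit1_def bit1.Rep_numeral bit1.Rep_0 bit1.Rep_1)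
qed

definition base_indices :: "9 list" where
  "base_indices = [0, 1, 2, 3, 4, 5, 6, 7]"

text \<open>The orientation is given by a nowhere vanishing 8-form \<open>vol\<close>; only its sign matters.\<close>

locale oriented_riemannian_8_manifold =
  smooth_manifold A for A :: "('m::{t2_space, second_countable_topology}, real^8) atlas" +
  fixes g :: "'m \<Rightarrow> 'm vec \<Rightarrow> 'm vec \<Rightarrow> real"
    and vol :: "'m \<Rightarrow> 'm vec list \<Rightarrow> real"
  assumes points_UNIV: "points A = UNIV"
    and metric_linear: "\<lbrakk>u \<in> tangent A x; v \<in> tangent A x; w \<in> tangent A x\<rbrakk> \<Longrightarrow>
      g x (fscale a u + fscale b v) w = a * g x u w + b * g x v w"
    and metric_sym: "\<lbrakk>u \<in> tangent A x; v \<in> tangent A x\<rbrakk> \<Longrightarrow> g x u v = g x v u"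
    and metric_pos: "\<lbrakk>u \<in> tangent A x; u \<noteq> 0\<rbrakk> \<Longrightarrow> g x u u > 0"
    and metric_smooth: "\<lbrakk>vector_field A X; vector_field A Y\<rbrakk> \<Longrightarrow>
      smooth_fun A (\<lambda>x. g x (X x) (Y x))"
    and vol_form: "differential_form A 8 vol"
    and vol_nonzero: "\<exists>vs. length vs = 8 \<and> set vs \<subseteq> tangent A x \<and> vol x vs \<noteq> 0"

definition oriented_frame ::
  "('m, real^8) atlas \<Rightarrow> ('m \<Rightarrow> 'm vec \<Rightarrow> 'm vec \<Rightarrow> real) \<Rightarrow> ('m \<Rightarrow> 'm vec list \<Rightarrow> real) \<Rightarrow>
   'm \<Rightarrow> (9 \<Rightarrow> 'm vec) \<Rightarrow> bool" where
  "oriented_frame A g vol x e \<longleftrightarrow>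
     (\<forall>m<8. e m \<in> tangent A x) \<and>
     (\<forall>m<8. \<forall>n<8. g x (e m) (e n) = (if m = n then 1 else 0)) \<and>
     vol x (map e base_indices) > 0"

text \<open>A connection takes a point, a tangent vector at this point and a smooth section.\<close>

locale levi_civita =
  fixes A :: "('m, real^8) atlas"
    and g :: "'m \<Rightarrow> 'm vec \<Rightarrow> 'm vec \<Rightarrow> real"
    and nab :: "'m \<Rightarrow> 'm vec \<Rightarrow> ('m \<Rightarrow> 'm vec) \<Rightarrow> 'm vec"
  assumes nab_tangent: "\<lbrakk>v \<in> tangent A x; vector_field A Y\<rbrakk> \<Longrightarrow> nab x v Y \<in> tangent A x"
    and nab_smooth: "\<lbrakk>vector_field A X; vector_field A Y\<rbrakk> \<Longrightarrow> vector_field A (\<lambda>x. nab x (X x) Y)"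
    and nab_linear: "\<lbrakk>u \<in> tangent A x; v \<in> tangent A x; vector_field A Y\<rbrakk> \<Longrightarrow>
      nab x (fscale a u + fscale b v) Y = fscale a (nab x u Y) + fscale b (nab x v Y)"
    and nab_add: "\<lbrakk>v \<in> tangent A x; vector_field A Y; vector_field A Z\<rbrakk> \<Longrightarrow>
      nab x v (\<lambda>y. Y y + Z y) = nab x v Y + nab x v Z"
    and nab_Leibniz: "\<lbrakk>v \<in> tangent A x; smooth_fun A h; vector_field A Y\<rbrakk> \<Longrightarrow>
      nab x v (\<lambda>y. fscale (h y) (Y y)) = fscale (v h) (Y x) + fscale (h x) (nab x v Y)"
    and nab_torsion_free: "\<lbrakk>vector_field A X; vector_field A Y\<rbrakk> \<Longrightarrow>
      nab x (X x) Y - nab x (Y x) X = lie_bracket X Y x"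
    and nab_metric: "\<lbrakk>v \<in> tangent A x; vector_field A Y; vector_field A Z\<rbrakk> \<Longrightarrow>
      v (\<lambda>y. g y (Y y) (Z y)) = g x (nab x v Y) (Z x) + g x (Y x) (nab x v Z)"

text \<open>The fibres of the pinor bundle are subspaces of a normed space (for instance the direct sum
  of all the fibres); the bundle structure is given by the family \<open>T\<close> of local trivializations.\<close>

type_synonym ('m, 's) trivializations = "('m set \<times> ('m \<Rightarrow> 's \<Rightarrow> real^16)) set"

definition smooth_section ::
  "('m, real^8) atlas \<Rightarrow> ('m \<Rightarrow> 's set) \<Rightarrow> ('m, 's) trivializations \<Rightarrow> ('m \<Rightarrow> 's) \<Rightarrow> bool" where
  "smooth_section A S T \<xi> \<longleftrightarrow> (\<forall>x. \<xi> x \<in> S x) \<and>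
     (\<forall>(U, \<tau>)\<in>T. \<forall>i. smooth_fun_on A U (\<lambda>x. \<tau> x (\<xi> x) $ i))"

definition linear_between :: "'a::real_vector set \<Rightarrow> 'b::real_vector set \<Rightarrow> ('a \<Rightarrow> 'b) \<Rightarrow> bool" where
  "linear_between V W L \<longleftrightarrow> L ` V \<subseteq> W \<and>
     (\<forall>s\<in>V. \<forall>t\<in>V. \<forall>a b. L (a *\<^sub>R s + b *\<^sub>R t) = a *\<^sub>R L s + b *\<^sub>R L t)"

text \<open>The antisymmetrized product with weight one of the endomorphisms labelled by a list of
  indices.\<close>

definition antisym_prod :: "(9 \<Rightarrow> 's \<Rightarrow> 's) \<Rightarrow> 9 list \<Rightarrow> 's \<Rightarrow> 's::real_vector" where
  "antisym_prod G as s = (1 / fact (length as)) *\<^sub>R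
     (\<Sum>\<sigma> | \<sigma> permutes {..<length as}.
        of_int (sign \<sigma>) *\<^sub>R foldr (\<lambda>i. G (as ! \<sigma> i)) [0..<length as] s)"

text \<open>Elements of the exterior algebra of a 9-dimensional oriented Euclidean space (below: the
  cotangent space of the cone at a point) are given by their coefficients with respect to the basis
  \<open>e\<^sup>C = e\<^sup>a \<and> ... \<and> e\<^sup>b\<close> (a < ... < b the elements of C) defined by an oriented orthonormal
  coframe. The inner product of \<^typ>\<open>real^(9 set)\<close> is the metric on forms.\<close>

type_synonym ext = "real^(9 set)"

text \<open>The action of an exterior form on pinors, given the action G of the coframe.\<close>

definition gamma_ext :: "(9 \<Rightarrow> 's \<Rightarrow> 's) \<Rightarrow> ext \<Rightarrow> 's \<Rightarrow> 's::real_vector" where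
  "gamma_ext G \<omega> s = (\<Sum>C\<in>UNIV. (\<omega> $ C) *\<^sub>R antisym_prod G (sorted_list_of_set C) s)"

text \<open>\<open>cl x v\<close> is Clifford multiplication by the covector metrically dual to the tangent vector v;
  thus \<open>cl x (e m)\<close> is \<open>\<gamma>\<^sup>m = \<gamma>(e\<^sup>m)\<close> for an orthonormal frame e. \<open>gam cl x e\<close> has the components
  \<open>\<gamma>\<^sup>m\<close> for m < 8 and \<open>\<gamma>\<^sup>(\<^sup>9\<^sup>)\<close>, the product of all of them, for the radial index.\<close>

definition gam :: "('m \<Rightarrow> 'm vec \<Rightarrow> 's \<Rightarrow> 's) \<Rightarrow> 'm \<Rightarrow> (9 \<Rightarrow> 'm vec) \<Rightarrow> 9 \<Rightarrow> 's \<Rightarrow> 's" where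
  "gam cl x e a = (if a < 8 then cl x (e a) else foldr (\<lambda>m. cl x (e m)) base_indices)"

locale pinor_bundle =
  fixes A :: "('m::topological_space, real^8) atlas"
    and g :: "'m \<Rightarrow> 'm vec \<Rightarrow> 'm vec \<Rightarrow> real"
    and vol :: "'m \<Rightarrow> 'm vec list \<Rightarrow> real"
    and S :: "'m \<Rightarrow> 's::real_normed_vector set"
    and T :: "('m, 's) trivializations"
    and cl :: "'m \<Rightarrow> 'm vec \<Rightarrow> 's \<Rightarrow> 's"
  assumes fibre_subspace: "subspace (S x)"
    and triv_open: "(U, \<tau>) \<in> T \<Longrightarrow> open U"
    and triv_cover: "\<Union> (fst ` T) = UNIV"
    and triv_linear: "\<lbrakk>(U, \<tau>) \<in> T; x \<in> U\<rbrakk> \<Longrightarrow>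
      linear_between (S x) UNIV (\<tau> x) \<and> bij_betw (\<tau> x) (S x) UNIV"
    and triv_transition: "\<lbrakk>(U, \<tau>) \<in> T; (V, \<rho>) \<in> T\<rbrakk> \<Longrightarrow>
      smooth_fun_on A (U \<inter> V) (\<lambda>x. \<rho> x (inv_into (S x) (\<tau> x) c) $ i)"
    and cl_linear: "v \<in> tangent A x \<Longrightarrow> linear_between (S x) (S x) (cl x v)"
    and cl_linear_vec: "\<lbrakk>u \<in> tangent A x; v \<in> tangent A x; s \<in> S x\<rbrakk> \<Longrightarrow>
      cl x (fscale a u + fscale b v) s = a *\<^sub>R cl x u s + b *\<^sub>R cl x v s"
    and cl_square: "\<lbrakk>v \<in> tangent A x; s \<in> S x\<rbrakk> \<Longrightarrow> cl x v (cl x v s) = g x v v *\<^sub>R s"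
    and cl_smooth: "\<lbrakk>vector_field A X; smooth_section A S T \<xi>\<rbrakk> \<Longrightarrow>
      smooth_section A S T (\<lambda>x. cl x (X x) (\<xi> x))"
    and cl_iso: "\<lbrakk>oriented_frame A g vol x e; linear_between (S x) (S x) L\<rbrakk> \<Longrightarrow>
      \<exists>!\<omega>. (\<forall>C. \<not> C \<subseteq> {..<8} \<longrightarrow> \<omega> $ C = 0) \<and> (\<forall>s\<in>S x. gamma_ext (gam cl x e) \<omega> s = L s)"

locale admissible_pairing =
  fixes A :: "('m, real^8) atlas"
    and S :: "'m \<Rightarrow> 's::real_normed_vector set"
    and T :: "('m, 's) trivializations"
    and cl :: "'m \<Rightarrow> 'm vec \<Rightarrow> 's \<Rightarrow> 's"
    and B :: "'m \<Rightarrow> 's \<Rightarrow> 's \<Rightarrow> real"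
  assumes pairing_linear: "\<lbrakk>s \<in> S x; t \<in> S x; u \<in> S x\<rbrakk> \<Longrightarrow>
      B x (a *\<^sub>R s + b *\<^sub>R t) u = a * B x s u + b * B x t u"
    and pairing_sym: "\<lbrakk>s \<in> S x; t \<in> S x\<rbrakk> \<Longrightarrow> B x s t = B x t s"
    and pairing_pos: "\<lbrakk>s \<in> S x; s \<noteq> 0\<rbrakk> \<Longrightarrow> B x s s > 0"
    and pairing_smooth: "\<lbrakk>smooth_section A S T \<xi>; smooth_section A S T \<eta>\<rbrakk> \<Longrightarrow>
      smooth_fun A (\<lambda>x. B x (\<xi> x) (\<eta> x))"
    and cl_self_adjoint: "\<lbrakk>v \<in> tangent A x; s \<in> S x; t \<in> S x\<rbrakk> \<Longrightarrow>
      B x (cl x v s) t = B x s (cl x v t)"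

text \<open>The connection induced on S by the Levi-Civita connection. Because the commutant of the
  Clifford action is \<open>\<real>\<close>, it is determined by the last two conditions; in a local
  trivialization in which the \<open>\<gamma>\<^sup>m\<close> and the pairing are constant it is the usual spin connection.\<close>

locale pinor_connection =
  fixes A :: "('m, real^8) atlas"
    and nab :: "'m \<Rightarrow> 'm vec \<Rightarrow> ('m \<Rightarrow> 'm vec) \<Rightarrow> 'm vec"
    and S :: "'m \<Rightarrow> 's::real_normed_vector set"
    and T :: "('m, 's) trivializations"
    and cl :: "'m \<Rightarrow> 'm vec \<Rightarrow> 's \<Rightarrow> 's"
    and B :: "'m \<Rightarrow> 's \<Rightarrow> 's \<Rightarrow> real"
    and nabS :: "'m \<Rightarrow> 'm vec \<Rightarrow> ('m \<Rightarrow> 's) \<Rightarrow> 's"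
  assumes nabS_fibre: "\<lbrakk>v \<in> tangent A x; smooth_section A S T \<xi>\<rbrakk> \<Longrightarrow> nabS x v \<xi> \<in> S x"
    and nabS_smooth: "\<lbrakk>vector_field A X; smooth_section A S T \<xi>\<rbrakk> \<Longrightarrow>
      smooth_section A S T (\<lambda>x. nabS x (X x) \<xi>)"
    and nabS_linear: "\<lbrakk>u \<in> tangent A x; v \<in> tangent A x; smooth_section A S T \<xi>\<rbrakk> \<Longrightarrow>
      nabS x (fscale a u + fscale b v) \<xi> = a *\<^sub>R nabS x u \<xi> + b *\<^sub>R nabS x v \<xi>"
    and nabS_add: "\<lbrakk>v \<in> tangent A x; smooth_section A S T \<xi>; smooth_section A S T \<eta>\<rbrakk> \<Longrightarrow>
      nabS x v (\<lambda>y. \<xi> y + \<eta> y) = nabS x v \<xi> + nabS x v \<eta>"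
    and nabS_Leibniz: "\<lbrakk>v \<in> tangent A x; smooth_fun A h; smooth_section A S T \<xi>\<rbrakk> \<Longrightarrow>
      nabS x v (\<lambda>y. h y *\<^sub>R \<xi> y) = v h *\<^sub>R \<xi> x + h x *\<^sub>R nabS x v \<xi>"
    and nabS_clifford: "\<lbrakk>v \<in> tangent A x; vector_field A Y; smooth_section A S T \<xi>\<rbrakk> \<Longrightarrow>
      nabS x v (\<lambda>y. cl y (Y y) (\<xi> y)) = cl x (nab x v Y) (\<xi> x) + cl x (Y x) (nabS x v \<xi>)"
    and nabS_pairing: "\<lbrakk>v \<in> tangent A x; smooth_section A S T \<xi>; smooth_section A S T \<eta>\<rbrakk> \<Longrightarrow>
      v (\<lambda>y. B y (\<xi> y) (\<eta> y)) = B x (nabS x v \<xi>) (\<eta> x) + B x (\<xi> x) (nabS x v \<eta>)"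

locale pinor_geometry =
  oriented_riemannian_8_manifold A g vol + levi_civita A g nab + pinor_bundle A g vol S T cl +
  admissible_pairing A S T cl B + pinor_connection A nab S T cl B nabS
  for A :: "('m::{t2_space, second_countable_topology}, real^8) atlas"
    and g :: "'m \<Rightarrow> 'm vec \<Rightarrow> 'm vec \<Rightarrow> real"
    and vol :: "'m \<Rightarrow> 'm vec list \<Rightarrow> real"
    and nab :: "'m \<Rightarrow> 'm vec \<Rightarrow> ('m \<Rightarrow> 'm vec) \<Rightarrow> 'm vec"
    and S :: "'m \<Rightarrow> 's::real_normed_vector set"
    and T :: "('m, 's) trivializations"
    and cl :: "'m \<Rightarrow> 'm vec \<Rightarrow> 's \<Rightarrow> 's"
    and B :: "'m \<Rightarrow> 's \<Rightarrow> 's \<Rightarrow> real"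
    and nabS :: "'m \<Rightarrow> 'm vec \<Rightarrow> ('m \<Rightarrow> 's) \<Rightarrow> 's"


section \<open>The constrained generalized Killing pinor equations on M\<close>

text \<open>\<open>killing_D cl nabS f F \<kappa> x e m \<xi>\<close> is \<open>D\<^sub>m \<xi>\<close> at the point x and \<open>killing_Q cl \<Delta> f F \<kappa> x e s\<close>
  is \<open>Q s\<close> for an element s of the fibre at x, both expressed in the oriented orthonormal frame e.\<close>

definition killing_D ::
  "('m \<Rightarrow> 'm vec \<Rightarrow> 's \<Rightarrow> 's) \<Rightarrow> ('m \<Rightarrow> 'm vec \<Rightarrow> ('m \<Rightarrow> 's) \<Rightarrow> 's) \<Rightarrow>
   ('m \<Rightarrow> 'm vec list \<Rightarrow> real) \<Rightarrow> ('m \<Rightarrow> 'm vec list \<Rightarrow> real) \<Rightarrow> real \<Rightarrow>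
   'm \<Rightarrow> (9 \<Rightarrow> 'm vec) \<Rightarrow> 9 \<Rightarrow> ('m \<Rightarrow> 's) \<Rightarrow> 's::real_vector" where
  "killing_D cl nabS f F \<kappa> x e m \<xi> = (let G = gam cl x e in
     nabS x (e m) \<xi>
     + (1/4) *\<^sub>R (\<Sum>p<8. f x [e p] *\<^sub>R antisym_prod G [m, p] (G 8 (\<xi> x)))
     + (1/24) *\<^sub>R (\<Sum>p<8. \<Sum>q<8. \<Sum>r<8.
         F x [e m, e p, e q, e r] *\<^sub>R antisym_prod G [p, q, r] (\<xi> x))
     + \<kappa> *\<^sub>R G m (G 8 (\<xi> x)))"

definition killing_Q ::
  "('m \<Rightarrow> 'm vec \<Rightarrow> 's \<Rightarrow> 's) \<Rightarrow> ('m \<Rightarrow> real) \<Rightarrow>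
   ('m \<Rightarrow> 'm vec list \<Rightarrow> real) \<Rightarrow> ('m \<Rightarrow> 'm vec list \<Rightarrow> real) \<Rightarrow> real \<Rightarrow>
   'm \<Rightarrow> (9 \<Rightarrow> 'm vec) \<Rightarrow> 's \<Rightarrow> 's::real_vector" where
  "killing_Q cl \<Delta> f F \<kappa> x e s = (let G = gam cl x e in
     (1/2) *\<^sub>R (\<Sum>m<8. e m \<Delta> *\<^sub>R G m s)
     - (1/288) *\<^sub>R (\<Sum>m<8. \<Sum>p<8. \<Sum>q<8. \<Sum>r<8.
         F x [e m, e p, e q, e r] *\<^sub>R antisym_prod G [m, p, q, r] s)
     - (1/6) *\<^sub>R (\<Sum>p<8. f x [e p] *\<^sub>R G p (G 8 s))
     - \<kappa> *\<^sub>R G 8 s)"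


section \<open>The metric cone\<close>

text \<open>A point of the cone is a pair (r, x) with r > 0; the projection \<open>\<Pi>\<close> is \<^const>\<open>snd\<close>, and the
  radial coordinate is \<^const>\<open>fst\<close>.\<close>

definition cone_atlas :: "('m, 'e) atlas \<Rightarrow> (real \<times> 'm, real \<times> 'e) atlas" where
  "cone_atlas A = (\<lambda>(U, \<phi>). ({0<..} \<times> U, \<lambda>(r, x). (r, \<phi> x))) ` A"

definition push :: "(real \<times> 'm) vec \<Rightarrow> 'm vec" where
  "push V = (\<lambda>h. V (h \<circ> snd))"

definition pullback ::
  "('m \<Rightarrow> 'm vec list \<Rightarrow> real) \<Rightarrow> real \<times> 'm \<Rightarrow> (real \<times> 'm) vec list \<Rightarrow> real" where
  "pullback \<alpha> p Vs = \<alpha> (snd p) (map push Vs)"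

definition cone_metric ::
  "('m \<Rightarrow> 'm vec \<Rightarrow> 'm vec \<Rightarrow> real) \<Rightarrow> real \<times> 'm \<Rightarrow> (real \<times> 'm) vec \<Rightarrow> (real \<times> 'm) vec \<Rightarrow> real" where
  "cone_metric g p V W = V fst * W fst + (fst p)^2 * g (snd p) (push V) (push W)"

text \<open>The frame E at p = (r, x) whose dual coframe consists of \<open>r \<Pi>\<^sup>*e\<^sup>m\<close> (m < 8) and \<open>dr\<close>.\<close>

definition cone_frame ::
  "('m, real^8) atlas \<Rightarrow> real \<times> 'm \<Rightarrow> (9 \<Rightarrow> 'm vec) \<Rightarrow> (9 \<Rightarrow> (real \<times> 'm) vec) \<Rightarrow> bool" where
  "cone_frame A p e E \<longleftrightarrow> (\<forall>a. E a \<in> tangent (cone_atlas A) p) \<and>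
     (\<forall>m<8. push (E m) = fscale (1 / fst p) (e m) \<and> E m fst = 0) \<and>
     push (E 8) = 0 \<and> E 8 fst = 1"

definition frame_components :: "nat \<Rightarrow> (9 \<Rightarrow> 'v) \<Rightarrow> ('v list \<Rightarrow> real) \<Rightarrow> ext" where
  "frame_components k E \<alpha> = (\<chi> C. if card C = k then \<alpha> (map E (sorted_list_of_set C)) else 0)"

text \<open>Sections of \<open>\<Pi>\<^sup>*S\<close>. They are set to 0 off the cone, in order that they form a vector space
  in which distinct functions are distinct sections.\<close>

definition cone_section ::
  "('m, real^8) atlas \<Rightarrow> ('m \<Rightarrow> 's::real_vector set) \<Rightarrow> ('m, 's) trivializations \<Rightarrow>
   (real \<times> 'm \<Rightarrow> 's) \<Rightarrow> bool" where
  "cone_section A S T \<xi> \<longleftrightarrow>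
     (\<forall>r x. if r > 0 then \<xi> (r, x) \<in> S x else \<xi> (r, x) = 0) \<and>
     (\<forall>(U, \<tau>)\<in>T. \<forall>i.
        smooth_fun_on (cone_atlas A) ({0<..} \<times> U) (\<lambda>p. \<tau> (snd p) (\<xi> p) $ i))"

text \<open>The pulled back connection: along the frame vector over \<open>e\<^sub>m / r\<close> it acts on each slice
  {r} x M as \<open>D\<^sub>m / r\<close>, and along the radial direction as the derivative in the fibre, which does not
  depend on r.\<close>

definition cone_D ::
  "('m \<Rightarrow> 'm vec \<Rightarrow> 's \<Rightarrow> 's) \<Rightarrow> ('m \<Rightarrow> 'm vec \<Rightarrow> ('m \<Rightarrow> 's) \<Rightarrow> 's) \<Rightarrow>
   ('m \<Rightarrow> 'm vec list \<Rightarrow> real) \<Rightarrow> ('m \<Rightarrow> 'm vec list \<Rightarrow> real) \<Rightarrow> real \<Rightarrow>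
   real \<times> 'm \<Rightarrow> (9 \<Rightarrow> 'm vec) \<Rightarrow> 9 \<Rightarrow> (real \<times> 'm \<Rightarrow> 's) \<Rightarrow> 's::real_normed_vector" where
  "cone_D cl nabS f F \<kappa> p e a \<xi> =
     (if a < 8 then (1 / fst p) *\<^sub>R killing_D cl nabS f F \<kappa> (snd p) e a (\<lambda>y. \<xi> (fst p, y))
      else vector_derivative (\<lambda>t. \<xi> (t, snd p)) (at (fst p)))"

definition cone_Q ::
  "('m \<Rightarrow> 'm vec \<Rightarrow> 's \<Rightarrow> 's) \<Rightarrow> ('m \<Rightarrow> real) \<Rightarrow>
   ('m \<Rightarrow> 'm vec list \<Rightarrow> real) \<Rightarrow> ('m \<Rightarrow> 'm vec list \<Rightarrow> real) \<Rightarrow> real \<Rightarrow>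
   real \<times> 'm \<Rightarrow> (9 \<Rightarrow> 'm vec) \<Rightarrow> (real \<times> 'm \<Rightarrow> 's) \<Rightarrow> 's::real_vector" where
  "cone_Q cl \<Delta> f F \<kappa> p e \<xi> = killing_Q cl \<Delta> f F \<kappa> (snd p) e (\<xi> p)"

definition killing_space ::
  "('m, real^8) atlas \<Rightarrow> ('m \<Rightarrow> 'm vec \<Rightarrow> 'm vec \<Rightarrow> real) \<Rightarrow> ('m \<Rightarrow> 'm vec list \<Rightarrow> real) \<Rightarrow>
   ('m \<Rightarrow> 's::real_normed_vector set) \<Rightarrow> ('m, 's) trivializations \<Rightarrow>
   ('m \<Rightarrow> 'm vec \<Rightarrow> 's \<Rightarrow> 's) \<Rightarrow> ('m \<Rightarrow> 'm vec \<Rightarrow> ('m \<Rightarrow> 's) \<Rightarrow> 's) \<Rightarrow> ('m \<Rightarrow> real) \<Rightarrow>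
   ('m \<Rightarrow> 'm vec list \<Rightarrow> real) \<Rightarrow> ('m \<Rightarrow> 'm vec list \<Rightarrow> real) \<Rightarrow> real \<Rightarrow>
   (real \<times> 'm \<Rightarrow> 's) set" where
  "killing_space A g vol S T cl nabS \<Delta> f F \<kappa> = {\<xi>. cone_section A S T \<xi> \<and>
     (\<forall>r>0. \<forall>x e. oriented_frame A g vol x e \<longrightarrow>
        (\<forall>a. cone_D cl nabS f F \<kappa> (r, x) e a \<xi> = 0) \<and> cone_Q cl \<Delta> f F \<kappa> (r, x) e \<xi> = 0)}"

definition orthonormal_pair ::
  "('m \<Rightarrow> 's \<Rightarrow> 's \<Rightarrow> real) \<Rightarrow> (real \<times> 'm \<Rightarrow> 's) \<Rightarrow> (real \<times> 'm \<Rightarrow> 's) \<Rightarrow> bool" where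
  "orthonormal_pair B \<xi>\<^sub>1 \<xi>\<^sub>2 \<longleftrightarrow> (\<forall>r>0. \<forall>x.
     B x (\<xi>\<^sub>1 (r, x)) (\<xi>\<^sub>1 (r, x)) = 1 \<and> B x (\<xi>\<^sub>2 (r, x)) (\<xi>\<^sub>2 (r, x)) = 1 \<and>
     B x (\<xi>\<^sub>1 (r, x)) (\<xi>\<^sub>2 (r, x)) = 0 \<and> B x (\<xi>\<^sub>2 (r, x)) (\<xi>\<^sub>1 (r, x)) = 0)"

lemma cone_frame_orthonormal:
  assumes "oriented_riemannian_8_manifold A g vol" "oriented_frame A g vol x e" "r > 0"
    and "cone_frame A (r, x) e E"
  shows "cone_metric g (r, x) (E a) (E b) = (if a = b then 1 else 0)"
proof -
  interpret oriented_riemannian_8_manifold A g vol by fact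
  have zero: "0 \<in> tangent A x" by (simp add: tangent_def)
  have lin1: "g x (fscale c u) w = c * g x u w" if "u \<in> tangent A x" "w \<in> tangent A x" for c u w
    using metric_linear[of u x u w c 0] that by (simp add: fscale_def zero_fun_def[symmetric])
  have sc: "fscale c u \<in> tangent A x" if "u \<in> tangent A x" for c u
    using that by (auto simp: tangent_def fscale_def algebra_simps)
  have z1: "g x 0 w = 0" if "w \<in> tangent A x" for w
    using lin1[OF zero that, of 0] by (simp add: fscale_def zero_fun_def)
  have z2: "g x w 0 = 0" if "w \<in> tangent A x" for w
    using z1[OF that] metric_sym[OF zero that] by simp
  have lin2: "g x (fscale c u) (fscale c w) = c * c * g x u w"
    if "u \<in> tangent A x" "w \<in> tangent A x" for c u w
    using lin1[OF that(1) sc[OF that(2)]] lin1[OF that(2) that(1)]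
      metric_sym[OF that(1) sc[OF that(2)]] metric_sym[OF that] by simp
  have E8: "push (E 8) = 0" "E 8 fst = 1" using assms(4) by (auto simp: cone_frame_def)
  have Em: "push (E m) = fscale (1 / r) (e m)" "E m fst = 0" "e m \<in> tangent A x" if "m < 8" for m
    using assms(2,4) that by (auto simp: cone_frame_def oriented_frame_def)
  have ee: "g x (e m) (e n) = (if m = n then 1 else 0)" if "m < 8" "n < 8" for m n
    using assms(2) that by (auto simp: oriented_frame_def)
  have top: "c < 8 \<or> c = 8" for c :: 9
    using index_cases by blast
  show ?thesis
    using top[of a] top[of b] E8 Em[of a] Em[of b] ee[of a b] assms(3) zero
      z1[OF zero] z1[OF sc[OF Em(3)]] z2[OF sc[OF Em(3)]] lin2[of "e a" "e b" "1 / r"]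
    by (auto simp: cone_metric_def power2_eq_square)
qed


section \<open>Products of forms\<close>

definition perm_sign :: "9 set \<Rightarrow> 9 set \<Rightarrow> real" where
  "perm_sign C D = (-1) ^ card {(c, d). c \<in> C \<and> d \<in> D \<and> d < c}"

text \<open>\<open>e\<^sup>C \<and> e\<^sup>D\<close> is \<open>perm_sign C D\<close> times the basis element of the union if C and D are disjoint,
  and 0 otherwise.\<close>

definition wedge :: "ext \<Rightarrow> ext \<Rightarrow> ext" (infixr "\<^bold>\<and>" 80) where
  "\<omega> \<^bold>\<and> \<eta> = (\<chi> C. \<Sum>D\<in>Pow C. perm_sign D (C - D) * (\<omega> $ D) * (\<eta> $ (C - D)))"

definition interior_prod :: "ext \<Rightarrow> ext \<Rightarrow> ext" ("\<iota>") where
  "\<iota> \<omega> = adjoint (wedge \<omega>)"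

definition coframe :: "9 \<Rightarrow> ext" where
  "coframe a = axis {a} 1"

text \<open>For a covector, \<open>\<iota>\<close> is the contraction with the metrically dual vector.\<close>

fun contracted_wedge :: "nat \<Rightarrow> ext \<Rightarrow> ext \<Rightarrow> ext" where
  "contracted_wedge 0 \<omega> \<eta> = \<omega> \<^bold>\<and> \<eta>"
| "contracted_wedge (Suc k) \<omega> \<eta> =
     (\<Sum>a\<in>UNIV. contracted_wedge k (\<iota> (coframe a) \<omega>) (\<iota> (coframe a) \<eta>))"

definition gprod :: "nat \<Rightarrow> ext \<Rightarrow> ext \<Rightarrow> ext" ("\<triangle>") where
  "\<triangle> k \<omega> \<eta> = (1 / fact k) *\<^sub>R contracted_wedge k \<omega> \<eta>"

definition grading :: "ext \<Rightarrow> ext" where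
  "grading \<omega> = (\<chi> C. (-1) ^ card C * (\<omega> $ C))"

definition reversion :: "ext \<Rightarrow> ext" where
  "reversion \<omega> = (\<chi> C. (-1) ^ (card C * (card C - 1) div 2) * (\<omega> $ C))"

definition geometric_prod :: "ext \<Rightarrow> ext \<Rightarrow> ext" (infixl "\<diamondop>" 78) where
  "\<omega> \<diamondop> \<eta> =
     (\<Sum>k\<le>4. ((-1) ^ k / fact (2 * k)) *\<^sub>R contracted_wedge (2 * k) \<omega> \<eta>)
     + (\<Sum>k\<le>4. ((-1) ^ (k + 1) / fact (2 * k + 1)) *\<^sub>R contracted_wedge (2 * k + 1) (grading \<omega>) \<eta>)"

definition vol_cone :: ext where
  "vol_cone = axis UNIV 1"

definition hodge :: "ext \<Rightarrow> ext" where
  "hodge \<eta> = (\<chi> C. perm_sign (- C) C * (\<eta> $ (- C)))"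

definition twisted_hodge :: "ext \<Rightarrow> ext" where
  "twisted_hodge \<omega> = \<omega> \<diamondop> vol_cone"

definition P_plus :: "ext \<Rightarrow> ext" where
  "P_plus \<omega> = (1/2) *\<^sub>R (\<omega> + twisted_hodge \<omega>)"

definition P_less :: "ext \<Rightarrow> ext" where
  "P_less \<omega> = (\<chi> C. if card C \<le> 4 then \<omega> $ C else 0)"

definition trunc_prod :: "ext \<Rightarrow> ext \<Rightarrow> ext" (infixl "\<diamondop>\<^sub>+" 78) where
  "\<omega> \<diamondop>\<^sub>+ \<eta> = 2 *\<^sub>R P_less (P_plus \<omega> \<diamondop> P_plus \<eta>)"

definition rank_part :: "nat \<Rightarrow> ext \<Rightarrow> ext" where
  "rank_part k \<omega> = (\<chi> C. if card C = k then \<omega> $ C else 0)"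

lemma interior_prod_adjoint: "\<iota> \<omega> \<eta> \<bullet> \<rho> = \<eta> \<bullet> (\<omega> \<^bold>\<and> \<rho>)"
proof -
  have "linear (wedge \<omega>)"
    by (intro linearI)
       (auto simp: wedge_def vec_eq_iff algebra_simps sum.distrib sum_distrib_left)
  from adjoint_works[OF this, of \<rho> \<eta>] show ?thesis
    by (simp add: interior_prod_def inner_commute)
qed

lemma wedge_hodge:
  assumes "rank_part k \<omega> = \<omega>" "rank_part k \<eta> = \<eta>"
  shows "\<omega> \<^bold>\<and> hodge \<eta> = (\<omega> \<bullet> \<eta>) *\<^sub>R vol_cone"
proof (subst vec_eq_iff, intro allI)
  fix C :: "9 set"
  have \<omega>: "\<omega> $ D = 0" if "card D \<noteq> k" for D
    using assms(1) that by (metis (mono_tags, lifting) rank_part_def vec_lambda_beta)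
  have \<eta>: "\<eta> $ D = 0" if "card D \<noteq> k" for D
    using assms(2) that by (metis (mono_tags, lifting) rank_part_def vec_lambda_beta)
  show "(\<omega> \<^bold>\<and> hodge \<eta>) $ C = ((\<omega> \<bullet> \<eta>) *\<^sub>R vol_cone) $ C"
  proof (cases "C = UNIV")
    case True
    have "perm_sign D (- D) * perm_sign D (- D) = 1" for D
      by (simp add: perm_sign_def minus_one_power_iff)
    then have eq: "perm_sign D (- D) * (\<omega> $ D) * (perm_sign D (- D) * (\<eta> $ D)) = \<omega> $ D * \<eta> $ D" for D
      by (metis (no_types, lifting) mult.assoc mult.commute mult_1)
    show ?thesis
      using True by (simp add: eq wedge_def hodge_def vol_cone_def axis_def inner_vec_def Compl_eq_Diff_UNIV[symmetric])
  next
    case False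
    have "perm_sign D (C - D) * (\<omega> $ D) * (perm_sign (- (C - D)) (C - D) * (\<eta> $ (- (C - D)))) = 0"
      if "D \<subseteq> C" for D
    proof (cases "card D = k")
      case True
      have "D \<subset> - (C - D)" using False that by auto
      then have "card D < card (- (C - D))" by (intro psubset_card_mono) auto
      then show ?thesis using True \<eta> by simp
    qed (simp add: \<omega>)
    then show ?thesis
      using False by (auto simp: wedge_def hodge_def vol_cone_def axis_def intro!: sum.neutral)
  qed
qed

text \<open>The exterior form with components \<open>\<B>(s, \<gamma>\<^sup>a\<^sup>.\<^sup>.\<^sup>.\<^sup>b t)\<close> of rank k.\<close>

definition bilinear_form ::
  "('s \<Rightarrow> 's \<Rightarrow> real) \<Rightarrow> (9 \<Rightarrow> 's \<Rightarrow> 's) \<Rightarrow> nat \<Rightarrow> 's \<Rightarrow> 's::real_vector \<Rightarrow> ext" where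
  "bilinear_form b G k s t =
     (\<chi> C. if card C = k then b s (antisym_prod G (sorted_list_of_set C) t) else 0)"

text \<open>The equations \<open>L = 0\<close>, with L in the list Ls, are listed by increasing rank, starting with
  rank 0.\<close>

definition amounts_by_rank :: "ext \<Rightarrow> ext list \<Rightarrow> bool" where
  "amounts_by_rank R Ls \<longleftrightarrow> (R = 0 \<longleftrightarrow> (\<forall>L\<in>set Ls. L = 0)) \<and>
     (\<forall>k<length Ls. rank_part k R = 0 \<longleftrightarrow> Ls ! k = 0)"

end

theory Submission
  imports Defs "HOL-Combinatorics.Multiset_Permutations"
begin

text \<open>On basis elements the geometric product is \<open>e\<^sup>C \<diamondop> e\<^sup>D = perm_sign C D e\<^sup>C\<^sup>+\<^sup>D\<close>, where + is the
  symmetric difference, and \<^const>\<open>perm_sign\<close> is a bicharacter for +. Hence wedge, contraction,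
  generalized and Hodge products of homogeneous forms are signs times rank parts of geometric
  products, and since \<open>\<nu>\<close> is central with square 1, \<open>\<omega> \<diamondop>\<^sub>+ \<eta>\<close> is the part of rank at most 4 of
  \<open>\<omega> \<diamondop> \<eta> + \<omega> \<diamondop> \<eta> \<diamondop> \<nu>\<close>. Reversing the products turns \<open>E \<diamondop> \<tau>(Q)\<close> into \<open>Q \<diamondop> E\<close> up to a sign for each
  pair of ranks, so that the relations with - and + each retain one half of the terms.

  The operator \<open>\<Sum>\<^sub>C \<B>(x, \<gamma>\<^sup>C u) \<gamma>\<^sup>C s\<close> of x commutes with the Clifford action and is therefore a multiple
  \<open>c \<B>(s, u) x\<close> of x (Fierz), with c > 0. So E acts as a nonzero multiple of \<open>s \<mapsto> \<B>(s, \<eta>\<^sub>2) \<eta>\<^sub>1\<close>, and the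
  two products \<open>Q \<diamondop>\<^sub>+ E\<close> and \<open>E \<diamondop>\<^sub>+ \<tau>(Q)\<close> vanish iff Q annihilates \<open>\<eta>\<^sub>1\<close> and \<open>\<eta>\<^sub>2\<close>, respectively.\<close>


section \<open>The geometric product on basis elements\<close>

text \<open>Two features of dimension 9 carry the separation on ranks. Since 9 is odd, n and 9 - n
  have opposite parity, so for factors of ranks p and q the parity of n + p + q decides whether rank
  n of the truncated product comes from rank n of the geometric product or, through \<nu>, from rank
  9 - n; the latter are the terms with a Hodge operator. And reversion fixes \<nu>, so both kinds
  get the same sign when the factors are exchanged. On the pinor side the obstacle is that \<nu>
  acts as the identity: a form is determined by its action only among the forms fixed by \<nu>. The
  truncated product is the lower half of such a form, which is why its vanishing can be tested on
  pinors. The form built from ranks 1 to 4 is likewise the lower half of the complete Fierz sum,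
  because the absent rank 0 coefficient is the pairing of two orthogonal pinors. Only the sign of
  the Fierz constant c is extracted, since all claims about the action concern vanishing.\<close>

lemma prod_sym_diff_involutive:
  fixes f :: "'a \<Rightarrow> 'b::comm_ring_1"
  assumes "finite C" "finite D" "\<And>x. f x * f x = 1"
  shows "prod f (sym_diff C D) = prod f C * prod f D"
proof -
  have C: "prod f C = prod f (C - D) * prod f (C \<inter> D)"
    and D: "prod f D = prod f (D - C) * prod f (C \<inter> D)"
    using assms(1,2) by (subst prod.union_disjoint[symmetric]; auto intro!: prod.cong)+
  have 1: "prod f (C \<inter> D) * prod f (C \<inter> D) = 1"
    by (simp add: prod.distrib[symmetric] assms(3))
  have S: "prod f (sym_diff C D) = prod f (C - D) * prod f (D - C)"
    using assms(1,2) by (subst prod.union_disjoint) auto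
  have "prod f C * prod f D = prod f (C - D) * prod f (D - C) * (prod f (C \<inter> D) * prod f (C \<inter> D))"
    unfolding C D by (simp add: mult_ac)
  then show ?thesis by (simp add: 1 S)
qed

text \<open>The inversion count becomes a double product of signs, so that multiplicativity in each
  argument reduces to \<open>prod_sym_diff_involutive\<close>.\<close>

lemma perm_sign_prod: "perm_sign C D = (\<Prod>c\<in>C. \<Prod>d\<in>D. if d < c then -1 else 1)"
proof -
  have "{(c, d). c \<in> C \<and> d \<in> D \<and> d < c} = {z \<in> C \<times> D. snd z < fst z}" by auto
  then show ?thesis
    unfolding prod.cartesian_product perm_sign_def
    by (simp add: case_prod_unfold prod.If_cases Int_def)
qed

lemma perm_sign_left: "perm_sign (sym_diff C D) X = perm_sign C X * perm_sign D X"
  unfolding perm_sign_prod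
  by (rule prod_sym_diff_involutive) (auto simp: prod.distrib[symmetric] intro!: prod.neutral)

lemma perm_sign_right: "perm_sign X (sym_diff C D) = perm_sign X C * perm_sign X D"
  unfolding perm_sign_prod prod.distrib[symmetric]
  by (intro prod.cong prod_sym_diff_involutive) auto

lemma perm_sign_square [simp]: "perm_sign C D * perm_sign C D = 1"
  by (simp add: perm_sign_def power_mult_distrib[symmetric])

lemma perm_sign_square_left [simp]: "perm_sign C D * (perm_sign C D * x) = x"
  by (metis mult.assoc mult_1 perm_sign_square)

lemma perm_sign_empty [simp]: "perm_sign {} D = 1" "perm_sign C {} = 1"
  by (simp_all add: perm_sign_def)

lemma perm_sign_self_singleton [simp]: "perm_sign {a} {a} = 1"
  by (simp add: perm_sign_prod)

text \<open>The commutation sign of \<open>e\<^sup>a\<close> with \<open>e\<^sup>C\<close>: each c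
  \<noteq> a in C contributes an inversion to exactly one of the two factors, and c = a to
  neither.\<close>

lemma perm_sign_singleton_commute:
  "perm_sign {a} C * perm_sign C {a} = (-1) ^ card (C - {a})"
proof -
  have "perm_sign {a} C * perm_sign C {a} = (\<Prod>c\<in>C. if c = a then 1 else -1)"
    unfolding perm_sign_prod by (auto simp: prod.distrib[symmetric] intro!: prod.cong)
  also have "\<dots> = (\<Prod>c\<in>C - {a}. -1)"
    by (rule prod.mono_neutral_cong_right) auto
  finally show ?thesis by simp
qed

lemma perm_sign_insert_left:
  "a \<notin> C \<Longrightarrow> perm_sign (insert a C) D = perm_sign {a} D * perm_sign C D"
  using perm_sign_left[of "{a}" C D] by (simp add: insert_Diff_if Un_commute)

lemma perm_sign_insert_right:
  "a \<notin> D \<Longrightarrow> perm_sign C (insert a D) = perm_sign C {a} * perm_sign C D"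
  using perm_sign_right[of C "{a}" D] by (simp add: insert_Diff_if Un_commute)

text \<open>Adjoining \<open>a\<close> contributes \<open>perm_sign {a} C * perm_sign C {a}\<close>,
  one sign for each element of \<open>C\<close>, so the exponents are the triangular numbers.
  Reversion thereby becomes the quadratic form of the bicharacter, see
  \<open>reversion_nth\<close>.\<close>

lemma perm_sign_self: "perm_sign C C = (-1) ^ (card C * (card C - 1) div 2)"
proof (induction C rule: finite_induct[OF finite])
  case (2 a C)
  have "perm_sign (insert a C) (insert a C) = (perm_sign {a} C * perm_sign C {a}) * perm_sign C C"
    by (simp add: perm_sign_insert_left[OF 2(2)] perm_sign_insert_right[OF 2(2)] mult_ac)
  also have "\<dots> = (-1) ^ card C * (-1) ^ (card C * (card C - 1) div 2)"
    using 2 by (simp add: perm_sign_singleton_commute)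
  also have "\<dots> = (-1) ^ (Suc (card C) * card C div 2)"
  proof -
    have "Suc n * n div 2 = n + n * (n - 1) div 2" for n :: nat
      by (cases n) auto
    then show ?thesis by (simp add: power_add)
  qed
  finally show ?case using 2 by simp
qed simp

lemma sym_diff_cancel: "sym_diff C (sym_diff C D) = D"
  by blast

lemma sum_sym_diff: "(\<Sum>D\<in>UNIV. h (sym_diff C D)) = (\<Sum>D\<in>(UNIV :: 'a::finite set set). h D)"
  by (rule sum.reindex_bij_witness[of _ "sym_diff C" "sym_diff C"]) (auto simp: sym_diff_cancel)

lemma interior_prod_nth:
  "\<iota> \<omega> \<eta> $ C = (\<Sum>D\<in>Pow (- C). perm_sign D C * \<omega> $ D * \<eta> $ (D \<union> C))"
proof -
  have "\<iota> \<omega> \<eta> $ C = \<eta> \<bullet> (\<omega> \<^bold>\<and> axis C 1)"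
    by (simp add: interior_prod_adjoint[symmetric] inner_axis)
  also have "\<dots> = (\<Sum>X\<in>UNIV. \<Sum>D\<in>Pow X. if X - D = C then perm_sign D C * \<omega> $ D * \<eta> $ X else 0)"
    by (auto simp: inner_vec_def wedge_def sum_distrib_left axis_def intro!: sum.cong)
  also have "\<dots> = (\<Sum>X\<in>UNIV. \<Sum>D\<in>UNIV. if D \<subseteq> X \<and> X - D = C then perm_sign D C * \<omega> $ D * \<eta> $ X else 0)"
    by (intro sum.cong refl sum.mono_neutral_cong_left) auto
  also have "\<dots> = (\<Sum>D\<in>UNIV. \<Sum>X\<in>UNIV. if D \<subseteq> X \<and> X - D = C then perm_sign D C * \<omega> $ D * \<eta> $ X else 0)"
    by (rule sum.swap)
  also have "\<dots> = (\<Sum>D\<in>UNIV. \<Sum>X\<in>UNIV. if X = D \<union> C then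
      if D \<subseteq> - C then perm_sign D C * \<omega> $ D * \<eta> $ X else 0 else 0)"
  proof -
    have "D \<subseteq> X \<and> X - D = C \<longleftrightarrow> X = D \<union> C \<and> D \<subseteq> - C" for D X by blast
    then show ?thesis by (intro sum.cong refl) simp
  qed
  also have "\<dots> = (\<Sum>D\<in>UNIV. if D \<subseteq> - C then perm_sign D C * \<omega> $ D * \<eta> $ (D \<union> C) else 0)"
    by simp
  also have "\<dots> = (\<Sum>D\<in>Pow (- C). perm_sign D C * \<omega> $ D * \<eta> $ (D \<union> C))"
    by (rule sum.mono_neutral_cong_right) auto
  finally show ?thesis .
qed

lemma interior_coframe_nth:
  "\<iota> (coframe a) \<eta> $ C = (if a \<in> C then 0 else perm_sign {a} C * \<eta> $ insert a C)"
proof -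
  have "\<iota> (coframe a) \<eta> $ C = (\<Sum>D\<in>Pow (- C). if D = {a} then perm_sign {a} C * \<eta> $ insert a C else 0)"
    unfolding interior_prod_nth by (rule sum.cong) (simp_all add: coframe_def axis_def)
  then show ?thesis by simp
qed

text \<open>The sign of \<open>e\<^sup>C \<triangle>\<^sub>k e\<^sup>D\<close> relative to \<^term>\<open>perm_sign C D\<close>, if C has p elements.\<close>

definition contraction_sign :: "nat \<Rightarrow> nat \<Rightarrow> real" where
  "contraction_sign k p = (-1) ^ (k * p + k * (k + 1) div 2)"

text \<open>The sign \<open>(-1) ^ p\<close> is that of moving \<open>e\<^sup>a\<close> past the p
  factors that a contraction with index a leaves in the first form.\<close>

lemma contraction_sign_Suc:
  "contraction_sign (Suc k) (Suc p) = (-1) ^ p * contraction_sign k p"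
proof -
  have "Suc k * (Suc k + 1) div 2 = k + 1 + k * (k + 1) div 2" by simp
  then have e: "Suc k * Suc p + Suc k * (Suc k + 1) div 2
      = p + (k * p + k * (k + 1) div 2) + 2 * (k + 1)" by simp
  show ?thesis unfolding contraction_sign_def e by (simp add: power_add power_mult)
qed

text \<open>The indices shared by \<open>D\<close> and \<open>sym_diff D C\<close> are exactly those
  of \<open>D - C\<close>, so k contractions select the \<open>D\<close> with
  \<open>card (D - C) = k\<close>; \<open>fact k\<close> counts the orders in which the shared
  indices are contracted.\<close>

lemma contracted_wedge_nth:
  "contracted_wedge k \<omega> \<eta> $ C = fact k * (\<Sum>D\<in>UNIV. if card (D - C) = k then
     contraction_sign k (card D) * perm_sign D (sym_diff D C) * \<omega> $ D * \<eta> $ sym_diff D C else 0)"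
proof (induction k arbitrary: \<omega> \<eta>)
  case 0
  have "(\<Sum>D\<in>Pow C. perm_sign D (C - D) * \<omega> $ D * \<eta> $ (C - D)) =
      (\<Sum>D\<in>UNIV. if card (D - C) = 0 then
         contraction_sign 0 (card D) * perm_sign D (sym_diff D C) * \<omega> $ D * \<eta> $ sym_diff D C else 0)"
  proof (rule sum.mono_neutral_cong_left)
    fix D assume "D \<in> Pow C"
    then have "D - C = {}" "sym_diff D C = C - D" by auto
    then show "perm_sign D (C - D) * \<omega> $ D * \<eta> $ (C - D) = (if card (D - C) = 0 then
         contraction_sign 0 (card D) * perm_sign D (sym_diff D C) * \<omega> $ D * \<eta> $ sym_diff D C else 0)"
      by (simp add: contraction_sign_def)
  qed auto
  then show ?case by (simp add: wedge_def)
next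
  case (Suc k)
  define H where "H X = contraction_sign (Suc k) (card X) * perm_sign X (sym_diff X C) * \<omega> $ X * \<eta> $ sym_diff X C" for X
  \<comment> \<open>Contraction with index a takes the coefficients at \<open>insert a D\<close> and
    \<open>insert a D'\<close> to those at \<open>D\<close> and \<open>D'\<close>, so the sum is to
    be reindexed by X = \<open>insert a D\<close>.\<close>
  have step: "(if card (D - C) = k then contraction_sign k (card D) * perm_sign D (sym_diff D C) *
        \<iota> (coframe a) \<omega> $ D * \<iota> (coframe a) \<eta> $ sym_diff D C else 0)
      = (if a \<notin> D \<and> a \<notin> C \<and> card (insert a D - C) = Suc k then H (insert a D) else 0)" for a D
  proof (cases "a \<in> D \<or> a \<in> C")
    case True
    then show ?thesis by (auto simp: interior_coframe_nth)
  next
    case False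
    define D' where "D' = sym_diff D C"
    have a: "a \<notin> D" "a \<notin> D'" "a \<notin> C" using False by (auto simp: D'_def)
    have i: "sym_diff (insert a D) C = insert a D'" using a by (auto simp: D'_def)
    have card: "card (insert a D - C) = Suc (card (D - C))"
      using a by (simp add: insert_Diff_if)
    have s: "perm_sign (insert a D) (insert a D') = (-1) ^ card D *
        (perm_sign {a} D * perm_sign {a} D' * perm_sign D D')"
    proof -
      have "(-1) ^ card D = perm_sign {a} D * perm_sign D {a}"
        using a by (simp add: perm_sign_singleton_commute)
      then show ?thesis
        by (simp add: perm_sign_insert_left[OF a(1)] perm_sign_insert_right[OF a(2)] mult_ac)
    qed
    have m: "(-1) ^ n * ((-1) ^ n * x) = (x :: real)" for n x
      by (simp add: mult.assoc[symmetric] power_mult_distrib[symmetric])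
    show ?thesis
      using a unfolding card i H_def D'_def[symmetric]
      by (simp add: interior_coframe_nth contraction_sign_Suc s mult_ac m)
  qed
  have "contracted_wedge (Suc k) \<omega> \<eta> $ C = fact k * (\<Sum>a\<in>UNIV. \<Sum>D\<in>UNIV.
      if a \<notin> D \<and> a \<notin> C \<and> card (insert a D - C) = Suc k then H (insert a D) else 0)"
    by (simp add: Suc step sum_distrib_left)
  also have "(\<Sum>a\<in>UNIV. \<Sum>D\<in>UNIV.
      if a \<notin> D \<and> a \<notin> C \<and> card (insert a D - C) = Suc k then H (insert a D) else 0)
    = (\<Sum>a\<in>UNIV. \<Sum>X\<in>UNIV. if a \<in> X - C \<and> card (X - C) = Suc k then H X else 0)"
  proof (rule sum.cong[OF refl])
    fix a
    have "(\<Sum>D\<in>UNIV. if a \<notin> D \<and> a \<notin> C \<and> card (insert a D - C) = Suc k then H (insert a D) else 0)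
        = (\<Sum>D\<in>{D. a \<notin> D}. if a \<notin> C \<and> card (insert a D - C) = Suc k then H (insert a D) else 0)"
      by (rule sum.mono_neutral_cong_right) simp_all
    also have "\<dots> = (\<Sum>X\<in>{X. a \<in> X}. if a \<notin> C \<and> card (X - C) = Suc k then H X else 0)"
      by (rule sum.reindex_bij_witness[of _ "\<lambda>X. X - {a}" "insert a"]) (simp_all add: insert_absorb)
    also have "\<dots> = (\<Sum>X\<in>UNIV. if a \<in> X - C \<and> card (X - C) = Suc k then H X else 0)"
      by (rule sum.mono_neutral_cong_left) simp_all
    finally show "(\<Sum>D\<in>UNIV. if a \<notin> D \<and> a \<notin> C \<and> card (insert a D - C) = Suc k then H (insert a D) else 0)
        = (\<Sum>X\<in>UNIV. if a \<in> X - C \<and> card (X - C) = Suc k then H X else 0)" .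
  qed
  also have "\<dots> = (\<Sum>X\<in>UNIV. \<Sum>a\<in>UNIV. if a \<in> X - C \<and> card (X - C) = Suc k then H X else 0)"
    by (rule sum.swap)
  \<comment> \<open>Each X is reached once for every a in \<open>X - C\<close>, which supplies the
    new factor of the factorial.\<close>
  also have "\<dots> = (\<Sum>X\<in>UNIV. if card (X - C) = Suc k then real (Suc k) * H X else 0)"
  proof (rule sum.cong[OF refl])
    fix X
    have "(\<Sum>a\<in>UNIV. if a \<in> X - C then H X else 0) = card (X - C) * H X"
      by (simp add: sum.If_cases set_diff_eq)
    then show "(\<Sum>a\<in>UNIV. if a \<in> X - C \<and> card (X - C) = Suc k then H X else 0)
        = (if card (X - C) = Suc k then real (Suc k) * H X else 0)"
      by simp
  qed
  finally show ?case
    by (simp add: H_def sum_distrib_left if_distrib mult_ac cong: if_cong)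
qed

text \<open>The signs in the definition make every contraction order contribute with the plain sign:
  \<open>contraction_sign (2 * k)\<close> is \<open>(-1) ^ k\<close> for every rank, and the rank
  dependent part of \<open>contraction_sign (2 * k + 1)\<close> is undone by \<open>grading\<close>.
  Each D then counts once, at the order \<open>card (D - C)\<close>.\<close>

lemma geometric_prod_nth:
  "(\<omega> \<diamondop> \<eta>) $ C = (\<Sum>D\<in>UNIV. perm_sign D (sym_diff D C) * \<omega> $ D * \<eta> $ sym_diff D C)"
proof -
  define h where "h D = perm_sign D (sym_diff D C) * \<omega> $ D * \<eta> $ sym_diff D C" for D
  have e: "((-1) ^ k / fact (2 * k)) * contracted_wedge (2 * k) \<omega> \<eta> $ C
      = (\<Sum>D\<in>UNIV. if card (D - C) = 2 * k then h D else 0)" for k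
  proof -
    have "2 * k * (2 * k + 1) div 2 = k + 2 * (k * k)" by simp
    then have "contraction_sign (2 * k) p = (-1) ^ k" for p
      by (simp add: contraction_sign_def power_add power_mult mult.assoc)
    then show ?thesis
      by (simp add: contracted_wedge_nth sum_distrib_left h_def if_distrib mult_ac
          power_mult_distrib[symmetric] cong: if_cong)
  qed
  have o: "((-1) ^ (k + 1) / fact (2 * k + 1)) * contracted_wedge (2 * k + 1) (grading \<omega>) \<eta> $ C
      = (\<Sum>D\<in>UNIV. if card (D - C) = 2 * k + 1 then h D else 0)" for k
  proof -
    have "(2 * k + 1) * (2 * k + 1 + 1) div 2 = 2 * (k * k) + 2 * k + k + 1" by simp
    then have "contraction_sign (2 * k + 1) p = (-1) ^ p * (-1) ^ (k + 1)" for p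
      unfolding contraction_sign_def by (simp add: power_add power_mult)
    then have s: "(-1) ^ (k + 1) * (contraction_sign (2 * k + 1) p * (-1) ^ p) = 1" for p
      by (simp add: mult_ac power_mult_distrib[symmetric])
    have "((-1) ^ (k + 1) / fact (2 * k + 1)) * contracted_wedge (2 * k + 1) (grading \<omega>) \<eta> $ C
      = (\<Sum>D\<in>UNIV. if card (D - C) = 2 * k + 1 then
          ((-1) ^ (k + 1) * (contraction_sign (2 * k + 1) (card D) * (-1) ^ card D)) * h D else 0)"
    proof -
      have f: "(c / fact n) * (fact n * x) = c * x" for c x :: real and n
        by simp
      show ?thesis
        unfolding contracted_wedge_nth f sum_distrib_left
        by (rule sum.cong[OF refl]) (simp only: h_def grading_def vec_lambda_beta mult_ac mult_zero_left mult_zero_right split: if_split, simp)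
    qed
    then show ?thesis by (simp only: s mult_1)
  qed
  have "(\<omega> \<diamondop> \<eta>) $ C = (\<Sum>k\<le>4. \<Sum>D\<in>UNIV. if card (D - C) = 2 * k then h D else 0)
      + (\<Sum>k\<le>4. \<Sum>D\<in>UNIV. if card (D - C) = 2 * k + 1 then h D else 0)"
    by (simp only: geometric_prod_def vector_add_component sum_component vector_scaleR_component real_scaleR_def e o)
  also have "\<dots> = (\<Sum>D\<in>UNIV. \<Sum>k\<le>4. (if card (D - C) = 2 * k then h D else 0)
      + (if card (D - C) = 2 * k + 1 then h D else 0))"
    unfolding sum.distrib by (subst (1 2) sum.swap) simp
  also have "\<dots> = (\<Sum>D\<in>UNIV. h D)"
  proof (rule sum.cong[OF refl])
    fix D
    \<comment> \<open>Contraction orders reach at most 9 = 2 * 4 + 1, so the two sums up to 4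
      exhaust them.\<close>
    have "card (D - C) \<le> 9" using card_mono[of UNIV "D - C"] by simp
    then have k: "card (D - C) div 2 \<le> 4" by linarith
    have "(\<Sum>k\<le>4. (if card (D - C) = 2 * k then h D else 0) + (if card (D - C) = 2 * k + 1 then h D else 0))
        = (\<Sum>k\<le>4. if k = card (D - C) div 2 then h D else 0)"
    proof (rule sum.cong[OF refl])
      fix k
      have "k = n div 2 \<longleftrightarrow> n = 2 * k \<or> n = 2 * k + 1" for n :: nat by presburger
      then show "(if card (D - C) = 2 * k then h D else 0) + (if card (D - C) = 2 * k + 1 then h D else 0)
        = (if k = card (D - C) div 2 then h D else 0)" by auto
    qed
    then show "(\<Sum>k\<le>4. (if card (D - C) = 2 * k then h D else 0) + (if card (D - C) = 2 * k + 1 then h D else 0))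
        = h D" using k by simp
  qed
  finally show ?thesis by (simp add: h_def)
qed

lemma geometric_prod_bilinear: "bilinear (\<diamondop>)"
  unfolding bilinear_def
  by (auto intro!: linearI simp: vec_eq_iff geometric_prod_nth algebra_simps sum.distrib sum_distrib_left)

lemmas geometric_prod_simps =
  bilinear_ladd[OF geometric_prod_bilinear] bilinear_radd[OF geometric_prod_bilinear]
  bilinear_lsub[OF geometric_prod_bilinear] bilinear_rsub[OF geometric_prod_bilinear]
  bilinear_lmul[OF geometric_prod_bilinear] bilinear_rmul[OF geometric_prod_bilinear]
  bilinear_lzero[OF geometric_prod_bilinear] bilinear_rzero[OF geometric_prod_bilinear]

text \<open>A bicharacter is a 2-cocycle: after the substitution of \<open>sym_diff D X\<close> for
  X the signs of both sides agree term by term.\<close>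

lemma geometric_prod_assoc: "(\<omega> \<diamondop> \<eta>) \<diamondop> \<zeta> = \<omega> \<diamondop> (\<eta> \<diamondop> \<zeta>)"
proof (subst vec_eq_iff, intro allI)
  fix C :: "9 set"
  let ?t = "\<lambda>D X. perm_sign D (sym_diff D C) * perm_sign X (sym_diff X (sym_diff D C))
    * \<omega> $ D * \<eta> $ X * \<zeta> $ sym_diff X (sym_diff D C)"
  have "((\<omega> \<diamondop> \<eta>) \<diamondop> \<zeta>) $ C = (\<Sum>X\<in>UNIV. \<Sum>D\<in>UNIV.
      perm_sign X (sym_diff X C) * perm_sign D (sym_diff D X) * \<omega> $ D * \<eta> $ sym_diff D X * \<zeta> $ sym_diff X C)"
    by (simp add: geometric_prod_nth sum_distrib_left sum_distrib_right mult_ac)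
  also have "\<dots> = (\<Sum>D\<in>UNIV. \<Sum>X\<in>UNIV.
      perm_sign X (sym_diff X C) * perm_sign D (sym_diff D X) * \<omega> $ D * \<eta> $ sym_diff D X * \<zeta> $ sym_diff X C)"
    by (rule sum.swap)
  also have "\<dots> = (\<Sum>D\<in>UNIV. \<Sum>X\<in>UNIV. ?t D X)"
  proof (rule sum.cong[OF refl])
    fix D
    have 1: "sym_diff D (sym_diff D X) = X" and 2: "sym_diff (sym_diff D X) C = sym_diff X (sym_diff D C)" for X
      by blast+
    show "(\<Sum>X\<in>UNIV. perm_sign X (sym_diff X C) * perm_sign D (sym_diff D X)
        * \<omega> $ D * \<eta> $ sym_diff D X * \<zeta> $ sym_diff X C) = (\<Sum>X\<in>UNIV. ?t D X)"
      by (subst sum_sym_diff[of _ D, symmetric], unfold 1 2)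
         (simp add: perm_sign_left perm_sign_right mult_ac)
  qed
  also have "\<dots> = (\<omega> \<diamondop> (\<eta> \<diamondop> \<zeta>)) $ C"
    by (simp add: geometric_prod_nth sum_distrib_left mult_ac)
  finally show "((\<omega> \<diamondop> \<eta>) \<diamondop> \<zeta>) $ C = (\<omega> \<diamondop> (\<eta> \<diamondop> \<zeta>)) $ C" .
qed

section \<open>The volume form and the truncated product\<close>

lemma sym_diff_eq_UNIV: "sym_diff D C = UNIV \<longleftrightarrow> D = - C"
  by blast

lemma vol_cone_nth: "vol_cone $ C = (if C = UNIV then 1 else 0)"
  by (auto simp: vol_cone_def axis_def)

lemma geometric_prod_vol_nth: "(\<omega> \<diamondop> vol_cone) $ C = perm_sign (- C) UNIV * \<omega> $ (- C)"
proof -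
  have "(\<omega> \<diamondop> vol_cone) $ C = (\<Sum>D\<in>UNIV. if D = - C then perm_sign (- C) UNIV * \<omega> $ (- C) else 0)"
    unfolding geometric_prod_nth
    by (rule sum.cong) (auto simp: vol_cone_nth sym_diff_eq_UNIV)
  then show ?thesis by simp
qed

text \<open>Centrality of \<nu> rests on the odd dimension: \<open>e\<^sup>a\<close> passes the 8
  other factors of \<nu>, an even number.\<close>

lemma perm_sign_UNIV_commute: "perm_sign UNIV C = perm_sign C UNIV"
proof -
  have "perm_sign {a} UNIV = perm_sign UNIV {a}" for a
  proof -
    have "perm_sign {a} UNIV * perm_sign UNIV {a} = 1"
      by (simp add: perm_sign_singleton_commute)
    then show ?thesis by (metis mult.right_neutral perm_sign_square_left)
  qed
  then show ?thesis
  proof (induction C rule: finite_induct[OF finite])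
    case (2 a C)
    then show ?case by (simp add: perm_sign_insert_left[OF 2(2)] perm_sign_insert_right[OF 2(2)])
  qed simp
qed

lemma vol_central: "vol_cone \<diamondop> \<omega> = \<omega> \<diamondop> vol_cone"
proof (subst vec_eq_iff, intro allI)
  fix C :: "9 set"
  have "(vol_cone \<diamondop> \<omega>) $ C = (\<Sum>D\<in>(UNIV :: 9 set set). if D = UNIV then perm_sign UNIV (- C) * \<omega> $ (- C) else 0)"
    unfolding geometric_prod_nth
    by (rule sum.cong) (auto simp: vol_cone_nth Compl_eq_Diff_UNIV)
  then show "(vol_cone \<diamondop> \<omega>) $ C = (\<omega> \<diamondop> vol_cone) $ C"
    by (simp add: geometric_prod_vol_nth perm_sign_UNIV_commute)
qed

lemma vol_square: "\<omega> \<diamondop> vol_cone \<diamondop> vol_cone = \<omega>"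
proof -
  \<comment> \<open>The product is \<open>perm_sign UNIV UNIV\<close>, whose exponent 9 * 8 / 2 = 36
    is even.\<close>
  have "perm_sign C UNIV * perm_sign (- C) UNIV = 1" for C :: "9 set"
    using perm_sign_left[of C "- C" UNIV] perm_sign_self[of UNIV] by (simp add: sym_diff_eq_UNIV)
  then show ?thesis
    by (simp add: vec_eq_iff geometric_prod_vol_nth mult.assoc[symmetric] mult.commute)
qed

text \<open>Moving \<nu> to the right turns the four products in
  \<open>P_plus \<omega> \<diamondop> P_plus \<eta>\<close> into two equal pairs; with the factor 2
  of the definition and the two factors 1/2 of the projections the weights combine to 1.\<close>

lemma trunc_prod_eq: "\<omega> \<diamondop>\<^sub>+ \<eta> = P_less (\<omega> \<diamondop> \<eta> + \<omega> \<diamondop> \<eta> \<diamondop> vol_cone)"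
proof -
  have 1: "\<omega> \<diamondop> vol_cone \<diamondop> \<eta> = \<omega> \<diamondop> \<eta> \<diamondop> vol_cone"
    by (simp only: geometric_prod_assoc vol_central)
  have 2: "\<omega> \<diamondop> (\<eta> \<diamondop> vol_cone) = \<omega> \<diamondop> \<eta> \<diamondop> vol_cone"
    by (simp only: geometric_prod_assoc)
  have 3: "\<omega> \<diamondop> vol_cone \<diamondop> (\<eta> \<diamondop> vol_cone) = \<omega> \<diamondop> \<eta>"
    by (simp only: geometric_prod_assoc[symmetric] 1 vol_square)
  have "P_plus \<omega> \<diamondop> P_plus \<eta>
      = (1/2) *\<^sub>R (1/2) *\<^sub>R ((\<omega> \<diamondop> \<eta> + \<omega> \<diamondop> \<eta> \<diamondop> vol_cone) + (\<omega> \<diamondop> \<eta> + \<omega> \<diamondop> \<eta> \<diamondop> vol_cone))"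
    by (simp add: P_plus_def twisted_hodge_def geometric_prod_simps 1 2 3 add_ac)
  then show ?thesis
    by (simp only: trunc_prod_def) (simp add: P_less_def vec_eq_iff)
qed

lemma reversion_nth: "reversion \<omega> $ C = perm_sign C C * \<omega> $ C"
  by (simp add: reversion_def perm_sign_self)

text \<open>Polarization of the quadratic form \<open>perm_sign C C\<close>: its value at
  \<open>sym_diff D X\<close> is the product of the values at D and X and of the commutation sign
  \<open>perm_sign D X * perm_sign X D\<close>.\<close>

lemma reversion_prod: "reversion (\<omega> \<diamondop> \<eta>) = reversion \<eta> \<diamondop> reversion \<omega>"
proof (subst vec_eq_iff, intro allI)
  fix C :: "9 set"
  have 1: "sym_diff (sym_diff D C) C = D" for D by blast
  have "(reversion \<eta> \<diamondop> reversion \<omega>) $ C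
      = (\<Sum>D\<in>UNIV. perm_sign (sym_diff D C) D * reversion \<eta> $ sym_diff D C * reversion \<omega> $ D)"
    unfolding geometric_prod_nth
    by (rule sum.reindex_bij_witness[of _ "\<lambda>D. sym_diff D C" "\<lambda>D. sym_diff D C"]) (simp_all add: 1)
  also have "\<dots> = (\<Sum>D\<in>UNIV. perm_sign C C * (perm_sign D (sym_diff D C) * \<omega> $ D * \<eta> $ sym_diff D C))"
    unfolding reversion_nth by (rule sum.cong) (simp_all add: perm_sign_left perm_sign_right mult_ac)
  finally show "reversion (\<omega> \<diamondop> \<eta>) $ C = (reversion \<eta> \<diamondop> reversion \<omega>) $ C"
    by (simp add: reversion_nth geometric_prod_nth sum_distrib_left)
qed

section \<open>Products of homogeneous forms\<close>

lemma rank_part_zero_nth: "rank_part p \<omega> = \<omega> \<Longrightarrow> card C \<noteq> p \<Longrightarrow> \<omega> $ C = 0"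
  by (metis (mono_tags, lifting) rank_part_def vec_lambda_beta)

lemma rank_part_idem [simp]: "rank_part n (rank_part n \<omega>) = rank_part n \<omega>"
  by (simp add: rank_part_def vec_eq_iff)

lemma linear_rank_part: "linear (rank_part n)"
  by (rule linearI) (simp_all add: rank_part_def vec_eq_iff)

lemmas rank_part_simps = linear_add[OF linear_rank_part] linear_diff[OF linear_rank_part]
  linear_scale[OF linear_rank_part] linear_0[OF linear_rank_part]

lemma rank_part_P_less: "n \<le> 4 \<Longrightarrow> rank_part n (P_less \<omega>) = rank_part n \<omega>"
  by (simp add: rank_part_def P_less_def vec_eq_iff)

text \<open>The rank count behind all selection rules: a product of basis elements of ranks p and q
  with k shared indices has rank p + q - 2 * k.\<close>

lemma card_sym_diff_eq:
  fixes C D :: "'a::finite set"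
  shows "card C + 2 * card (D - C) = card D + card (sym_diff D C)"
proof -
  have "card D = card (D \<inter> C) + card (D - C)" "card C = card (D \<inter> C) + card (C - D)"
    by (simp_all add: card_Diff_subset_Int Int_commute card_mono)
  moreover have "card (sym_diff D C) = card (D - C) + card (C - D)"
    by (rule card_Un_disjoint) auto
  ultimately show ?thesis by simp
qed

abbreviation reversion_sign :: "nat \<Rightarrow> real" where
  "reversion_sign k \<equiv> (-1) ^ (k * (k - 1) div 2)"

lemma reversion_rank_part: "reversion (rank_part n \<omega>) = reversion_sign n *\<^sub>R rank_part n \<omega>"
  by (simp add: reversion_def rank_part_def vec_eq_iff)

lemma reversion_homogeneous: "rank_part p \<omega> = \<omega> \<Longrightarrow> reversion \<omega> = reversion_sign p *\<^sub>R \<omega>"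
  by (metis reversion_rank_part)

lemma rank_part_reversion: "rank_part n (reversion \<omega>) = reversion_sign n *\<^sub>R rank_part n \<omega>"
  by (simp add: reversion_def rank_part_def vec_eq_iff)

lemma linear_reversion: "linear reversion"
  by (rule linearI) (simp_all add: reversion_def vec_eq_iff algebra_simps)

lemmas reversion_simps = linear_add[OF linear_reversion] linear_diff[OF linear_reversion]
  linear_scale[OF linear_reversion]

text \<open>The number of shared indices is a natural number bounded by both ranks; this gives the
  parity condition and the triangle inequalities among n, p and q.\<close>

lemma rank_part_geometric_prod_zero:
  assumes "rank_part p \<omega> = \<omega>" "rank_part q \<eta> = \<eta>"
    and "odd (n + p + q) \<or> n > p + q \<or> p > n + q \<or> q > n + p"
  shows "rank_part n (\<omega> \<diamondop> \<eta>) = 0"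
proof (subst vec_eq_iff, intro allI)
  fix C :: "9 set"
  have "\<omega> $ D = 0 \<or> \<eta> $ sym_diff D C = 0" if n: "card C = n" for D
  proof (rule ccontr)
    assume "\<not> (\<omega> $ D = 0 \<or> \<eta> $ sym_diff D C = 0)"
    then have "card D = p" "card (sym_diff D C) = q"
      using assms(1,2) rank_part_zero_nth by blast+
    then have *: "n + 2 * card (D - C) = p + q" "card (D - C) \<le> p" "card (D - C) \<le> q"
      using n card_sym_diff_eq[of C D] card_mono[of D "D - C"] card_mono[of "sym_diff D C" "D - C"]
      by simp_all
    then have "even (n + p + q)" by presburger
    then show False using assms(3) * by linarith
  qed
  then show "rank_part n (\<omega> \<diamondop> \<eta>) $ C = 0 $ C"
    by (auto simp: rank_part_def geometric_prod_nth intro!: sum.neutral)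
qed

text \<open>For homogeneous factors the number of shared indices and the rank of the result
  determine each other, so selecting the contraction order k is projecting to rank n.\<close>

lemma gprod_eq_rank_part:
  assumes "rank_part p \<omega> = \<omega>" "rank_part q \<eta> = \<eta>" "n + 2 * k = p + q"
  shows "\<triangle> k \<omega> \<eta> = contraction_sign k p *\<^sub>R rank_part n (\<omega> \<diamondop> \<eta>)"
proof (subst vec_eq_iff, intro allI)
  fix C :: "9 set"
  have "(if card (D - C) = k then
      contraction_sign k (card D) * perm_sign D (sym_diff D C) * \<omega> $ D * \<eta> $ sym_diff D C else 0)
    = (if card C = n then
      contraction_sign k p * (perm_sign D (sym_diff D C) * \<omega> $ D * \<eta> $ sym_diff D C) else 0)" for D
  proof (cases "\<omega> $ D = 0 \<or> \<eta> $ sym_diff D C = 0")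
    case False
    then have "card D = p" "card (sym_diff D C) = q"
      using assms(1,2) rank_part_zero_nth by blast+
    then show ?thesis
      using assms(3) card_sym_diff_eq[of C D] by auto
  qed auto
  then show "\<triangle> k \<omega> \<eta> $ C = (contraction_sign k p *\<^sub>R rank_part n (\<omega> \<diamondop> \<eta>)) $ C"
    by (simp add: gprod_def contracted_wedge_nth rank_part_def geometric_prod_nth sum_distrib_left)
qed

lemma wedge_eq_rank_part:
  assumes "rank_part p \<omega> = \<omega>" "rank_part q \<eta> = \<eta>" "n = p + q"
  shows "\<omega> \<^bold>\<and> \<eta> = rank_part n (\<omega> \<diamondop> \<eta>)"
  using gprod_eq_rank_part[OF assms(1,2), of n 0] assms(3) by (simp add: gprod_def contraction_sign_def)

text \<open>The case in which all indices of \<omega> are contracted. Then D is disjoint from C, and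
  \<open>perm_sign D (sym_diff D C)\<close> splits into \<open>perm_sign D D\<close>, the reversion
  sign, and the sign \<open>perm_sign D C\<close> of the interior product.\<close>

lemma interior_prod_eq_rank_part:
  assumes "rank_part p \<omega> = \<omega>" "rank_part q \<eta> = \<eta>" "n + p = q"
  shows "\<iota> \<omega> \<eta> = reversion_sign p *\<^sub>R rank_part n (\<omega> \<diamondop> \<eta>)"
proof (subst vec_eq_iff, intro allI)
  fix C :: "9 set"
  have "(\<Sum>D\<in>Pow (- C). perm_sign D C * \<omega> $ D * \<eta> $ (D \<union> C))
    = (\<Sum>D\<in>UNIV. if card C = n then
        reversion_sign p * (perm_sign D (sym_diff D C) * \<omega> $ D * \<eta> $ sym_diff D C) else 0)"
  proof (rule sum.mono_neutral_cong_left)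
    show "\<forall>D\<in>UNIV - Pow (- C). (if card C = n then
        reversion_sign p * (perm_sign D (sym_diff D C) * \<omega> $ D * \<eta> $ sym_diff D C) else 0) = 0"
    proof
      fix D assume "D \<in> UNIV - Pow (- C)"
      then have "D \<inter> C \<noteq> {}" by auto
      \<comment> \<open>If D meets C, fewer than p indices are contracted and the rank count
        fails.\<close>
      then have "card (D - C) < card D" by (intro psubset_card_mono) auto
      then have "card C = n \<Longrightarrow> card D \<noteq> p \<or> card (sym_diff D C) \<noteq> q"
        using card_sym_diff_eq[of C D] assms(3) by auto
      then show "(if card C = n then
        reversion_sign p * (perm_sign D (sym_diff D C) * \<omega> $ D * \<eta> $ sym_diff D C) else 0) = 0"
        using rank_part_zero_nth[OF assms(1), of D] rank_part_zero_nth[OF assms(2), of "sym_diff D C"] by auto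
    qed
    fix D assume D: "D \<in> Pow (- C)"
    then have DC: "sym_diff D C = D \<union> C" "D - C = D" by auto
    have "perm_sign D (sym_diff D C) = reversion_sign (card D) * perm_sign D C"
      by (simp only: perm_sign_right perm_sign_self)
    moreover have "card C = n" if "card D = p" "card (D \<union> C) = q"
      using that card_sym_diff_eq[of C D] assms(3) by (simp add: DC)
    ultimately show "perm_sign D C * \<omega> $ D * \<eta> $ (D \<union> C) = (if card C = n then
        reversion_sign p * (perm_sign D (sym_diff D C) * \<omega> $ D * \<eta> $ sym_diff D C) else 0)"
      using rank_part_zero_nth[OF assms(1), of D] rank_part_zero_nth[OF assms(2), of "D \<union> C"]
      by (cases "card D = p \<and> card (D \<union> C) = q")
         (auto simp: DC mult.assoc[symmetric] power_mult_distrib[symmetric])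
  qed simp_all
  then show "\<iota> \<omega> \<eta> $ C = (reversion_sign p *\<^sub>R rank_part n (\<omega> \<diamondop> \<eta>)) $ C"
    by (simp add: interior_prod_nth rank_part_def geometric_prod_nth sum_distrib_left)
qed

text \<open>The Hodge sign \<open>perm_sign (- C) C\<close> and the sign
  \<open>perm_sign (- C) UNIV\<close> of multiplication by \<nu> differ by
  \<open>perm_sign (- C) (- C)\<close>, because C is the symmetric difference of \<open>UNIV\<close>
  and \<open>- C\<close>.\<close>

lemma hodge_eq_reversion: "hodge \<eta> = reversion \<eta> \<diamondop> vol_cone"
proof -
  have "perm_sign (- C) UNIV * perm_sign (- C) (- C) = perm_sign (- C) C" for C :: "9 set"
  proof -
    have "sym_diff UNIV (- C) = C" by blast
    then show ?thesis using perm_sign_right[of "- C" UNIV "- C"] by simp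
  qed
  then show ?thesis
    by (simp add: vec_eq_iff hodge_def geometric_prod_vol_nth reversion_nth mult.assoc[symmetric])
qed

lemma hodge_scale: "hodge (c *\<^sub>R \<eta>) = c *\<^sub>R hodge \<eta>"
  by (simp add: hodge_def vec_eq_iff)

lemma hodge_rank_part: "hodge (rank_part n \<eta>) = reversion_sign n *\<^sub>R (rank_part n \<eta> \<diamondop> vol_cone)"
  by (simp add: hodge_eq_reversion reversion_rank_part geometric_prod_simps)

text \<open>Reversion exchanges the factors and is scalar on each of the three ranks. This brings
  products into the factor order of the stated systems.\<close>

lemma rank_part_swap:
  assumes "rank_part p \<omega> = \<omega>" "rank_part q \<eta> = \<eta>"
  shows "rank_part n (\<eta> \<diamondop> \<omega>)
    = (reversion_sign n * reversion_sign p * reversion_sign q) *\<^sub>R rank_part n (\<omega> \<diamondop> \<eta>)"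
proof -
  have "reversion_sign n *\<^sub>R rank_part n (\<omega> \<diamondop> \<eta>)
      = (reversion_sign p * reversion_sign q) *\<^sub>R rank_part n (\<eta> \<diamondop> \<omega>)"
    unfolding rank_part_reversion[symmetric] reversion_prod
    by (simp add: reversion_homogeneous[OF assms(1)] reversion_homogeneous[OF assms(2)]
        geometric_prod_simps rank_part_simps)
  then have "(reversion_sign p * reversion_sign q) *\<^sub>R reversion_sign n *\<^sub>R rank_part n (\<omega> \<diamondop> \<eta>)
      = ((reversion_sign p * reversion_sign p) * (reversion_sign q * reversion_sign q)) *\<^sub>R rank_part n (\<eta> \<diamondop> \<omega>)"
    by (simp add: mult_ac)
  then show ?thesis
    by (simp add: power_mult_distrib[symmetric] mult_ac)
qed

lemma rank_part_vol:
  assumes "n \<le> 9"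
  shows "rank_part n (\<omega> \<diamondop> vol_cone) = rank_part (9 - n) \<omega> \<diamondop> vol_cone"
proof -
  have "card (- C) = 9 - n \<longleftrightarrow> card C = n" for C :: "9 set"
    using assms card_Un_disjoint[of C "- C"] by (auto simp: Compl_partition)
  then show ?thesis
    by (simp add: rank_part_def vec_eq_iff geometric_prod_vol_nth)
qed

text \<open>The exponent 9 * 8 / 2 is even, so \<nu> is its own reversion; this lets ranks n and 9 -
  n carry the same reversion sign.\<close>

lemma reversion_vol: "reversion (\<omega> \<diamondop> vol_cone) = reversion \<omega> \<diamondop> vol_cone"
proof -
  have "reversion vol_cone = vol_cone"
    by (simp add: reversion_def vec_eq_iff vol_cone_nth)
  then show ?thesis by (simp add: reversion_prod vol_central)
qed

lemma wedge_nth: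
  "(\<omega> \<^bold>\<and> \<eta>) $ C = (\<Sum>D\<in>UNIV. if D \<subseteq> C then perm_sign D (sym_diff D C) * \<omega> $ D * \<eta> $ sym_diff D C else 0)"
proof -
  have "sym_diff D C = C - D" if "D \<in> Pow C" for D using that by blast
  then show ?thesis
    unfolding wedge_def vec_lambda_beta by (intro sum.mono_neutral_cong_left) simp_all
qed

text \<open>The cocycle argument of \<open>geometric_prod_assoc\<close> with the inclusions carried
  along. It reconciles wedge products with \<open>W\<close>, itself a wedge product, with the
  right-nested products of the statement.\<close>

lemma wedge_assoc: "(\<omega> \<^bold>\<and> \<eta>) \<^bold>\<and> \<zeta> = \<omega> \<^bold>\<and> (\<eta> \<^bold>\<and> \<zeta>)"
proof (subst vec_eq_iff, intro allI)
  fix C :: "9 set"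
  let ?t = "\<lambda>D X. if D \<subseteq> C \<and> X \<subseteq> sym_diff D C then
    perm_sign D (sym_diff D C) * perm_sign X (sym_diff X (sym_diff D C))
    * \<omega> $ D * \<eta> $ X * \<zeta> $ sym_diff X (sym_diff D C) else 0"
  let ?u = "\<lambda>D X. if X \<subseteq> C \<and> D \<subseteq> X then
    perm_sign X (sym_diff X C) * perm_sign D (sym_diff D X)
    * \<omega> $ D * \<eta> $ sym_diff D X * \<zeta> $ sym_diff X C else 0"
  have "((\<omega> \<^bold>\<and> \<eta>) \<^bold>\<and> \<zeta>) $ C = (\<Sum>X\<in>UNIV. \<Sum>D\<in>UNIV. ?u D X)"
    unfolding wedge_nth sum_distrib_left sum_distrib_right
    by (intro sum.cong refl) (simp add: sum_distrib_left sum_distrib_right, intro impI sum.cong refl, simp)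
  also have "\<dots> = (\<Sum>D\<in>UNIV. \<Sum>X\<in>UNIV. ?u D X)"
    by (rule sum.swap)
  also have "\<dots> = (\<Sum>D\<in>UNIV. \<Sum>X\<in>UNIV. ?t D X)"
  proof (rule sum.cong[OF refl])
    fix D
    have 1: "sym_diff D (sym_diff D X) = X" and 2: "sym_diff (sym_diff D X) C = sym_diff X (sym_diff D C)"
      and 3: "sym_diff D X \<subseteq> C \<and> D \<subseteq> sym_diff D X \<longleftrightarrow> D \<subseteq> C \<and> X \<subseteq> sym_diff D C" for X
      by blast+
    show "(\<Sum>X\<in>UNIV. ?u D X) = (\<Sum>X\<in>UNIV. ?t D X)"
      by (subst sum_sym_diff[of _ D, symmetric], unfold 1 2 3)
         (simp add: perm_sign_left perm_sign_right mult_ac cong: if_cong)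
  qed
  also have "\<dots> = (\<omega> \<^bold>\<and> (\<eta> \<^bold>\<and> \<zeta>)) $ C"
    unfolding wedge_nth sum_distrib_left
    by (intro sum.cong refl) (simp add: sum_distrib_left, intro impI sum.cong refl, simp)
  finally show "((\<omega> \<^bold>\<and> \<eta>) \<^bold>\<and> \<zeta>) $ C = (\<omega> \<^bold>\<and> (\<eta> \<^bold>\<and> \<zeta>)) $ C" .
qed

section \<open>Separation on ranks\<close>

text \<open>For \<open>n \<le> 4\<close> this is the part of rank n of \<open>\<omega> \<diamondop>\<^sub>+ \<eta>\<close>. It collects the parts of ranks n and
  9 - n of \<open>\<omega> \<diamondop> \<eta>\<close>, of which at most one is nonzero if \<open>\<omega>\<close> and \<open>\<eta>\<close> are homogeneous.\<close>

definition folded_rank_part :: "nat \<Rightarrow> ext \<Rightarrow> ext \<Rightarrow> ext" where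
  "folded_rank_part n \<omega> \<eta> = rank_part n (\<omega> \<diamondop> \<eta> + \<omega> \<diamondop> \<eta> \<diamondop> vol_cone)"

lemma folded_rank_part_bilinear: "bilinear (folded_rank_part n)"
  unfolding bilinear_def
  by (auto intro!: linearI simp: folded_rank_part_def geometric_prod_simps rank_part_simps algebra_simps)

lemmas folded_rank_part_simps =
  bilinear_ladd[OF folded_rank_part_bilinear] bilinear_radd[OF folded_rank_part_bilinear]
  bilinear_lsub[OF folded_rank_part_bilinear] bilinear_rsub[OF folded_rank_part_bilinear]
  bilinear_lmul[OF folded_rank_part_bilinear] bilinear_rmul[OF folded_rank_part_bilinear]

lemma rank_part_trunc_prod: "n \<le> 4 \<Longrightarrow> rank_part n (\<omega> \<diamondop>\<^sub>+ \<eta>) = folded_rank_part n \<omega> \<eta>"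
  by (simp add: trunc_prod_eq rank_part_P_less folded_rank_part_def)

lemma folded_rank_part_reversion:
  assumes "rank_part q \<eta> = \<eta>"
  shows "folded_rank_part n \<eta> (reversion \<omega>)
    = (reversion_sign n * reversion_sign q) *\<^sub>R folded_rank_part n \<omega> \<eta>"
proof -
  have "reversion (reversion \<eta>) = \<eta>"
    by (simp add: vec_eq_iff reversion_nth)
  then have \<eta>: "\<eta> = reversion_sign q *\<^sub>R reversion \<eta>"
    using reversion_homogeneous[OF assms] by (metis linear_scale[OF linear_reversion])
  have "\<eta> \<diamondop> reversion \<omega> = reversion_sign q *\<^sub>R reversion (\<omega> \<diamondop> \<eta>)"
    by (subst \<eta>) (simp add: reversion_prod geometric_prod_simps)
  then have "\<eta> \<diamondop> reversion \<omega> + \<eta> \<diamondop> reversion \<omega> \<diamondop> vol_cone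
      = reversion_sign q *\<^sub>R reversion (\<omega> \<diamondop> \<eta> + \<omega> \<diamondop> \<eta> \<diamondop> vol_cone)"
    by (simp add: geometric_prod_simps reversion_simps reversion_vol scaleR_add_right)
  then show ?thesis
    by (simp add: folded_rank_part_def rank_part_simps rank_part_reversion mult.commute)
qed

text \<open>The selection rules leave one of the two parts. On numerals all the conditions evaluate,
  so simplification alone picks the products that occur in each rank.\<close>

lemma folded_rank_part_eq:
  assumes "rank_part p \<omega> = \<omega>" "rank_part q \<eta> = \<eta>" "n \<le> 9"
  shows "folded_rank_part n \<omega> \<eta> =
    (if even (n + p + q) then
       if n > p + q \<or> p > n + q \<or> q > n + p then 0 else rank_part n (\<omega> \<diamondop> \<eta>)
     else if 9 - n > p + q \<or> p > 9 - n + q \<or> q > 9 - n + p then 0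
     else rank_part (9 - n) (\<omega> \<diamondop> \<eta>) \<diamondop> vol_cone)"
proof -
  have "odd (n + p + q) \<longleftrightarrow> even (9 - n + p + q)" using assms(3) by presburger
  then show ?thesis
    using rank_part_geometric_prod_zero[OF assms(1,2), of n]
      rank_part_geometric_prod_zero[OF assms(1,2), of "9 - n"]
    by (auto simp: folded_rank_part_def rank_part_simps rank_part_vol[OF assms(3)] geometric_prod_simps)
qed

lemma linear_P_less: "linear P_less"
  by (rule linearI) (simp_all add: P_less_def vec_eq_iff)

lemma P_less_trunc_prod: "P_less (\<omega> \<diamondop>\<^sub>+ \<eta>) = \<omega> \<diamondop>\<^sub>+ \<eta>"
  by (simp add: trunc_prod_eq P_less_def vec_eq_iff)

lemma rank_parts_vanish_iff: "(\<forall>k<5. rank_part k (P_less \<omega>) = 0) \<longleftrightarrow> P_less \<omega> = 0"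
proof
  assume *: "\<forall>k<5. rank_part k (P_less \<omega>) = 0"
  have "P_less \<omega> $ C = 0" for C
  proof (cases "card C \<le> 4")
    case True
    then have "rank_part (card C) (P_less \<omega>) $ C = 0" using * by simp
    then show ?thesis by (simp add: rank_part_def)
  qed (simp add: P_less_def)
  then show "P_less \<omega> = 0" by (simp add: vec_eq_iff)
qed (simp add: linear_0[OF linear_rank_part])

text \<open>The factors \<open>c k\<close> may depend on the rank because the rank 0 equation of the
  minus relation is normalized differently from the others.\<close>

lemma amounts_by_rankI:
  assumes "P_less R = R" "length Ls = 5"
    and "\<And>k. k < 5 \<Longrightarrow> c k \<noteq> 0 \<and> rank_part k R = c k *\<^sub>R Ls ! k"
  shows "amounts_by_rank R Ls"
proof -
  have k: "rank_part k R = 0 \<longleftrightarrow> Ls ! k = 0" if "k < 5" for k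
    using assms(3)[OF that] by auto
  have "R = 0 \<longleftrightarrow> (\<forall>k<5. Ls ! k = 0)"
    using rank_parts_vanish_iff[of R] assms(1) k by simp
  also have "\<dots> \<longleftrightarrow> (\<forall>L\<in>set Ls. L = 0)"
    by (metis assms(2) in_set_conv_nth)
  finally show ?thesis
    unfolding amounts_by_rank_def using assms(2) k by simp
qed

text \<open>The separation on ranks is an identity between arbitrary forms of these ranks, so it is
  isolated here from the pinor geometry.\<close>

locale cone_forms =
  fixes d\<Delta> \<theta> f F V K \<Psi> \<Phi> :: ext and r \<kappa> :: real
  assumes ranks: "rank_part 1 d\<Delta> = d\<Delta>" "rank_part 1 \<theta> = \<theta>" "rank_part 1 f = f" "rank_part 4 F = F"
    "rank_part 1 V = V" "rank_part 2 K = K" "rank_part 3 \<Psi> = \<Psi>" "rank_part 4 \<Phi> = \<Phi>"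
begin

definition W where "W = f \<^bold>\<and> \<theta>"
definition Q where "Q = (1/2) *\<^sub>R r *\<^sub>R d\<Delta> - (1/6) *\<^sub>R W - (1/12) *\<^sub>R F - \<kappa> *\<^sub>R \<theta>"
definition E where "E = (1/32) *\<^sub>R (V + K + \<Psi> + \<Phi>)"

lemma rank_W: "rank_part 2 W = W"
  unfolding W_def by (subst (1 2) wedge_eq_rank_part[OF ranks(3,2), of 2]) simp_all

lemma reversion_Q: "reversion Q = (1/2) *\<^sub>R r *\<^sub>R d\<Delta> + (1/6) *\<^sub>R W - (1/12) *\<^sub>R F - \<kappa> *\<^sub>R \<theta>"
  by (simp add: Q_def reversion_simps reversion_homogeneous[OF ranks(1)]
      reversion_homogeneous[OF ranks(2)] reversion_homogeneous[OF ranks(4)] reversion_homogeneous[OF rank_W])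

lemma folded_Q_E: "folded_rank_part n Q E = (1/32) *\<^sub>R
  (folded_rank_part n Q V + folded_rank_part n Q K + folded_rank_part n Q \<Psi> + folded_rank_part n Q \<Phi>)"
  by (simp add: E_def folded_rank_part_simps)

text \<open>The signs +, -, -, + are the reversion signs of ranks 1 to 4; the common factor
  \<open>reversion_sign n\<close> decides which half cancels against
  \<open>folded_Q_E\<close>.\<close>

lemma folded_E_Q: "folded_rank_part n E (reversion Q) = (reversion_sign n / 32) *\<^sub>R
  (folded_rank_part n Q V - folded_rank_part n Q K - folded_rank_part n Q \<Psi> + folded_rank_part n Q \<Phi>)"
  by (simp add: E_def folded_rank_part_simps folded_rank_part_reversion[OF ranks(5)]
      folded_rank_part_reversion[OF ranks(6)] folded_rank_part_reversion[OF ranks(7)]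
      folded_rank_part_reversion[OF ranks(8)] scaleR_add_right scaleR_diff_right)

lemma folded_Q: "folded_rank_part n Q X = (r/2) *\<^sub>R folded_rank_part n d\<Delta> X
  - (1/6) *\<^sub>R folded_rank_part n W X - (1/12) *\<^sub>R folded_rank_part n F X - \<kappa> *\<^sub>R folded_rank_part n \<theta> X"
  by (simp add: Q_def folded_rank_part_simps)

lemmas folded_eqs =
  folded_rank_part_eq[OF ranks(1) ranks(5)] folded_rank_part_eq[OF ranks(1) ranks(6)]
  folded_rank_part_eq[OF ranks(1) ranks(7)] folded_rank_part_eq[OF ranks(1) ranks(8)]
  folded_rank_part_eq[OF ranks(2) ranks(5)] folded_rank_part_eq[OF ranks(2) ranks(6)]
  folded_rank_part_eq[OF ranks(2) ranks(7)] folded_rank_part_eq[OF ranks(2) ranks(8)]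
  folded_rank_part_eq[OF ranks(4) ranks(5)] folded_rank_part_eq[OF ranks(4) ranks(6)]
  folded_rank_part_eq[OF ranks(4) ranks(7)] folded_rank_part_eq[OF ranks(4) ranks(8)]
  folded_rank_part_eq[OF rank_W ranks(5)] folded_rank_part_eq[OF rank_W ranks(6)]
  folded_rank_part_eq[OF rank_W ranks(7)] folded_rank_part_eq[OF rank_W ranks(8)]

text \<open>\<open>reversion_sign n\<close> is 1 for n in {0, 1, 4} and -1 for n in {2, 3}; the
  surviving half is doubled, whence 1/16 = 2/32.\<close>

lemma Rminus_folded:
  "n \<in> {0, 1, 4} \<Longrightarrow> rank_part n (Q \<diamondop>\<^sub>+ E - E \<diamondop>\<^sub>+ reversion Q)
    = (1/16) *\<^sub>R (folded_rank_part n Q K + folded_rank_part n Q \<Psi>)"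
  "n \<in> {2, 3} \<Longrightarrow> rank_part n (Q \<diamondop>\<^sub>+ E - E \<diamondop>\<^sub>+ reversion Q)
    = (1/16) *\<^sub>R (folded_rank_part n Q V + folded_rank_part n Q \<Phi>)"
  by (auto simp: rank_part_simps rank_part_trunc_prod folded_Q_E folded_E_Q vec_eq_iff field_simps)

lemma Rplus_folded:
  "n \<in> {0, 1, 4} \<Longrightarrow> rank_part n (Q \<diamondop>\<^sub>+ E + E \<diamondop>\<^sub>+ reversion Q)
    = (1/16) *\<^sub>R (folded_rank_part n Q V + folded_rank_part n Q \<Phi>)"
  "n \<in> {2, 3} \<Longrightarrow> rank_part n (Q \<diamondop>\<^sub>+ E + E \<diamondop>\<^sub>+ reversion Q)
    = (1/16) *\<^sub>R (folded_rank_part n Q K + folded_rank_part n Q \<Psi>)"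
  by (auto simp: rank_part_simps rank_part_trunc_prod folded_Q_E folded_E_Q vec_eq_iff field_simps)

text \<open>The coefficients 1/2, 1/6, 1/12 and \<kappa> of Q are doubled to those of the system
  when 1/32 is extracted from the factor 1/16. In rank 0 only the product of \<open>W\<close> and
  \<open>K\<close> survives, and its coefficient 1/6 is absorbed as well, which gives 1/96.\<close>

lemma Rminus:
  defines "R \<equiv> Q \<diamondop>\<^sub>+ E - E \<diamondop>\<^sub>+ reversion Q"
  shows "rank_part 0 R = (1/96) *\<^sub>R \<iota> W K" (is ?g0)
    and "rank_part 1 R = (1/32) *\<^sub>R
      (r *\<^sub>R \<iota> d\<Delta> K + (1/3) *\<^sub>R \<iota> W \<Psi> - (1/6) *\<^sub>R \<iota> \<Psi> F - (2 * \<kappa>) *\<^sub>R \<iota> \<theta> K)" (is ?g1)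
    and "rank_part 2 R = (1/32) *\<^sub>R
      ((1/3) *\<^sub>R \<iota> W \<Phi> - (1/6) *\<^sub>R \<triangle> 3 F \<Phi> + r *\<^sub>R d\<Delta> \<^bold>\<and> V + (2 * \<kappa>) *\<^sub>R V \<^bold>\<and> \<theta>)" (is ?g2)
    and "rank_part 3 R = (1/32) *\<^sub>R
      (r *\<^sub>R \<iota> d\<Delta> \<Phi> - (1/3) *\<^sub>R V \<^bold>\<and> W + (1/6) *\<^sub>R \<iota> V F
        - (1/6) *\<^sub>R hodge (\<triangle> 1 F \<Phi>) + (1/3) *\<^sub>R hodge (W \<^bold>\<and> \<Phi>) - (2 * \<kappa>) *\<^sub>R \<iota> \<theta> \<Phi>)" (is ?g3)
    and "rank_part 4 R = (1/32) *\<^sub>R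
      (r *\<^sub>R d\<Delta> \<^bold>\<and> \<Psi> - (1/3) *\<^sub>R W \<^bold>\<and> K - (1/6) *\<^sub>R \<triangle> 1 K F
        - (1/3) *\<^sub>R hodge (W \<^bold>\<and> \<Psi>) + (1/6) *\<^sub>R hodge (\<triangle> 1 \<Psi> F) + (2 * \<kappa>) *\<^sub>R \<Psi> \<^bold>\<and> \<theta>)" (is ?g4)
proof -
  note products = Rminus_folded folded_Q folded_eqs
    contraction_sign_def hodge_scale hodge_scale[of "-1", simplified] hodge_rank_part
  \<comment> \<open>These turn around the products that the system writes with the bilinear first,
    such as \<open>\<iota> \<Psi> F\<close>; the folded parts have the constituents of Q on the
    left.\<close>
  note swap = rank_part_swap[OF ranks(4) ranks(7)] rank_part_swap[OF ranks(2) ranks(5)]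
    rank_part_swap[OF rank_W ranks(5)] rank_part_swap[OF ranks(4) ranks(5)]
    rank_part_swap[OF ranks(4) ranks(6)] rank_part_swap[OF ranks(2) ranks(7)]
  show ?g0
    by (simp add: R_def products interior_prod_eq_rank_part[OF rank_W ranks(6), of 0])
  show ?g1
    by (simp add: R_def products swap interior_prod_eq_rank_part[OF ranks(1) ranks(6), of 1]
        interior_prod_eq_rank_part[OF ranks(2) ranks(6), of 1]
        interior_prod_eq_rank_part[OF rank_W ranks(7), of 1]
        interior_prod_eq_rank_part[OF ranks(7) ranks(4), of 1]; simp add: vec_eq_iff algebra_simps)
  show ?g2
    by (simp add: R_def products swap interior_prod_eq_rank_part[OF rank_W ranks(8), of 2]
        gprod_eq_rank_part[OF ranks(4) ranks(8), of 2 3]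
        wedge_eq_rank_part[OF ranks(1) ranks(5), of 2]
        wedge_eq_rank_part[OF ranks(5) ranks(2), of 2]; simp add: vec_eq_iff algebra_simps)
  show ?g3
    by (simp add: R_def products swap interior_prod_eq_rank_part[OF ranks(1) ranks(8), of 3]
        interior_prod_eq_rank_part[OF ranks(2) ranks(8), of 3]
        interior_prod_eq_rank_part[OF ranks(5) ranks(4), of 3]
        wedge_eq_rank_part[OF ranks(5) rank_W, of 3]
        wedge_eq_rank_part[OF rank_W ranks(8), of 6]
        gprod_eq_rank_part[OF ranks(4) ranks(8), of 6 "Suc 0"]; simp add: vec_eq_iff algebra_simps)
  show ?g4
    by (simp add: R_def products swap wedge_eq_rank_part[OF ranks(1) ranks(7), of 4]
        wedge_eq_rank_part[OF rank_W ranks(6), of 4]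
        wedge_eq_rank_part[OF rank_W ranks(7), of 5]
        wedge_eq_rank_part[OF ranks(7) ranks(2), of 4]
        gprod_eq_rank_part[OF ranks(6) ranks(4), of 4 "Suc 0"]
        gprod_eq_rank_part[OF ranks(7) ranks(4), of 5 "Suc 0"]; simp add: vec_eq_iff algebra_simps)
qed

lemma Rplus:
  defines "R \<equiv> Q \<diamondop>\<^sub>+ E + E \<diamondop>\<^sub>+ reversion Q"
  shows "rank_part 0 R = (1/32) *\<^sub>R
      (- (1/6) *\<^sub>R \<iota> F \<Phi> + r *\<^sub>R \<iota> d\<Delta> V - (2 * \<kappa>) *\<^sub>R \<iota> \<theta> V)" (is ?g0)
    and "rank_part 1 R = (1/32) *\<^sub>R
      ((1/3) *\<^sub>R \<iota> V W - (1/6) *\<^sub>R hodge (F \<^bold>\<and> \<Phi>))" (is ?g1)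
    and "rank_part 2 R = (1/32) *\<^sub>R
      (r *\<^sub>R \<iota> d\<Delta> \<Psi> + (1/3) *\<^sub>R \<triangle> 1 W K + (1/6) *\<^sub>R \<iota> K F
        + (1/6) *\<^sub>R hodge (F \<^bold>\<and> \<Psi>) - (2 * \<kappa>) *\<^sub>R \<iota> \<theta> \<Psi>)" (is ?g2)
    and "rank_part 3 R = (1/32) *\<^sub>R
      ((1/3) *\<^sub>R \<triangle> 1 W \<Psi> + (1/6) *\<^sub>R \<triangle> 2 \<Psi> F + (1/6) *\<^sub>R hodge (K \<^bold>\<and> F)
        + r *\<^sub>R d\<Delta> \<^bold>\<and> K - (2 * \<kappa>) *\<^sub>R K \<^bold>\<and> \<theta>)" (is ?g3)
    and "rank_part 4 R = (1/32) *\<^sub>R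
      ((1/3) *\<^sub>R \<triangle> 1 W \<Phi> + (1/6) *\<^sub>R \<triangle> 2 F \<Phi> - (1/6) *\<^sub>R hodge (F \<^bold>\<and> V)
        + hodge (r *\<^sub>R d\<Delta> \<^bold>\<and> \<Phi>) - (2 * \<kappa>) *\<^sub>R hodge (\<Phi> \<^bold>\<and> \<theta>))" (is ?g4)
proof -
  note products = Rplus_folded folded_Q folded_eqs
    contraction_sign_def hodge_scale hodge_scale[of "-1", simplified] hodge_rank_part
  note swap = rank_part_swap[OF rank_W ranks(5)] rank_part_swap[OF ranks(4) ranks(6)]
    rank_part_swap[OF ranks(4) ranks(7)] rank_part_swap[OF ranks(2) ranks(6)]
    rank_part_swap[OF ranks(2) ranks(8)]
  show ?g0
    by (simp add: R_def products interior_prod_eq_rank_part[OF ranks(4) ranks(8), of 0]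
        interior_prod_eq_rank_part[OF ranks(1) ranks(5), of 0]
        interior_prod_eq_rank_part[OF ranks(2) ranks(5), of 0]; simp add: vec_eq_iff algebra_simps)
  show ?g1
    by (simp add: R_def products swap interior_prod_eq_rank_part[OF ranks(5) rank_W, of 1]
        wedge_eq_rank_part[OF ranks(4) ranks(8), of 8]; simp add: vec_eq_iff algebra_simps)
  show ?g2
    by (simp add: R_def products swap interior_prod_eq_rank_part[OF ranks(1) ranks(7), of 2]
        interior_prod_eq_rank_part[OF ranks(2) ranks(7), of 2]
        interior_prod_eq_rank_part[OF ranks(6) ranks(4), of 2]
        gprod_eq_rank_part[OF rank_W ranks(6), of 2 "Suc 0"]
        wedge_eq_rank_part[OF ranks(4) ranks(7), of 7]; simp add: vec_eq_iff algebra_simps)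
  show ?g3
    by (simp add: R_def products swap gprod_eq_rank_part[OF rank_W ranks(7), of 3 "Suc 0"]
        gprod_eq_rank_part[OF ranks(7) ranks(4), of 3 2]
        wedge_eq_rank_part[OF ranks(6) ranks(4), of 6]
        wedge_eq_rank_part[OF ranks(1) ranks(6), of 3]
        wedge_eq_rank_part[OF ranks(6) ranks(2), of 3]; simp add: vec_eq_iff algebra_simps)
  show ?g4
    by (simp add: R_def products swap gprod_eq_rank_part[OF rank_W ranks(8), of 4 "Suc 0"]
        gprod_eq_rank_part[OF ranks(4) ranks(8), of 4 2]
        wedge_eq_rank_part[OF ranks(4) ranks(5), of 5]
        wedge_eq_rank_part[OF ranks(1) ranks(8), of 5]
        wedge_eq_rank_part[OF ranks(8) ranks(2), of 5]; simp add: vec_eq_iff algebra_simps)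
qed

lemma amounts_Rminus: "amounts_by_rank (Q \<diamondop>\<^sub>+ E - E \<diamondop>\<^sub>+ reversion Q)
   [\<iota> W K,
    r *\<^sub>R \<iota> d\<Delta> K + (1/3) *\<^sub>R \<iota> W \<Psi> - (1/6) *\<^sub>R \<iota> \<Psi> F - (2 * \<kappa>) *\<^sub>R \<iota> \<theta> K,
    (1/3) *\<^sub>R \<iota> W \<Phi> - (1/6) *\<^sub>R \<triangle> 3 F \<Phi> + r *\<^sub>R d\<Delta> \<^bold>\<and> V + (2 * \<kappa>) *\<^sub>R V \<^bold>\<and> \<theta>,
    r *\<^sub>R \<iota> d\<Delta> \<Phi> - (1/3) *\<^sub>R V \<^bold>\<and> W + (1/6) *\<^sub>R \<iota> V F
      - (1/6) *\<^sub>R hodge (\<triangle> 1 F \<Phi>) + (1/3) *\<^sub>R hodge (W \<^bold>\<and> \<Phi>) - (2 * \<kappa>) *\<^sub>R \<iota> \<theta> \<Phi>,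
    r *\<^sub>R d\<Delta> \<^bold>\<and> \<Psi> - (1/3) *\<^sub>R W \<^bold>\<and> K - (1/6) *\<^sub>R \<triangle> 1 K F
      - (1/3) *\<^sub>R hodge (W \<^bold>\<and> \<Psi>) + (1/6) *\<^sub>R hodge (\<triangle> 1 \<Psi> F) + (2 * \<kappa>) *\<^sub>R \<Psi> \<^bold>\<and> \<theta>]"
  (is "amounts_by_rank _ ?Ls")
proof (rule amounts_by_rankI[where c = "\<lambda>k. if k = 0 then 1/96 else 1/32"])
  fix k :: nat assume "k < 5"
  then have "k \<in> {0, 1, 2, 3, 4}" by auto
  then show "(if k = 0 then 1/96 else 1/32) \<noteq> (0::real) \<and>
      rank_part k (Q \<diamondop>\<^sub>+ E - E \<diamondop>\<^sub>+ reversion Q) = (if k = 0 then 1/96 else 1/32) *\<^sub>R ?Ls ! k"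
    by (elim insertE emptyE; simp only: Rminus) (simp_all add: nth_Cons')
qed (simp_all add: P_less_trunc_prod linear_diff[OF linear_P_less])

lemma amounts_Rplus: "amounts_by_rank (Q \<diamondop>\<^sub>+ E + E \<diamondop>\<^sub>+ reversion Q)
   [- (1/6) *\<^sub>R \<iota> F \<Phi> + r *\<^sub>R \<iota> d\<Delta> V - (2 * \<kappa>) *\<^sub>R \<iota> \<theta> V,
    (1/3) *\<^sub>R \<iota> V W - (1/6) *\<^sub>R hodge (F \<^bold>\<and> \<Phi>),
    r *\<^sub>R \<iota> d\<Delta> \<Psi> + (1/3) *\<^sub>R \<triangle> 1 W K + (1/6) *\<^sub>R \<iota> K F
      + (1/6) *\<^sub>R hodge (F \<^bold>\<and> \<Psi>) - (2 * \<kappa>) *\<^sub>R \<iota> \<theta> \<Psi>,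
    (1/3) *\<^sub>R \<triangle> 1 W \<Psi> + (1/6) *\<^sub>R \<triangle> 2 \<Psi> F + (1/6) *\<^sub>R hodge (K \<^bold>\<and> F)
      + r *\<^sub>R d\<Delta> \<^bold>\<and> K - (2 * \<kappa>) *\<^sub>R K \<^bold>\<and> \<theta>,
    (1/3) *\<^sub>R \<triangle> 1 W \<Phi> + (1/6) *\<^sub>R \<triangle> 2 F \<Phi> - (1/6) *\<^sub>R hodge (F \<^bold>\<and> V)
      + hodge (r *\<^sub>R d\<Delta> \<^bold>\<and> \<Phi>) - (2 * \<kappa>) *\<^sub>R hodge (\<Phi> \<^bold>\<and> \<theta>)]"
  (is "amounts_by_rank _ ?Ls")
proof (rule amounts_by_rankI[where c = "\<lambda>k. 1/32"])
  fix k :: nat assume "k < 5"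
  then have "k \<in> {0, 1, 2, 3, 4}" by auto
  then show "1/32 \<noteq> (0::real) \<and>
      rank_part k (Q \<diamondop>\<^sub>+ E + E \<diamondop>\<^sub>+ reversion Q) = (1/32) *\<^sub>R ?Ls ! k"
    by (elim insertE emptyE; simp only: Rplus) (simp_all add: nth_Cons')
qed (simp_all add: P_less_trunc_prod linear_add[OF linear_P_less])

end

section \<open>Clifford modules and the Fierz identity\<close>

lemma fold_indices_eq_map:
  "foldr (\<lambda>i. G (as ! \<sigma> i)) [0..<n] s = foldr G (map (\<lambda>i. as ! \<sigma> i) [0..<n]) s"
  by (simp add: foldr_map comp_def)

text \<open>One fibre of the pinor bundle of the cone. \<open>G_volume\<close> expresses signature
  +1, and \<open>G_iso\<close> the isomorphism of Cl(8,0) with End(S): uniqueness there concerns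
  forms without the radial index 8, because on all nine indices \<nu> acts as the identity.\<close>

locale clifford_module =
  fixes S :: "'s::real_vector set" and b :: "'s \<Rightarrow> 's \<Rightarrow> real" and G :: "9 \<Rightarrow> 's \<Rightarrow> 's"
  assumes subspace: "subspace S"
    and G_linear: "linear_between S S (G a)"
    and G_square: "s \<in> S \<Longrightarrow> G a (G a s) = s"
    and G_anticommute: "a \<noteq> c \<Longrightarrow> s \<in> S \<Longrightarrow> G a (G c s) = - G c (G a s)"
    and G_volume: "s \<in> S \<Longrightarrow> foldr G (sorted_list_of_set UNIV) s = s"
    and b_linear: "s \<in> S \<Longrightarrow> t \<in> S \<Longrightarrow> u \<in> S \<Longrightarrow> b (x *\<^sub>R s + y *\<^sub>R t) u = x * b s u + y * b t u"
    and b_sym: "s \<in> S \<Longrightarrow> t \<in> S \<Longrightarrow> b s t = b t s"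
    and b_pos: "s \<in> S \<Longrightarrow> s \<noteq> 0 \<Longrightarrow> b s s > 0"
    and G_self_adjoint: "s \<in> S \<Longrightarrow> t \<in> S \<Longrightarrow> b (G a s) t = b s (G a t)"
    and G_iso: "linear_between S S L \<Longrightarrow>
      \<exists>!\<omega>. (\<forall>C. \<not> C \<subseteq> {..<8} \<longrightarrow> \<omega> $ C = 0) \<and> (\<forall>s\<in>S. gamma_ext G \<omega> s = L s)"
begin

lemmas S_simps [simp] = subspace_0[OF subspace] subspace_add[OF subspace] subspace_diff[OF subspace]
  subspace_neg[OF subspace] subspace_scale[OF subspace] subspace_sum[OF subspace]

lemma G_in [simp]: "s \<in> S \<Longrightarrow> G a s \<in> S"
  using G_linear by (auto simp: linear_between_def)

lemma G_combination: "s \<in> S \<Longrightarrow> t \<in> S \<Longrightarrow> G a (x *\<^sub>R s + y *\<^sub>R t) = x *\<^sub>R G a s + y *\<^sub>R G a t"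
  using G_linear by (auto simp: linear_between_def)

lemma G_scale: "s \<in> S \<Longrightarrow> G a (x *\<^sub>R s) = x *\<^sub>R G a s"
  using G_combination[of s 0 a x 0] by simp

lemma G_zero [simp]: "G a 0 = 0"
  using G_scale[of 0 a 0] by simp

lemma G_minus: "s \<in> S \<Longrightarrow> G a (- s) = - G a s"
  using G_scale[of s a "-1"] by simp

lemma G_sum: "(\<And>i. i \<in> I \<Longrightarrow> s i \<in> S) \<Longrightarrow> G a (\<Sum>i\<in>I. x i *\<^sub>R s i) = (\<Sum>i\<in>I. x i *\<^sub>R G a (s i))"
proof (induction I rule: infinite_finite_induct)
  case (insert i I)
  then show ?case
    using G_combination[of "s i" "\<Sum>i\<in>I. x i *\<^sub>R s i" a "x i" 1] by simp
qed simp_all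

lemma b_scale: "s \<in> S \<Longrightarrow> u \<in> S \<Longrightarrow> b (x *\<^sub>R s) u = x * b s u"
  using b_linear[of s 0 u x 0] by simp

lemma b_zero [simp]: "u \<in> S \<Longrightarrow> b 0 u = 0"
  using b_scale[of 0 u 0] by simp

lemma b_sum: "(\<And>i. i \<in> I \<Longrightarrow> s i \<in> S) \<Longrightarrow> u \<in> S \<Longrightarrow>
  b (\<Sum>i\<in>I. x i *\<^sub>R s i) u = (\<Sum>i\<in>I. x i * b (s i) u)"
proof (induction I rule: infinite_finite_induct)
  case (insert i I)
  then show ?case
    using b_linear[of "s i" "\<Sum>i\<in>I. x i *\<^sub>R s i" u "x i" 1] by simp
qed simp_all

lemma foldr_G_in [simp]: "s \<in> S \<Longrightarrow> foldr G as s \<in> S"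
  by (induction as) auto

lemma foldr_G_scale: "s \<in> S \<Longrightarrow> foldr G as (x *\<^sub>R s) = x *\<^sub>R foldr G as s"
  by (induction as) (auto simp: G_scale)

lemma foldr_G_minus: "s \<in> S \<Longrightarrow> foldr G as (- s) = - foldr G as s"
  using foldr_G_scale[of s as "-1"] by simp

lemma G_foldr: "a \<notin> set as \<Longrightarrow> s \<in> S \<Longrightarrow> G a (foldr G as s) = (-1) ^ length as *\<^sub>R foldr G as (G a s)"
proof (induction as)
  case (Cons c as)
  then have "G a (G c (foldr G as s)) = - G c (G a (foldr G as s))"
    by (intro G_anticommute) auto
  then show ?case using Cons by (simp add: G_scale)
qed simp

text \<open>Moving \<open>G u\<close> or \<open>G v\<close> past \<open>bs\<close> costs the same
  sign on both sides, so a single anticommutation remains.\<close>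

lemma foldr_G_swap:
  assumes "u \<noteq> v" "u \<notin> set bs" "v \<notin> set bs" "s \<in> S"
  shows "foldr G (as @ u # bs @ v # cs) s = - foldr G (as @ v # bs @ u # cs) s"
proof -
  define t where "t = foldr G cs s"
  have t: "t \<in> S" using assms(4) by (simp add: t_def)
  have "G u (foldr G bs (G v t)) = - G v (foldr G bs (G u t))"
    using t assms G_anticommute[OF assms(1) t] by (simp add: G_foldr foldr_G_minus)
  then show ?thesis
    using t assms(4) by (simp add: t_def foldr_G_minus)
qed

lemma foldr_G_transpose:
  assumes "distinct as" "u \<in> set as" "v \<in> set as" "u \<noteq> v" "s \<in> S"
  shows "foldr G (map (Transposition.transpose u v) as) s = - foldr G as s"
proof -
  have *: ?thesis if "as = xs @ p # ys @ q # zs" "{p, q} = {u, v}" for p q xs ys zs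
  proof -
    have tr: "Transposition.transpose u v p = q" "Transposition.transpose u v q = p"
      using that(2) by (auto simp: doubleton_eq_iff)
    have "map (Transposition.transpose u v) ws = ws" if "p \<notin> set ws" "q \<notin> set ws" for ws
      using that \<open>{p, q} = {u, v}\<close>
      by (intro map_idI transpose_apply_other) (auto simp: doubleton_eq_iff)
    then have "map (Transposition.transpose u v) as = xs @ q # ys @ p # zs"
      using assms(1) that(1) tr by simp
    moreover have "foldr G as s = - foldr G (xs @ q # ys @ p # zs) s"
      unfolding that(1) using assms(1,5) that(1) by (intro foldr_G_swap) auto
    ultimately show ?thesis by simp
  qed
  from assms(2) obtain xs ys where 1: "as = xs @ u # ys" by (meson split_list)
  with assms(3,4) have "v \<in> set xs \<or> v \<in> set ys" by auto
  then show ?thesis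
  proof
    assume "v \<in> set xs"
    then obtain ws zs where "xs = ws @ v # zs" by (meson split_list)
    then show ?thesis using *[of ws v zs u ys] 1 by auto
  next
    assume "v \<in> set ys"
    then obtain ws zs where "ys = ws @ v # zs" by (meson split_list)
    then show ?thesis using *[of xs u ws v zs] 1 by auto
  qed
qed

text \<open>Each transposition changes both the sign of the product and that of the permutation, so
  all the summands agree and the antisymmetrization of weight one averages equal terms.\<close>

lemma antisym_prod_distinct:
  assumes "distinct as" "s \<in> S"
  shows "antisym_prod G as s = foldr G as s"
proof -
  let ?n = "length as"
  have perm: "foldr G (map (\<lambda>i. as ! \<sigma> i) [0..<?n]) s = of_int (sign \<sigma>) *\<^sub>R foldr G as s"
    if "\<sigma> permutes {..<?n}" for \<sigma>
    using that finite_lessThan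
  proof (induction rule: permutes_induct)
    case id
    then show ?case by (simp add: map_nth)
  next
    case (swap i j \<sigma>)
    let ?xs = "map (\<lambda>k. as ! \<sigma> k) [0..<?n]"
    have in_n: "\<sigma> k < ?n \<longleftrightarrow> k < ?n" for k
      using permutes_in_image[OF swap.hyps(4), of k] by simp
    \<comment> \<open>As the entries are distinct, transposing positions amounts to transposing
      values, to which \<open>foldr_G_transpose\<close> applies.\<close>
    have "as ! Transposition.transpose i j (\<sigma> k) = Transposition.transpose (as ! i) (as ! j) (as ! \<sigma> k)" if "k < ?n" for k
      using swap(1,2) assms(1) that in_n[of k]
      by (auto simp: Transposition.transpose_def nth_eq_iff_index_eq)
    then have eq: "map (\<lambda>k. as ! (Transposition.transpose i j \<circ> \<sigma>) k) [0..<?n] = map (Transposition.transpose (as ! i) (as ! j)) ?xs"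
      by simp
    have inj: "inj \<sigma>" using swap.hyps(4) by (rule permutes_inj)
    have "distinct ?xs"
      using assms(1) in_n inj by (auto simp: distinct_map inj_on_def nth_eq_iff_index_eq)
    moreover have "set ?xs = set as"
    proof -
      have "set ?xs = (!) as ` \<sigma> ` {..<?n}" by (auto simp: image_image)
      also have "\<dots> = set as" unfolding permutes_image[OF swap.hyps(4)] by (auto simp: in_set_conv_nth)
      finally show ?thesis .
    qed
    ultimately have "foldr G (map (Transposition.transpose (as ! i) (as ! j)) ?xs) s = - foldr G ?xs s"
      using swap(1-3) assms by (intro foldr_G_transpose) (auto simp: nth_eq_iff_index_eq)
    moreover have "sign (Transposition.transpose i j \<circ> \<sigma>) = - sign \<sigma>"
      using swap(3) permutes_imp_permutation[OF finite_lessThan swap.hyps(4)]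
      by (subst sign_compose) (simp_all add: sign_swap_id permutation_swap_id)
    ultimately show ?case
      unfolding eq using swap(5) by (simp del: map_map comp_apply)
  qed
  have "antisym_prod G as s = (1 / fact ?n) *\<^sub>R (\<Sum>\<sigma> | \<sigma> permutes {..<?n}. foldr G as s)"
    unfolding antisym_prod_def fold_indices_eq_map
    by (intro arg_cong2[of _ _ _ _ scaleR] sum.cong refl)
       (simp add: perm scaleR_scaleR[symmetric] sign_def del: scaleR_scaleR)
  then show ?thesis
    by (simp add: card_permutations[of "{..<?n}" ?n] scaleR_sum_left[symmetric] sum_constant_scaleR)
qed

section \<open>Action of basis elements and of forms on pinors\<close>

definition basis_action :: "9 set \<Rightarrow> 's \<Rightarrow> 's" ("\<gamma>") where
  "\<gamma> C = foldr G (sorted_list_of_set C)"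

lemma gamma_in [simp]: "s \<in> S \<Longrightarrow> \<gamma> C s \<in> S"
  by (simp add: basis_action_def)

lemma gamma_scale: "s \<in> S \<Longrightarrow> \<gamma> C (x *\<^sub>R s) = x *\<^sub>R \<gamma> C s"
  by (simp add: basis_action_def foldr_G_scale)

lemma gamma_empty [simp]: "\<gamma> {} s = s"
  by (simp add: basis_action_def)

lemma gamma_insert_min: "\<forall>a\<in>C. m < a \<Longrightarrow> \<gamma> (insert m C) s = G m (\<gamma> C s)"
proof -
  assume m: "\<forall>a\<in>C. m < a"
  then have "m \<notin> C" by blast
  then have "sorted_list_of_set (insert m C) = m # sorted_list_of_set C"
    using m by (simp add: insort_is_Cons less_imp_le)
  then show ?thesis by (simp add: basis_action_def)
qed

lemma gamma_singleton: "\<gamma> {a} s = G a s"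
  by (simp add: basis_action_def)

lemma perm_sign_singleton_min:
  assumes "\<forall>c\<in>C. a \<le> c"
  shows "perm_sign {a} C = 1"
proof -
  have "{(c, d). c \<in> {a} \<and> d \<in> C \<and> d < c} = {}" using assms by auto
  then show ?thesis by (simp only: perm_sign_def card.empty power_0)
qed

text \<open>\<open>perm_sign {a} C\<close> counts the elements of C below a, which are the factors
  that \<open>G a\<close> has to pass; the induction adjoins least elements and so treats these one
  at a time.\<close>

lemma G_gamma: "s \<in> S \<Longrightarrow> G a (\<gamma> C s) = perm_sign {a} C *\<^sub>R \<gamma> (sym_diff {a} C) s"
proof (induction C rule: finite_linorder_min_induct[OF finite])
  case 1
  then show ?case by (simp add: gamma_singleton)
next
  case (2 m C)
  have m: "m \<notin> C" using 2(2) by blast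
  consider "a = m" | "a < m" | "m < a" by fastforce
  then show ?case
  proof cases
    case 1
    then have "sym_diff {a} (insert m C) = C" using m by auto
    moreover have "perm_sign {a} (insert m C) = 1"
      using 1 2(2) by (intro perm_sign_singleton_min) auto
    ultimately show ?thesis
      using 1 2 by (simp add: gamma_insert_min G_square)
  next
    case 2: 2
    have all: "\<forall>c\<in>insert m C. a < c" using 2 \<open>\<forall>a\<in>C. m < a\<close> by auto
    then have "sym_diff {a} (insert m C) = insert a (insert m C)" by auto
    moreover have "perm_sign {a} (insert m C) = 1"
      using all by (intro perm_sign_singleton_min) auto
    ultimately show ?thesis
      using gamma_insert_min[OF all] by simp
  next
    case 3
    have "sym_diff {a} (insert m C) = insert m (sym_diff {a} C)" using 3 m by auto
    moreover have "\<gamma> (insert m (sym_diff {a} C)) s = G m (\<gamma> (sym_diff {a} C) s)"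
      using 3 2(2) by (intro gamma_insert_min) auto
    moreover have "perm_sign {a} (insert m C) = - perm_sign {a} C"
      using 3 perm_sign_insert_right[OF m, of "{a}"] by (simp add: perm_sign_prod)
    moreover have "G a (G m (\<gamma> C s)) = - G m (G a (\<gamma> C s))"
      using 3 2(4) by (intro G_anticommute) auto
    ultimately show ?thesis
      using 2 by (simp add: gamma_insert_min G_scale)
  qed
qed

text \<open>These are the structure constants of \<open>geometric_prod_nth\<close>, so that the
  action becomes an algebra morphism in \<open>gamma_ext_prod\<close>.\<close>

lemma gamma_gamma: "s \<in> S \<Longrightarrow> \<gamma> C (\<gamma> D s) = perm_sign C D *\<^sub>R \<gamma> (sym_diff C D) s"
proof (induction C rule: finite_linorder_min_induct[OF finite])
  case (2 m C)
  have m: "m \<notin> C" using 2(2) by blast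
  have "sym_diff {m} (sym_diff C D) = sym_diff (insert m C) D" using m by blast
  moreover have "perm_sign {m} (sym_diff C D) = perm_sign {m} C * perm_sign {m} D"
    by (rule perm_sign_right)
  moreover have "perm_sign {m} C = 1" using 2(2) by (intro perm_sign_singleton_min) auto
  ultimately show ?case
    using 2 by (simp add: gamma_insert_min G_scale G_gamma perm_sign_insert_left[OF m] mult.commute)
qed simp

lemma gamma_UNIV: "s \<in> S \<Longrightarrow> \<gamma> UNIV s = s"
  using G_volume by (simp add: basis_action_def)

text \<open>Since \<nu> acts as the identity, complementary basis elements act alike up to sign; on
  operators this is the folding of the ranks above 4.\<close>

lemma gamma_Compl: "s \<in> S \<Longrightarrow> \<gamma> (- C) s = perm_sign C UNIV *\<^sub>R \<gamma> C s"
proof -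
  assume s: "s \<in> S"
  have "sym_diff C UNIV = - C" by blast
  then have "\<gamma> C s = perm_sign C UNIV *\<^sub>R \<gamma> (- C) s"
    using gamma_gamma[OF s, of C UNIV] by (simp add: gamma_UNIV s)
  then show ?thesis by simp
qed

text \<open>The adjoint of a product of self-adjoint factors is the reversed product.\<close>

lemma b_gamma: "s \<in> S \<Longrightarrow> t \<in> S \<Longrightarrow> b (\<gamma> C s) t = perm_sign C C * b s (\<gamma> C t)"
proof (induction C arbitrary: t rule: finite_linorder_min_induct[OF finite])
  case (2 m C)
  have m: "m \<notin> C" using 2(2) by blast
  have e: "sym_diff C {m} = insert m C" using m by auto
  have "b (\<gamma> (insert m C) s) t = perm_sign C C * b s (\<gamma> C (\<gamma> {m} t))"
    using 2 by (simp add: gamma_insert_min gamma_singleton G_self_adjoint)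
  also have "\<dots> = perm_sign C C * perm_sign C {m} * b s (\<gamma> (insert m C) t)"
    using 2(4,5) b_scale[of "\<gamma> (insert m C) t" s "perm_sign C {m}"]
    by (simp add: gamma_gamma e b_sym[of s])
  also have "perm_sign C C * perm_sign C {m} = perm_sign (insert m C) (insert m C)"
    using 2(2) perm_sign_singleton_min[of C m]
    by (simp add: perm_sign_insert_left[OF m] perm_sign_insert_right[OF m] less_imp_le)
  finally show ?case .
qed simp

lemma gamma_ext_eq: "s \<in> S \<Longrightarrow> gamma_ext G \<omega> s = (\<Sum>C\<in>UNIV. \<omega> $ C *\<^sub>R \<gamma> C s)"
  by (simp add: gamma_ext_def antisym_prod_distinct basis_action_def)

lemma gamma_ext_in [simp]: "s \<in> S \<Longrightarrow> gamma_ext G \<omega> s \<in> S"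
  by (simp add: gamma_ext_eq)

lemma gamma_sum: "(\<And>i. i \<in> I \<Longrightarrow> s i \<in> S) \<Longrightarrow> \<gamma> C (\<Sum>i\<in>I. x i *\<^sub>R s i) = (\<Sum>i\<in>I. x i *\<^sub>R \<gamma> C (s i))"
  by (induction C rule: finite_linorder_min_induct[OF finite]) (simp_all add: gamma_insert_min G_sum)

lemma gamma_ext_prod: "s \<in> S \<Longrightarrow> gamma_ext G (\<omega> \<diamondop> \<eta>) s = gamma_ext G \<omega> (gamma_ext G \<eta> s)"
proof -
  assume s: "s \<in> S"
  have "gamma_ext G (\<omega> \<diamondop> \<eta>) s = (\<Sum>C\<in>UNIV. \<Sum>D\<in>UNIV.
      (perm_sign D (sym_diff D C) * \<omega> $ D * \<eta> $ sym_diff D C) *\<^sub>R \<gamma> C s)"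
    by (simp add: gamma_ext_eq s geometric_prod_nth scaleR_sum_left)
  also have "\<dots> = (\<Sum>D\<in>UNIV. \<Sum>C\<in>UNIV.
      (perm_sign D (sym_diff D C) * \<omega> $ D * \<eta> $ sym_diff D C) *\<^sub>R \<gamma> C s)"
    by (rule sum.swap)
  also have "\<dots> = (\<Sum>D\<in>UNIV. \<Sum>C\<in>UNIV. (\<omega> $ D * \<eta> $ C) *\<^sub>R \<gamma> D (\<gamma> C s))"
  proof (rule sum.cong[OF refl])
    fix D
    show "(\<Sum>C\<in>UNIV. (perm_sign D (sym_diff D C) * \<omega> $ D * \<eta> $ sym_diff D C) *\<^sub>R \<gamma> C s)
        = (\<Sum>C\<in>UNIV. (\<omega> $ D * \<eta> $ C) *\<^sub>R \<gamma> D (\<gamma> C s))"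
      by (subst sum_sym_diff[of _ D, symmetric], unfold sym_diff_cancel)
         (simp add: gamma_gamma s mult_ac)
  qed
  also have "\<dots> = gamma_ext G \<omega> (gamma_ext G \<eta> s)"
    by (simp add: gamma_ext_eq s gamma_sum scaleR_sum_right)
  finally show ?thesis .
qed

lemma gamma_ext_vol: "s \<in> S \<Longrightarrow> gamma_ext G vol_cone s = s"
  by (simp add: gamma_ext_eq vol_cone_nth gamma_UNIV if_distrib[of "\<lambda>x. x *\<^sub>R _"] cong: if_cong)

lemma gamma_ext_add: "gamma_ext G (\<omega> + \<eta>) s = gamma_ext G \<omega> s + gamma_ext G \<eta> s"
  by (simp add: gamma_ext_def scaleR_add_left sum.distrib)

lemma gamma_ext_scale: "gamma_ext G (x *\<^sub>R \<omega>) s = x *\<^sub>R gamma_ext G \<omega> s"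
  by (simp add: gamma_ext_def scaleR_sum_right)

lemma b_gamma_ext: "s \<in> S \<Longrightarrow> t \<in> S \<Longrightarrow> b (gamma_ext G (reversion \<omega>) s) t = b s (gamma_ext G \<omega> t)"
  by (simp add: gamma_ext_eq b_sum b_gamma reversion_nth b_sym[of s] mult_ac)

text \<open>Invariance under \<nu> is the natural restriction here, as
  \<open>\<omega> - \<omega> \<diamondop> vol_cone\<close> acts as zero for every \<omega>.\<close>

lemma gamma_ext_faithful:
  assumes "\<omega> \<diamondop> vol_cone = \<omega>" "\<And>s. s \<in> S \<Longrightarrow> gamma_ext G \<omega> s = 0"
  shows "\<omega> = 0"
proof -
  \<comment> \<open>\<open>\<omega>\<close> is determined by its components without radial index, to which \<open>G_iso\<close> applies.\<close>
  define \<omega>' :: ext where "\<omega>' = (\<chi> C. if 8 \<in> C then 0 else \<omega> $ C)"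
  have "\<not> C \<subseteq> {..<8} \<longleftrightarrow> 8 \<in> C" for C :: "9 set"
    using index_cases by (auto simp: subset_iff)
  then have zero: "\<forall>C. \<not> C \<subseteq> {..<8} \<longrightarrow> \<omega>' $ C = 0"
    by (simp add: \<omega>'_def)
  \<comment> \<open>Of two complementary index sets exactly one contains 8, so the two summands have
    disjoint supports that together cover all index sets.\<close>
  have "\<omega>' + \<omega>' \<diamondop> vol_cone = \<omega>"
  proof (subst vec_eq_iff, intro allI)
    fix C
    have "\<omega> $ C = perm_sign (- C) UNIV * \<omega> $ (- C)"
      using assms(1) geometric_prod_vol_nth[of \<omega> C] by simp
    then show "(\<omega>' + \<omega>' \<diamondop> vol_cone) $ C = \<omega> $ C"
      by (simp add: geometric_prod_vol_nth \<omega>'_def)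
  qed
  then have "gamma_ext G \<omega> s = 2 *\<^sub>R gamma_ext G \<omega>' s" if "s \<in> S" for s
    using that gamma_ext_add[of \<omega>' "\<omega>' \<diamondop> vol_cone" s]
    by (simp add: gamma_ext_prod gamma_ext_vol scaleR_2)
  then have "\<forall>s\<in>S. gamma_ext G \<omega>' s = 0" using assms(2) by simp
  moreover have "linear_between S S (\<lambda>s. 0)"
    by (auto simp: linear_between_def)
  ultimately have "\<omega>' = 0"
    using G_iso[of "\<lambda>s. 0"] zero by (smt (verit) gamma_ext_scale scaleR_zero_left zero_index)
  with \<open>\<omega>' + \<omega>' \<diamondop> vol_cone = \<omega>\<close> show ?thesis
    by (simp add: geometric_prod_simps)
qed

text \<open>The untruncated form Y is fixed by \<nu>, so its ranks above 4 are determined by the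
  lower ones and truncation loses nothing; Y acts as twice the composition.\<close>

lemma trunc_prod_eq_0_iff:
  "\<omega> \<diamondop>\<^sub>+ \<eta> = 0 \<longleftrightarrow> (\<forall>s\<in>S. gamma_ext G \<omega> (gamma_ext G \<eta> s) = 0)"
proof -
  define Y where "Y = \<omega> \<diamondop> \<eta> + \<omega> \<diamondop> \<eta> \<diamondop> vol_cone"
  have Y: "Y \<diamondop> vol_cone = Y"
    by (simp add: Y_def geometric_prod_simps vol_square add.commute)
  have \<gamma>Y: "gamma_ext G Y s = 2 *\<^sub>R gamma_ext G \<omega> (gamma_ext G \<eta> s)" if "s \<in> S" for s
    using that by (simp add: Y_def gamma_ext_add gamma_ext_prod gamma_ext_vol scaleR_2)
  have "P_less Y = 0 \<longleftrightarrow> Y = 0"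
  proof
    assume *: "P_less Y = 0"
    have low: "Y $ C = 0" if "card C \<le> 4" for C
      using arg_cong[OF *, of "\<lambda>\<omega>. \<omega> $ C"] that by (simp add: P_less_def)
    have "Y $ C = 0" for C
    proof (cases "card C \<le> 4")
      case False
      have "card C + card (- C) = 9"
        using card_Un_disjoint[of C "- C"] by (simp add: Compl_partition)
      then have "Y $ (- C) = 0" using False low by simp
      then show ?thesis using Y geometric_prod_vol_nth[of Y C] by simp
    qed (rule low)
    then show "Y = 0" by (simp add: vec_eq_iff)
  qed (simp add: linear_0[OF linear_P_less])
  also have "Y = 0 \<longleftrightarrow> (\<forall>s\<in>S. gamma_ext G Y s = 0)"
    using gamma_ext_faithful[OF Y] by (auto simp: gamma_ext_def)
  finally show ?thesis
    by (simp add: trunc_prod_eq Y_def[symmetric] \<gamma>Y)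
qed

text \<open>Write L as the action of \<omega>. Conjugation by \<open>G a\<close> fixes L and
  multiplies the coefficient at C by \<open>(-1) ^ card (C - {a})\<close>, so by uniqueness of
  \<omega> this cardinality is even wherever the coefficient is nonzero. For nonempty C an index in
  C makes \<open>card C\<close> odd, while the radial index, which is not in C, makes it even. Only
  the scalar part remains.\<close>

lemma commutant_scalar:
  assumes L: "linear_between S S L" and commutes: "\<And>a s. s \<in> S \<Longrightarrow> L (G a s) = G a (L s)"
  shows "\<exists>c. \<forall>s\<in>S. L s = c *\<^sub>R s"
proof -
  have L_in: "s \<in> S \<Longrightarrow> L s \<in> S" for s using L by (auto simp: linear_between_def)
  from G_iso[OF L] obtain \<omega> where low: "\<And>C. \<not> C \<subseteq> {..<8} \<Longrightarrow> \<omega> $ C = 0"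
    and \<omega>: "\<And>s. s \<in> S \<Longrightarrow> gamma_ext G \<omega> s = L s"
    and unique: "\<And>\<omega>'. (\<forall>C. \<not> C \<subseteq> {..<8} \<longrightarrow> \<omega>' $ C = 0) \<Longrightarrow> (\<forall>s\<in>S. gamma_ext G \<omega>' s = L s) \<Longrightarrow> \<omega>' = \<omega>"
    by metis
  have even: "even (card (C - {a}))" if "\<omega> $ C \<noteq> 0" for a C
  proof -
    define \<omega>' :: ext where "\<omega>' = (\<chi> C. perm_sign {a} C * perm_sign C {a} * \<omega> $ C)"
    have "gamma_ext G \<omega>' s = L s" if s: "s \<in> S" for s
    proof -
      have "perm_sign (sym_diff {a} C) {a} = perm_sign C {a}" for C
        using perm_sign_left[of "{a}" C "{a}"] by simp
      moreover have "sym_diff (sym_diff {a} C) {a} = C" for C by blast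
      ultimately have "G a (\<gamma> C (G a s)) = (perm_sign {a} C * perm_sign C {a}) *\<^sub>R \<gamma> C s" for C
        using gamma_gamma[OF s, of "sym_diff {a} C" "{a}"] s
        by (simp add: G_gamma gamma_singleton)
      then have "gamma_ext G \<omega>' s = G a (gamma_ext G \<omega> (G a s))"
        using s by (simp add: gamma_ext_eq G_sum \<omega>'_def mult_ac)
      also have "\<dots> = L s" using s by (simp add: \<omega> commutes L_in G_square)
      finally show ?thesis .
    qed
    then have "\<omega>' = \<omega>" by (intro unique) (auto simp: \<omega>'_def low)
    from arg_cong[OF this, of "\<lambda>v. v $ C"]
    have "perm_sign {a} C * perm_sign C {a} * \<omega> $ C = \<omega> $ C"
      by (simp add: \<omega>'_def)
    then show ?thesis
      using that by (simp add: perm_sign_singleton_commute minus_one_power_iff split: if_splits)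
  qed
  have zero: "\<omega> $ C = 0" if ne: "C \<noteq> {}" for C
  proof (rule ccontr)
    assume C: "\<omega> $ C \<noteq> 0"
    obtain a where "a \<in> C" using ne by auto
    then have odd: "odd (card C)"
      using even[OF C, of a] card_Suc_Diff1[of C a] by (metis even_Suc finite)
    have "8 \<notin> C" using low[of C] C by auto
    then show False using even[OF C, of 8] odd by simp
  qed
  have "L s = \<omega> $ {} *\<^sub>R s" if "s \<in> S" for s
  proof -
    have "L s = (\<Sum>C\<in>{{}}. \<omega> $ C *\<^sub>R \<gamma> C s)"
      unfolding \<omega>[OF that, symmetric] gamma_ext_eq[OF that]
      by (rule sum.mono_neutral_right) (auto simp: zero)
    then show ?thesis by simp
  qed
  then show ?thesis by blast
qed

text \<open>The scalar \<open>l s u\<close> is read off at x = t = z; exchanging the pairs (s, u)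
  and (z, z) turns it into \<open>l z z * b s u\<close>, so c is \<open>l z z\<close>.\<close>

lemma fierz:
  assumes z: "z \<in> S" "b z z = 1"
  shows "\<exists>c>0. \<forall>s\<in>S. \<forall>u\<in>S. \<forall>x\<in>S.
    (\<Sum>C\<in>UNIV. b x (\<gamma> C u) *\<^sub>R \<gamma> C s) = (c * b s u) *\<^sub>R x"
proof -
  define L where "L s u x = (\<Sum>C\<in>UNIV. b x (\<gamma> C u) *\<^sub>R \<gamma> C s)" for s u x
  have "\<exists>c. \<forall>x\<in>S. L s u x = c *\<^sub>R x" if s: "s \<in> S" and u: "u \<in> S" for s u
  proof -
    have "linear_between S S (L s u)"
      using s u by (auto simp: linear_between_def L_def b_linear scaleR_add_left sum.distrib scaleR_sum_right)
    moreover have "L s u (G a x) = G a (L s u x)" if x: "x \<in> S" for a x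
    proof -
      \<comment> \<open>Self-adjointness moves \<open>G a\<close> onto \<open>\<gamma> C u\<close>,
        where it shifts C by \<open>{a}\<close>; reindexing transfers the shift to
        \<open>\<gamma> C s\<close>.\<close>
      have "L s u (G a x) = (\<Sum>C\<in>UNIV. (perm_sign {a} C * b x (\<gamma> (sym_diff {a} C) u)) *\<^sub>R \<gamma> C s)"
        using x u b_scale[of _ x] by (simp add: L_def G_self_adjoint G_gamma b_sym[of x])
      also have "\<dots> = (\<Sum>C\<in>UNIV. (perm_sign {a} C * b x (\<gamma> C u)) *\<^sub>R \<gamma> (sym_diff {a} C) s)"
        by (subst sum_sym_diff[of _ "{a}", symmetric], unfold sym_diff_cancel) (simp add: perm_sign_right)
      also have "\<dots> = G a (L s u x)"
        using s by (simp add: L_def G_sum G_gamma mult.commute)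
      finally show ?thesis .
    qed
    ultimately show ?thesis by (rule commutant_scalar)
  qed
  then obtain l where l: "\<And>s u x. s \<in> S \<Longrightarrow> u \<in> S \<Longrightarrow> x \<in> S \<Longrightarrow> L s u x = l s u *\<^sub>R x"
    by metis
  have bL: "b (L s u x) t = l s u * b x t" if "s \<in> S" "u \<in> S" "x \<in> S" "t \<in> S" for s u x t
    using that by (simp add: l b_scale)
  have L_sum: "b (L s u x) t = (\<Sum>C\<in>UNIV. b x (\<gamma> C u) * b (\<gamma> C s) t)"
    if "s \<in> S" "u \<in> S" "x \<in> S" "t \<in> S" for s u x t
    using that by (simp add: L_def b_sum)
  \<comment> \<open>\<^term>\<open>b (L s u x) t\<close> does not change if (s, u) and (x, t) are exchanged.\<close>
  have "l s u = l z z * b s u" if "s \<in> S" "u \<in> S" for s u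
  proof -
    have "l s u = b (L s u z) z" using that z by (simp add: bL)
    also have "\<dots> = (\<Sum>C\<in>UNIV. b s (\<gamma> C z) * b (\<gamma> C z) u)"
      unfolding L_sum[OF that z(1) z(1)]
      using that z by (intro sum.cong refl) (simp add: b_gamma b_sym[of z "\<gamma> _ u"] mult_ac)
    also have "\<dots> = b (L z z s) u" using that z by (simp add: L_sum)
    also have "\<dots> = l z z * b s u" using that z by (simp add: bL)
    finally show ?thesis .
  qed
  \<comment> \<open>A sum of squares to which the empty index set contributes the square of
    \<open>b z z\<close>, that is 1.\<close>
  moreover have "l z z > 0"
  proof -
    have "b (\<gamma> C z) z = b z (\<gamma> C z)" for C using z by (simp add: b_sym)
    then have "l z z = (\<Sum>C\<in>UNIV. (b z (\<gamma> C z))\<^sup>2)"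
      using bL[of z z z z] L_sum[of z z z z] z by (simp add: power2_eq_square)
    moreover have "(b z (\<gamma> {} z))\<^sup>2 \<le> (\<Sum>C\<in>UNIV. (b z (\<gamma> C z))\<^sup>2)"
      by (rule member_le_sum) auto
    ultimately show ?thesis using z by simp
  qed
  ultimately show ?thesis using l by (intro exI[of _ "l z z"]) (simp add: L_def)
qed

text \<open>By complementation the full Fierz sum is twice its part of rank at most 4, in which rank
  0 drops out through \<open>b x u = 0\<close>. The 64 in the proof is this 2 times the
  normalization 32.\<close>

lemma pinor_bilinears_operator:
  assumes S: "x \<in> S" "u \<in> S" and norm: "b x x = 1" and orth: "b x u = 0"
  shows "\<exists>c>0. \<forall>s\<in>S. gamma_ext G ((1/32) *\<^sub>R
    (bilinear_form b G 1 x u + bilinear_form b G 2 x u + bilinear_form b G 3 x u + bilinear_form b G 4 x u)) s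
    = (c * b s u) *\<^sub>R x"
proof -
  define E where "E = (1/32) *\<^sub>R
    (bilinear_form b G 1 x u + bilinear_form b G 2 x u + bilinear_form b G 3 x u + bilinear_form b G 4 x u)"
  obtain c where c: "c > 0" and fierz: "\<forall>s\<in>S. \<forall>u\<in>S. \<forall>x\<in>S.
      (\<Sum>C\<in>UNIV. b x (\<gamma> C u) *\<^sub>R \<gamma> C s) = (c * b s u) *\<^sub>R x"
    using fierz[OF S(1) norm] by blast
  have E: "E $ C = (if card C \<le> 4 then b x (\<gamma> C u) / 32 else 0)" for C
  proof (cases "C = {}")
    case False
    then have "card C \<noteq> 0" by simp
    then have "card C = 1 \<or> card C = 2 \<or> card C = 3 \<or> card C = 4 \<or> card C > 4" by linarith
    then show ?thesis
      using S by (auto simp: E_def bilinear_form_def antisym_prod_distinct basis_action_def)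
  qed (simp add: E_def bilinear_form_def orth)
  have "gamma_ext G E s = ((c / 64) * b s u) *\<^sub>R x" if s: "s \<in> S" for s
  proof -
    let ?h = "\<lambda>C. b x (\<gamma> C u) *\<^sub>R \<gamma> C s"
    let ?low = "{C :: 9 set. card C \<le> 4}"
    have card: "card C + card (- C) = 9" for C :: "9 set"
      using card_Un_disjoint[of C "- C"] by (simp add: Compl_partition)
    have compl_low: "card (- C) \<le> 4 \<longleftrightarrow> \<not> card C \<le> 4" for C :: "9 set"
      using card[of C] by linarith
    \<comment> \<open>The sign of \<open>gamma_Compl\<close> occurs in both factors and squares to
      1.\<close>
    have "?h (- C) = ?h C" for C
      using S s b_scale[of "\<gamma> C u" x "perm_sign C UNIV"] by (simp add: gamma_Compl b_sym[of x])
    then have high: "sum ?h (- ?low) = sum ?h ?low"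
      by (intro sum.reindex_bij_witness[of _ uminus uminus]) (auto simp: compl_low)
    have "(c * b s u) *\<^sub>R x = sum ?h ?low + sum ?h (- ?low)"
      unfolding fierz[rule_format, OF s S(2,1), symmetric] by (subst sum.union_disjoint[symmetric]) auto
    also have "\<dots> = 2 *\<^sub>R sum ?h ?low" by (simp add: high scaleR_2)
    also have "\<dots> = 64 *\<^sub>R gamma_ext G E s"
      by (simp add: gamma_ext_eq[OF s] E scaleR_sum_right sum.If_cases if_distrib[of "\<lambda>x. x *\<^sub>R _"] cong: if_cong)
    finally have "(1/64) *\<^sub>R (c * b s u) *\<^sub>R x = (1/64) *\<^sub>R 64 *\<^sub>R gamma_ext G E s"
      by (rule arg_cong)
    then show ?thesis by simp
  qed
  then show ?thesis using c by (intro exI[of _ "c / 64"]) (simp add: E_def)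
qed

text \<open>In \<open>Q \<diamondop>\<^sub>+ E\<close> the form Q is applied to x, and s = u
  exhibits a nonzero coefficient. In the other product \<open>reversion Q\<close> is the adjoint of
  Q, so the coefficient of x is a multiple of \<open>b s (gamma_ext G Q u)\<close>, and its
  vanishing for all s forces \<open>gamma_ext G Q u = 0\<close> by positivity of the pairing.
  Difference and sum of the two products vanish together iff both products do.\<close>

lemma algebraic_constraints:
  assumes S: "x \<in> S" "u \<in> S" and norm: "b x x = 1" "b u u = 1" and orth: "b x u = 0"
  defines "E \<equiv> (1/32) *\<^sub>R
    (bilinear_form b G 1 x u + bilinear_form b G 2 x u + bilinear_form b G 3 x u + bilinear_form b G 4 x u)"
  shows "gamma_ext G Q x = 0 \<and> gamma_ext G Q u = 0 \<longleftrightarrow>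
    Q \<diamondop>\<^sub>+ E - E \<diamondop>\<^sub>+ reversion Q = 0 \<and> Q \<diamondop>\<^sub>+ E + E \<diamondop>\<^sub>+ reversion Q = 0"
proof -
  obtain c where c: "c > 0" and E: "\<forall>s\<in>S. gamma_ext G E s = (c * b s u) *\<^sub>R x"
    unfolding E_def using pinor_bilinears_operator[OF S norm(1) orth] by blast
  have x0: "x \<noteq> 0" using norm(1) S by auto
  have scale: "gamma_ext G Q (y *\<^sub>R x) = y *\<^sub>R gamma_ext G Q x" for y
    using S by (simp add: gamma_ext_eq gamma_scale scaleR_sum_right mult.commute)
  have "Q \<diamondop>\<^sub>+ E = 0 \<longleftrightarrow> (\<forall>s\<in>S. (c * b s u) *\<^sub>R gamma_ext G Q x = 0)"
    by (simp add: trunc_prod_eq_0_iff E scale)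
  also have "\<dots> \<longleftrightarrow> gamma_ext G Q x = 0"
    using c norm(2) S(2) by auto
  finally have 1: "Q \<diamondop>\<^sub>+ E = 0 \<longleftrightarrow> gamma_ext G Q x = 0" .
  have "E \<diamondop>\<^sub>+ reversion Q = 0 \<longleftrightarrow> (\<forall>s\<in>S. b s (gamma_ext G Q u) = 0)"
    using c S x0 by (simp add: trunc_prod_eq_0_iff E b_gamma_ext)
  also have "\<dots> \<longleftrightarrow> gamma_ext G Q u = 0"
  proof
    assume *: "\<forall>s\<in>S. b s (gamma_ext G Q u) = 0"
    then have "b (gamma_ext G Q u) (gamma_ext G Q u) = 0" using S by simp
    then show "gamma_ext G Q u = 0"
      using b_pos[of "gamma_ext G Q u"] S by auto
  next
    assume *: "gamma_ext G Q u = 0"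
    then show "\<forall>s\<in>S. b s (gamma_ext G Q u) = 0" by (simp add: b_sym[of _ 0])
  qed
  finally have 2: "E \<diamondop>\<^sub>+ reversion Q = 0 \<longleftrightarrow> gamma_ext G Q u = 0" .
  have "X - Y = 0 \<and> X + Y = 0 \<longleftrightarrow> X = 0 \<and> Y = 0" for X Y :: ext
    by (auto simp: scaleR_2[symmetric])
  then show ?thesis using 1 2 by simp
qed

end

section \<open>Differential forms on tuples of tangent vectors\<close>

lemma tangent_combination:
  assumes "u \<in> tangent A x" "v \<in> tangent A x"
  shows "fscale a u + fscale b v \<in> tangent A x"
  using assms by (auto simp: tangent_def fscale_def algebra_simps)

lemma tangent_scale: "u \<in> tangent A x \<Longrightarrow> fscale a u \<in> tangent A x"
  by (auto simp: tangent_def fscale_def algebra_simps)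

lemma differential_form_linear:
  assumes "differential_form A k \<alpha>" "x \<in> points A" "Suc (length us + length ws) = k"
    and "set us \<subseteq> tangent A x" "set ws \<subseteq> tangent A x" "u \<in> tangent A x" "v \<in> tangent A x"
  shows "\<alpha> x (us @ (fscale a u + fscale b v) # ws) = a * \<alpha> x (us @ u # ws) + b * \<alpha> x (us @ v # ws)"
proof -
  have "\<forall>vs. length vs = k \<longrightarrow> set vs \<subseteq> tangent A x \<longrightarrow>
      (\<forall>i<k. \<forall>u\<in>tangent A x. \<forall>w\<in>tangent A x. \<forall>a b.
        \<alpha> x (vs[i := fscale a u + fscale b w]) = a * \<alpha> x (vs[i := u]) + b * \<alpha> x (vs[i := w]))"
    using assms(1,2) unfolding differential_form_def by blast
  from this[rule_format, of "us @ u # ws" "length us" u v a b] assms show ?thesis by simp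
qed

lemma differential_form_alternating:
  assumes "differential_form A k \<alpha>" "x \<in> points A" "length vs = k" "set vs \<subseteq> tangent A x"
    and "i < k" "j < k" "i \<noteq> j" "vs ! i = vs ! j"
  shows "\<alpha> x vs = 0"
  using assms unfolding differential_form_def by blast

text \<open>Polarization of the alternating property at u + v, written
  \<open>fscale 1 u + fscale 1 v\<close> to match the multilinearity in
  \<open>differential_form\<close>.\<close>

lemma differential_form_swap:
  assumes "differential_form A k \<alpha>" "x \<in> points A" "Suc (Suc (length us + length ws)) = k"
    and "set us \<subseteq> tangent A x" "set ws \<subseteq> tangent A x" "u \<in> tangent A x" "v \<in> tangent A x"
  shows "\<alpha> x (us @ u # v # ws) = - \<alpha> x (us @ v # u # ws)"
proof -
  have lin1: "\<alpha> x (us @ (fscale 1 u + fscale 1 v) # w # ws) = \<alpha> x (us @ u # w # ws) + \<alpha> x (us @ v # w # ws)"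
    if "w \<in> tangent A x" for w
    using differential_form_linear[OF assms(1,2), of us "w # ws" u v 1 1] assms that by simp
  have lin2: "\<alpha> x (us @ w # (fscale 1 u + fscale 1 v) # ws) = \<alpha> x (us @ w # u # ws) + \<alpha> x (us @ w # v # ws)"
    if "w \<in> tangent A x" for w
    using differential_form_linear[OF assms(1,2), of "us @ [w]" ws u v 1 1] assms that by simp
  have alt: "\<alpha> x (us @ w # w # ws) = 0" if "w \<in> tangent A x" for w
    using differential_form_alternating[OF assms(1,2), of "us @ w # w # ws" "length us" "Suc (length us)"]
      assms that by (simp add: nth_append)
  have uv: "fscale 1 u + fscale 1 v \<in> tangent A x" using assms by (intro tangent_combination)
  show ?thesis
    using alt[OF uv] alt[OF assms(6)] alt[OF assms(7)] lin1[OF uv] lin2[OF assms(6)] lin2[OF assms(7)]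
    by simp
qed

text \<open>Supplies the powers of 1/r by which values on the cone frame differ from values on the
  frame of M.\<close>

lemma differential_form_scale:
  assumes "differential_form A k \<alpha>" "x \<in> points A" "length us + length ws = k"
    and "set us \<subseteq> tangent A x" "set ws \<subseteq> tangent A x"
  shows "\<alpha> x (us @ map (fscale c) ws) = c ^ length ws * \<alpha> x (us @ ws)"
  using assms(3-5)
proof (induction ws arbitrary: us)
  case (Cons w ws)
  have "set (map (fscale c) ws) \<subseteq> tangent A x"
    using Cons.prems by (auto intro: tangent_scale)
  then have "\<alpha> x (us @ fscale c w # map (fscale c) ws) = c * \<alpha> x (us @ w # map (fscale c) ws)"
    using differential_form_linear[OF assms(1,2), of us "map (fscale c) ws" w w c 0] Cons.prems
    by (simp add: fscale_def zero_fun_def[symmetric])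
  moreover have "\<alpha> x ((us @ [w]) @ map (fscale c) ws) = c ^ length ws * \<alpha> x ((us @ [w]) @ ws)"
    using Cons.prems by (intro Cons.IH) auto
  ultimately show ?case by simp
qed simp

lemma differential_form_zero:
  assumes "differential_form A k \<alpha>" "x \<in> points A" "length vs = k" "set vs \<subseteq> tangent A x" "0 \<in> set vs"
  shows "\<alpha> x vs = 0"
proof -
  obtain us ws where vs: "vs = us @ 0 # ws" using assms(5) by (meson split_list)
  have "fscale 0 (0 :: 'a vec) + fscale 0 0 = 0" by (simp add: fscale_def zero_fun_def)
  then show ?thesis
    using differential_form_linear[OF assms(1,2), of us ws 0 0 0 0] assms(3,4) by (simp add: vs)
qed

text \<open>Insertion sort only exchanges neighbours. The hypothesis ranges over rearrangements of
  \<open>xs\<close>, so that properties such as distinctness are available at every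
  exchange.\<close>

lemma sort_invariant:
  fixes xs :: "'a::linorder list"
  assumes "\<And>us u v ws. mset (us @ u # v # ws) = mset xs \<Longrightarrow> H (us @ u # v # ws) = H (us @ v # u # ws)"
  shows "H (sort xs) = H xs"
proof -
  have insort: "H (us @ insort x ys) = H (us @ x # ys)" if "mset (us @ x # ys) = mset xs" for us x ys
    using that
  proof (induction ys arbitrary: us)
    case (Cons y ys)
    have "H (us @ y # insort x ys) = H ((us @ [y]) @ x # ys)"
      using Cons.IH[of "us @ [y]"] Cons.prems by (simp add: add_mset_commute)
    also have "\<dots> = H (us @ x # y # ys)"
      using assms[of us x y ys] Cons.prems by simp
    finally show ?case by simp
  qed simp
  have "H (us @ sort ys) = H (us @ ys)" if "mset (us @ ys) = mset xs" for us ys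
    using that
  proof (induction ys arbitrary: us)
    case (Cons y ys)
    have "H (us @ insort y (sort ys)) = H (us @ y # sort ys)"
      using Cons.prems by (intro insort) simp
    also have "\<dots> = H (us @ y # ys)"
      using Cons.IH[of "us @ [y]"] Cons.prems by simp
    finally show ?case by simp
  qed simp
  from this[of "[]" xs] show ?thesis by simp
qed

text \<open>Passes from the unrestricted index sums of \<open>killing_Q\<close> to the increasing
  index lists of \<open>ext\<close>: each set has \<open>fact n\<close> orderings, all with the same
  value by \<open>swap\<close>.\<close>

lemma sum_lists_eq_sum_sets:
  fixes H :: "'a::{finite,linorder} list \<Rightarrow> 'v::real_vector"
  assumes nondistinct: "\<And>xs. length xs = n \<Longrightarrow> set xs \<subseteq> I \<Longrightarrow> \<not> distinct xs \<Longrightarrow> H xs = 0"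
    and swap: "\<And>us u v ws. distinct (us @ u # v # ws) \<Longrightarrow> length (us @ u # v # ws) = n \<Longrightarrow>
      set (us @ u # v # ws) \<subseteq> I \<Longrightarrow> H (us @ u # v # ws) = H (us @ v # u # ws)"
  shows "(\<Sum>xs | length xs = n \<and> set xs \<subseteq> I. H xs)
    = fact n *\<^sub>R (\<Sum>C | C \<subseteq> I \<and> card C = n. H (sorted_list_of_set C))"
proof -
  let ?D = "{xs. length xs = n \<and> set xs \<subseteq> I \<and> distinct xs}"
  have fin: "finite {xs. length xs = n \<and> set xs \<subseteq> I}"
    using finite_lists_length_eq[of I n] by (simp add: conj_commute)
  have "(\<Sum>xs | length xs = n \<and> set xs \<subseteq> I. H xs) = sum H ?D"
    using fin nondistinct by (intro sum.mono_neutral_right) auto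
  also have "\<dots> = (\<Sum>C | C \<subseteq> I \<and> card C = n. sum H {xs \<in> ?D. set xs = C})"
  proof (rule sum.group[symmetric])
    show "finite ?D" by (rule finite_subset[OF _ fin]) auto
  qed (auto simp: distinct_card)
  also have "\<dots> = (\<Sum>C | C \<subseteq> I \<and> card C = n. fact n *\<^sub>R H (sorted_list_of_set C))"
  proof (rule sum.cong[OF refl])
    fix C assume "C \<in> {C. C \<subseteq> I \<and> card C = n}"
    then have C: "C \<subseteq> I" "card C = n" by auto
    have D: "{xs \<in> ?D. set xs = C} = permutations_of_set C"
      using C by (auto simp: permutations_of_set_def distinct_card)
    have "H xs = H (sorted_list_of_set C)" if xs: "xs \<in> permutations_of_set C" for xs
    proof -
      have "distinct xs" "set xs = C" using xs by (auto simp: permutations_of_set_def)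
      then have "sorted_list_of_set C = sort xs"
        using sorted_list_of_set_sort_remdups[of xs] by (simp add: distinct_remdups_id)
      moreover have "H (sort xs) = H xs"
      proof (rule sort_invariant)
        fix us u v ws assume eq: "mset (us @ u # v # ws) = mset xs"
        show "H (us @ u # v # ws) = H (us @ v # u # ws)"
          using mset_eq_setD[OF eq] mset_eq_length[OF eq] mset_eq_imp_distinct_iff[OF eq]
            \<open>distinct xs\<close> \<open>set xs = C\<close> C distinct_card[of xs]
          by (intro swap) auto
      qed
      ultimately show ?thesis by simp
    qed
    then show "sum H {xs \<in> ?D. set xs = C} = fact n *\<^sub>R H (sorted_list_of_set C)"
      unfolding D using C card_permutations_of_set[of C] by (simp add: sum_constant_scaleR)
  qed
  finally show ?thesis by (simp add: scaleR_sum_right)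
qed

lemma sum_lists_4:
  fixes H :: "'a::finite list \<Rightarrow> 'v::comm_monoid_add"
  shows "(\<Sum>m\<in>I. \<Sum>p\<in>I. \<Sum>q\<in>I. \<Sum>r\<in>I. H [m, p, q, r]) = (\<Sum>xs | length xs = 4 \<and> set xs \<subseteq> I. H xs)"
proof -
  have "(\<Sum>m\<in>I. \<Sum>p\<in>I. \<Sum>q\<in>I. \<Sum>r\<in>I. H [m, p, q, r])
      = (\<Sum>(m, p, q, r)\<in>I \<times> I \<times> I \<times> I. H [m, p, q, r])"
    by (simp add: sum.cartesian_product case_prod_unfold)
  also have "\<dots> = (\<Sum>xs | length xs = 4 \<and> set xs \<subseteq> I. H xs)"
  proof (rule sum.reindex_bij_witness[of _ "\<lambda>xs. (xs ! 0, xs ! 1, xs ! 2, xs ! 3)" "\<lambda>(m, p, q, r). [m, p, q, r]"])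
    fix xs assume "xs \<in> {xs. length xs = 4 \<and> set xs \<subseteq> I}"
    then have l: "length xs = 4" and s: "set xs \<subseteq> I" by auto
    show "(case (xs ! 0, xs ! 1, xs ! 2, xs ! 3) of (m, p, q, r) \<Rightarrow> [m, p, q, r]) = xs"
      using l by (intro nth_equalityI) (auto simp: less_Suc_eq numeral_eq_Suc)
    show "(xs ! 0, xs ! 1, xs ! 2, xs ! 3) \<in> I \<times> I \<times> I \<times> I"
      using l s nth_mem[of _ xs] by auto
  qed (auto simp: numeral_eq_Suc)
  finally show ?thesis .
qed

section \<open>The pinor bundle and the cone\<close>

lemma lessThan_8: "{..<8 :: 9} = {0, 1, 2, 3, 4, 5, 6, 7}"
proof -
  have "c \<in> {..<8 :: 9} \<longleftrightarrow> c \<in> {0, 1, 2, 3, 4, 5, 6, 7}" for c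
  proof (cases c)
    case (of_int z)
    then have "z \<in> {0, 1, 2, 3, 4, 5, 6, 7, 8}" by auto
    then show ?thesis
      unfolding of_int(1) by (auto simp: less_bit1_def bit1.Rep_numeral bit1.Rep_0 bit1.Rep_1)
  qed
  then show ?thesis by blast
qed

lemma sorted_list_UNIV_9: "sorted_list_of_set (UNIV :: 9 set) = base_indices @ [8]"
proof -
  have "UNIV = insert 8 {..<8 :: 9}" using index_cases by auto
  then have "UNIV = set (base_indices @ [8])" by (auto simp: lessThan_8 base_indices_def)
  moreover have "sorted (base_indices @ [8])" "distinct (base_indices @ [8])"
    by (simp_all add: base_indices_def less_eq_bit1_def bit1.Rep_numeral bit1.Rep_0 bit1.Rep_1
        bit1.Rep_inject_sym)
  ultimately show ?thesis
    by (metis distinct_remdups_id sorted_list_of_set_sort_remdups sorted_sort_id)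
qed

section \<open>Fibres of the pinor bundle as Clifford modules\<close>

context pinor_geometry
begin

lemma in_points [simp]: "x \<in> points A"
  by (simp add: points_UNIV)

lemma cl_in [simp]: "v \<in> tangent A x \<Longrightarrow> s \<in> S x \<Longrightarrow> cl x v s \<in> S x"
  using cl_linear by (auto simp: linear_between_def)

lemma cl_combination: "v \<in> tangent A x \<Longrightarrow> s \<in> S x \<Longrightarrow> t \<in> S x \<Longrightarrow>
  cl x v (a *\<^sub>R s + b *\<^sub>R t) = a *\<^sub>R cl x v s + b *\<^sub>R cl x v t"
  using cl_linear by (auto simp: linear_between_def)

lemma cl_minus: "v \<in> tangent A x \<Longrightarrow> s \<in> S x \<Longrightarrow> cl x v (- s) = - cl x v s"
  using cl_combination[of v x s s "-1" 0] by simp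

text \<open>Polarization of \<open>cl_square\<close> at u + v.\<close>

lemma cl_anticommute:
  assumes "u \<in> tangent A x" "v \<in> tangent A x" "s \<in> S x"
  shows "cl x u (cl x v s) + cl x v (cl x u s) = (2 * g x u v) *\<^sub>R s"
proof -
  let ?w = "u + v"
  have w: "?w \<in> tangent A x" using tangent_combination[OF assms(1,2), of 1 1] by simp
  have cl_w: "cl x ?w t = cl x u t + cl x v t" if "t \<in> S x" for t
    using cl_linear_vec[OF assms(1,2) that, of 1 1] by simp
  have g_w: "g x ?w t = g x u t + g x v t" if "t \<in> tangent A x" for t
    using metric_linear[OF assms(1,2) that, of 1 1] by simp
  have "cl x u (cl x u s) + cl x v (cl x u s) + (cl x u (cl x v s) + cl x v (cl x v s)) = cl x ?w (cl x ?w s)"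
    using assms w cl_combination[of u x "cl x u s" "cl x v s" 1 1]
      cl_combination[of v x "cl x u s" "cl x v s" 1 1]
    by (simp add: cl_w subspace_add[OF fibre_subspace])
  also have "\<dots> = g x ?w ?w *\<^sub>R s" using w assms by (intro cl_square)
  also have "g x ?w ?w = g x u u + 2 * g x u v + g x v v"
    using assms w by (simp add: g_w metric_sym[of u x ?w] metric_sym[of v x ?w] metric_sym[of v x u])
  finally show ?thesis
    using assms by (simp add: cl_square algebra_simps)
qed

text \<open>The ninth generator is the product of the other eight. It anticommutes with each of
  them, since each anticommutes with 7 of its factors; it squares to the identity and is
  self-adjoint, since reversing 8 factors has sign (-1)^28 = 1.\<close>

lemma gam_clifford_module:
  assumes e: "oriented_frame A g vol x e"
  shows "clifford_module (S x) (B x) (gam cl x e)"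
proof -
  let ?G = "gam cl x e"
  define c where "c m = cl x (e m)" for m
  have et: "e m \<in> tangent A x" if "m < 8" for m
    using e that by (simp add: oriented_frame_def)
  have c_in: "c m s \<in> S x" if "m < 8" "s \<in> S x" for m s
    using that et by (simp add: c_def)
  have c_neg: "c m (- s) = - c m s" if "m < 8" "s \<in> S x" for m s
    using that et by (simp add: c_def cl_minus)
  have c_lin: "c m (a *\<^sub>R s + b *\<^sub>R t) = a *\<^sub>R c m s + b *\<^sub>R c m t"
    if "m < 8" "s \<in> S x" "t \<in> S x" for m s t a b
    using that et by (simp add: c_def cl_combination)
  have c_sq: "c m (c m s) = s" if "m < 8" "s \<in> S x" for m s
    using that et e by (simp add: c_def cl_square oriented_frame_def)
  have c_anti: "c m (c n s) = - c n (c m s)" if "n \<noteq> m" "m < 8" "n < 8" "s \<in> S x" for m n s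
    using that et e cl_anticommute[of "e m" x "e n" s]
    by (simp add: c_def oriented_frame_def eq_neg_iff_add_eq_0)
  have c_adj: "B x (c m s) t = B x s (c m t)" if "m < 8" "s \<in> S x" "t \<in> S x" for m s t
    using that et by (simp add: c_def cl_self_adjoint)
  have neg_in: "- s \<in> S x" if "s \<in> S x" for s
    using that by (rule subspace_neg[OF fibre_subspace])
  have lt: "0 < (8::9)" "1 < (8::9)" "2 < (8::9)" "3 < (8::9)" "4 < (8::9)" "5 < (8::9)" "6 < (8::9)" "7 < (8::9)"
    by (simp_all add: less_bit1_def bit1.Rep_numeral bit1.Rep_0 bit1.Rep_1)
  have G_base: "?G a = c a" if "a < 8" for a using that by (simp add: gam_def c_def fun_eq_iff)
  have G8: "?G 8 s = c 0 (c 1 (c 2 (c 3 (c 4 (c 5 (c 6 (c 7 s)))))))" for s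
    by (simp add: gam_def base_indices_def c_def)
  \<comment> \<open>Restricted to n < m the rule sorts indices and thus terminates as a rewrite
    rule; products of base generators then have normal forms.\<close>
  have c_anti': "c m (c n s) = - c n (c m s)" if "n < m" "m < 8" "n < 8" "s \<in> S x" for m n s
    using c_anti[of n m s] that by auto
  note reorder = c_anti' c_sq c_in c_neg lt neg_in less_bit1_def bit1.Rep_numeral bit1.Rep_0 bit1.Rep_1
  have G8_anti: "c a (?G 8 s) = - ?G 8 (c a s)" if "a < 8" "s \<in> S x" for a s
  proof -
    from that(1) have "a \<in> {0, 1, 2, 3, 4, 5, 6, 7}" by (simp add: lessThan_8[symmetric])
    then show ?thesis
      by (elim insertE emptyE) (simp_all add: G8 reorder that(2))
  qed
  have G8_in: "?G 8 s \<in> S x" if "s \<in> S x" for s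
    using that by (simp add: G8 reorder)
  have G8_sq: "?G 8 (?G 8 s) = s" if "s \<in> S x" for s
    using that by (simp add: G8 reorder)
  have G8_adj: "B x (?G 8 s) t = B x s (?G 8 t)" if "s \<in> S x" "t \<in> S x" for s t
    using that by (simp add: G8 c_adj reorder)
  have G8_lin: "?G 8 (a *\<^sub>R s + b *\<^sub>R t) = a *\<^sub>R ?G 8 s + b *\<^sub>R ?G 8 t"
    if "s \<in> S x" "t \<in> S x" for s t a b
    using that by (simp add: G8 c_lin reorder)
  show ?thesis
  proof
    show "subspace (S x)" by (rule fibre_subspace)
    show "linear_between (S x) (S x) (?G a)" for a
      using index_cases[of a] by (auto simp: linear_between_def G_base c_in c_lin G8_in G8_lin)
    show "?G a (?G a s) = s" if "s \<in> S x" for a s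
      using that index_cases[of a] by (auto simp: G_base c_sq G8_sq)
    show "?G a (?G d s) = - ?G d (?G a s)" if "a \<noteq> d" "s \<in> S x" for a d s
      using that c_anti[of d a s] G8_anti[of a s] G8_anti[of d s] index_cases[of a] index_cases[of d]
      by (auto simp: G_base)
    \<comment> \<open>The ordered product of all nine generators is the square of the ninth.\<close>
    show "foldr ?G (sorted_list_of_set UNIV) s = s" if "s \<in> S x" for s
    proof -
      have "foldr ?G base_indices t = ?G 8 t" for t
        by (simp add: G8 base_indices_def G_base lt)
      then show ?thesis using that by (simp add: sorted_list_UNIV_9 G8_sq)
    qed
    show "B x (a *\<^sub>R s + b *\<^sub>R t) u = a * B x s u + b * B x t u"
      if "s \<in> S x" "t \<in> S x" "u \<in> S x" for s t u a b
      using that by (rule pairing_linear)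
    show "B x s t = B x t s" if "s \<in> S x" "t \<in> S x" for s t
      using that by (rule pairing_sym)
    show "B x s s > 0" if "s \<in> S x" "s \<noteq> 0" for s
      using that by (rule pairing_pos)
    show "B x (?G a s) t = B x s (?G a t)" if "s \<in> S x" "t \<in> S x" for a s t
      using that index_cases[of a] by (auto simp: G_base c_adj G8_adj)
    show "\<exists>!\<omega>. (\<forall>C. \<not> C \<subseteq> {..<8} \<longrightarrow> \<omega> $ C = 0) \<and> (\<forall>s\<in>S x. gamma_ext ?G \<omega> s = L s)"
      if "linear_between (S x) (S x) L" for L
      using e that by (rule cl_iso)
  qed
qed

end

lemma (in clifford_module) gamma_ext_rank_1:
  assumes "s \<in> S"
  shows "gamma_ext G (frame_components 1 E \<alpha>) s = (\<Sum>a\<in>UNIV. \<alpha> [E a] *\<^sub>R G a s)"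
proof -
  have "gamma_ext G (frame_components 1 E \<alpha>) s
      = (\<Sum>C | card C = 1. \<alpha> (map E (sorted_list_of_set C)) *\<^sub>R \<gamma> C s)"
    unfolding gamma_ext_eq[OF assms]
    by (rule sum.mono_neutral_cong_right) (auto simp: frame_components_def)
  also have "\<dots> = (\<Sum>a\<in>UNIV. \<alpha> [E a] *\<^sub>R G a s)"
    by (rule sum.reindex_bij_witness[of _ "\<lambda>a. {a}" the_elem])
       (auto simp: card_1_singleton_iff gamma_singleton)
  finally show ?thesis .
qed

lemma frame_components_rank [simp]: "rank_part k (frame_components k E \<alpha>) = frame_components k E \<alpha>"
  by (simp add: rank_part_def frame_components_def vec_eq_iff)

lemma bilinear_form_rank [simp]: "rank_part k (bilinear_form b G k s t) = bilinear_form b G k s t"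
  by (simp add: rank_part_def bilinear_form_def vec_eq_iff)

text \<open>Without a component of f along a nothing is contracted. This lets the wedge of f with
  \<theta> act as the composition of the action of f with \<open>G 8\<close>.\<close>

lemma wedge_coframe_orthogonal:
  assumes "rank_part 1 f = f" "f $ {a} = 0"
  shows "f \<^bold>\<and> coframe a = f \<diamondop> coframe a"
proof (subst vec_eq_iff, intro allI)
  fix C
  have "f $ D = 0 \<or> coframe a $ sym_diff D C = 0" if "\<not> D \<subseteq> C" for D
  proof (rule ccontr)
    assume *: "\<not> ?thesis"
    then have "card D = 1" using rank_part_zero_nth[OF assms(1)] by blast
    then obtain c where D: "D = {c}" by (auto simp: card_1_singleton_iff)
    then have "c \<noteq> a" using * assms(2) by auto
    moreover have "sym_diff D C = {a}" using * by (auto simp: coframe_def axis_def split: if_splits)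
    ultimately show False using that D by blast
  qed
  then show "(f \<^bold>\<and> coframe a) $ C = (f \<diamondop> coframe a) $ C"
    unfolding wedge_nth geometric_prod_nth by (intro sum.cong) auto
qed

lemma UNIV_9: "(UNIV :: 9 set) = insert 8 {..<8}"
  using index_cases by auto

section \<open>The algebraic constraint as the action of a form\<close>

context pinor_geometry
begin

text \<open>The 24 orderings of an index set give the factor 24. The factor \<open>r ^ 4\<close>
  cancels the 1/r of four cone frame vectors, and components with the radial index vanish because
  \<open>push (E 8) = 0\<close>.\<close>

lemma gamma_ext_four_form:
  assumes F: "differential_form A 4 F" and e: "oriented_frame A g vol x e"
    and push: "\<And>m. m < 8 \<Longrightarrow> push (E m) = fscale (1 / r) (e m)" "push (E 8) = 0" and r: "r > 0"
    and s: "s \<in> S x"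
  shows "(\<Sum>m<8. \<Sum>p<8. \<Sum>q<8. \<Sum>t<8. F x [e m, e p, e q, e t] *\<^sub>R antisym_prod (gam cl x e) [m, p, q, t] s)
    = 24 *\<^sub>R gamma_ext (gam cl x e) (frame_components 4 E (\<lambda>Vs. r ^ 4 * pullback F (r, x) Vs)) s"
proof -
  interpret clifford_module "S x" "B x" "gam cl x e" by (rule gam_clifford_module[OF e])
  let ?H = "\<lambda>xs. F x (map e xs) *\<^sub>R antisym_prod (gam cl x e) xs s"
  have et: "e ` I \<subseteq> tangent A x" if "I \<subseteq> {..<8}" for I
    using e that by (auto simp: oriented_frame_def)
  have "(\<Sum>m<8. \<Sum>p<8. \<Sum>q<8. \<Sum>t<8. F x [e m, e p, e q, e t] *\<^sub>R antisym_prod (gam cl x e) [m, p, q, t] s)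
      = (\<Sum>xs | length xs = 4 \<and> set xs \<subseteq> {..<8}. ?H xs)"
    using sum_lists_4[of ?H "{..<8}"] by simp
  also have "\<dots> = fact 4 *\<^sub>R (\<Sum>C | C \<subseteq> {..<8} \<and> card C = 4. ?H (sorted_list_of_set C))"
  proof (rule sum_lists_eq_sum_sets)
    fix xs :: "9 list" assume xs: "length xs = 4" "set xs \<subseteq> {..<8}" "\<not> distinct xs"
    then obtain i j where "i < 4" "j < 4" "i \<noteq> j" "xs ! i = xs ! j"
      by (auto simp: distinct_conv_nth)
    then have "F x (map e xs) = 0"
      using differential_form_alternating[OF F, of x "map e xs" i j] xs et by auto
    then show "?H xs = 0" by simp
  next
    fix us u v ws assume *: "distinct (us @ u # v # ws)" "length (us @ u # v # ws) = 4"
      "set (us @ u # v # ws) \<subseteq> {..<8 :: 9}"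
    have "F x (map e us @ e u # e v # map e ws) = - F x (map e us @ e v # e u # map e ws)"
      using * et[of "set us"] et[of "set ws"] et[of "{u, v}"] by (intro differential_form_swap[OF F]) auto
    moreover have "foldr (gam cl x e) (us @ u # v # ws) s = - foldr (gam cl x e) (us @ v # u # ws) s"
      using foldr_G_swap[of u v "[]" s us ws] * s by simp
    moreover have "distinct (us @ v # u # ws)" using * by auto
    ultimately show "?H (us @ u # v # ws) = ?H (us @ v # u # ws)"
      using * s by (simp add: antisym_prod_distinct del: foldr_append foldr.simps)
  qed
  also have "(\<Sum>C | C \<subseteq> {..<8} \<and> card C = 4. ?H (sorted_list_of_set C))
      = gamma_ext (gam cl x e) (frame_components 4 E (\<lambda>Vs. r ^ 4 * pullback F (r, x) Vs)) s"
    unfolding gamma_ext_eq[OF s] basis_action_def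
  proof (rule sum.mono_neutral_cong_left)
    show "\<forall>C\<in>UNIV - {C. C \<subseteq> {..<8} \<and> card C = 4}.
        frame_components 4 E (\<lambda>Vs. r ^ 4 * pullback F (r, x) Vs) $ C *\<^sub>R foldr (gam cl x e) (sorted_list_of_set C) s = 0"
    proof
      fix C :: "9 set" assume C: "C \<in> UNIV - {C. C \<subseteq> {..<8} \<and> card C = 4}"
      have "pullback F (r, x) (map E (sorted_list_of_set C)) = 0" if "card C = 4"
      proof -
        have "8 \<in> C" using C that index_cases by auto
        then have "0 \<in> set (map push (map E (sorted_list_of_set C)))"
          using push(2) by force
        moreover have "push (E a) \<in> tangent A x" for a
        proof (cases "a < 8")
          case True
          then show ?thesis using push(1) et[of "{a}"] by (simp add: tangent_scale)
        next
          case False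
          then have "a = 8" using index_cases by blast
          then show ?thesis using push(2) by (simp add: tangent_def)
        qed
        ultimately show ?thesis
          using that unfolding pullback_def by (intro differential_form_zero[OF F]) auto
      qed
      then show "frame_components 4 E (\<lambda>Vs. r ^ 4 * pullback F (r, x) Vs) $ C *\<^sub>R foldr (gam cl x e) (sorted_list_of_set C) s = 0"
        by (simp add: frame_components_def)
    qed
    fix C :: "9 set" assume C: "C \<in> {C. C \<subseteq> {..<8} \<and> card C = 4}"
    then have "map push (map E (sorted_list_of_set C)) = map (fscale (1 / r)) (map e (sorted_list_of_set C))"
      using push(1) by auto
    moreover have "F x ([] @ map (fscale (1 / r)) (map e (sorted_list_of_set C)))
        = (1 / r) ^ length (map e (sorted_list_of_set C)) * F x ([] @ map e (sorted_list_of_set C))"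
      using C et by (intro differential_form_scale[OF F]) auto
    ultimately have "r ^ 4 * pullback F (r, x) (map E (sorted_list_of_set C)) = F x (map e (sorted_list_of_set C))"
      using r C by (simp add: pullback_def power_one_over del: map_map)
    then show "?H (sorted_list_of_set C)
        = frame_components 4 E (\<lambda>Vs. r ^ 4 * pullback F (r, x) Vs) $ C *\<^sub>R foldr (gam cl x e) (sorted_list_of_set C) s"
      using C s by (simp add: frame_components_def antisym_prod_distinct)
  qed simp_all
  finally show ?thesis by (simp add: fact_numeral)
qed

text \<open>Each r in the cone lifts and in front of \<open>d\<Delta>\<close> cancels the 1/r of a
  cone frame vector, and 24/288 = 1/12 is the coefficient of F.\<close>

lemma cone_Q_eq_gamma_ext:
  fixes \<Delta> :: "'m \<Rightarrow> real"
  assumes f\<^sub>0: "differential_form A 1 f\<^sub>0" and F\<^sub>0: "differential_form A 4 F\<^sub>0"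
    and r: "r > 0" and e: "oriented_frame A g vol x e" and E: "cone_frame A (r, x) e E"
    and \<eta>: "\<eta> (r, x) \<in> S x"
  defines "\<theta> \<equiv> frame_components 1 E (d_fun fst (r, x))"
    and "d\<Delta> \<equiv> frame_components 1 E (d_fun (\<Delta> \<circ> snd) (r, x))"
    and "f \<equiv> frame_components 1 E (\<lambda>Vs. r * pullback f\<^sub>0 (r, x) Vs)"
    and "F \<equiv> frame_components 4 E (\<lambda>Vs. r ^ 4 * pullback F\<^sub>0 (r, x) Vs)"
  shows "cone_Q cl \<Delta> f\<^sub>0 F\<^sub>0 \<kappa> (r, x) e \<eta> = gamma_ext (gam cl x e)
    ((1/2) *\<^sub>R r *\<^sub>R d\<Delta> - (1/6) *\<^sub>R f \<^bold>\<and> \<theta> - (1/12) *\<^sub>R F - \<kappa> *\<^sub>R \<theta>) (\<eta> (r, x))"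
proof -
  interpret clifford_module "S x" "B x" "gam cl x e" by (rule gam_clifford_module[OF e])
  let ?G = "gam cl x e" and ?s = "\<eta> (r, x)"
  have push: "\<And>m. m < 8 \<Longrightarrow> push (E m) = fscale (1 / r) (e m)" "push (E 8) = 0"
    and E_fst: "\<And>m. m < 8 \<Longrightarrow> E m fst = 0" "E 8 fst = 1"
    using E by (auto simp: cone_frame_def)
  have et: "e m \<in> tangent A x" if "m < 8" for m
    using e that by (simp add: oriented_frame_def)
  have zero: "0 \<in> tangent A x" by (simp add: tangent_def)
  have \<theta>: "\<theta> = coframe 8"
  proof -
    have "E a fst = (if a = 8 then 1 else 0)" for a
      using index_cases[of a] E_fst by auto
    then show ?thesis
      by (auto simp: \<theta>_def vec_eq_iff frame_components_def coframe_def axis_def d_fun_def card_1_singleton_iff split: if_splits)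
  qed
  have G\<theta>: "gamma_ext ?G \<theta> ?s = ?G 8 ?s"
    unfolding \<theta>_def gamma_ext_rank_1[OF \<eta>] UNIV_9 using E_fst by (simp add: d_fun_def)
  have "r * E m (\<Delta> \<circ> snd) = e m \<Delta>" if "m < 8" for m
    using fun_cong[OF push(1)[OF that], of \<Delta>] r by (simp add: push_def fscale_def)
  moreover have "E 8 (\<Delta> \<circ> snd) = 0"
    using fun_cong[OF push(2), of \<Delta>] by (simp add: push_def)
  ultimately have Gd\<Delta>: "r *\<^sub>R gamma_ext ?G d\<Delta> ?s = (\<Sum>m<8. e m \<Delta> *\<^sub>R ?G m ?s)"
    unfolding d\<Delta>_def gamma_ext_rank_1[OF \<eta>] UNIV_9 by (simp add: d_fun_def scaleR_sum_right)
  have f_base: "r * pullback f\<^sub>0 (r, x) [E m] = f\<^sub>0 x [e m]" if "m < 8" for m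
    using differential_form_scale[OF f\<^sub>0, of x "[]" "[e m]" "1 / r"] that et r push(1)[OF that]
    by (simp add: pullback_def)
  have f_radial: "pullback f\<^sub>0 (r, x) [E 8] = 0"
    using differential_form_zero[OF f\<^sub>0, of x "[0]"] push(2) zero by (simp add: pullback_def)
  have "f $ {8} = 0" using f_radial by (simp add: f_def frame_components_def)
  then have "f \<^bold>\<and> \<theta> = f \<diamondop> \<theta>"
    unfolding \<theta> by (intro wedge_coframe_orthogonal) (simp_all add: f_def)
  then have "gamma_ext ?G (f \<^bold>\<and> \<theta>) ?s = gamma_ext ?G f (?G 8 ?s)"
    by (simp add: gamma_ext_prod \<eta> G\<theta>)
  also have "\<dots> = (\<Sum>p<8. f\<^sub>0 x [e p] *\<^sub>R ?G p (?G 8 ?s))"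
    unfolding f_def gamma_ext_rank_1[OF G_in[OF \<eta>]] UNIV_9 using f_base f_radial by simp
  finally have Gf: "gamma_ext ?G (f \<^bold>\<and> \<theta>) ?s = (\<Sum>p<8. f\<^sub>0 x [e p] *\<^sub>R ?G p (?G 8 ?s))" .
  have GF: "(\<Sum>m<8. \<Sum>p<8. \<Sum>q<8. \<Sum>t<8. F\<^sub>0 x [e m, e p, e q, e t] *\<^sub>R antisym_prod ?G [m, p, q, t] ?s)
      = 24 *\<^sub>R gamma_ext ?G F ?s"
    unfolding F_def using F\<^sub>0 e push r \<eta> by (rule gamma_ext_four_form)
  have diff: "gamma_ext ?G (\<omega> - \<omega>') s = gamma_ext ?G \<omega> s - gamma_ext ?G \<omega>' s" for \<omega> \<omega>' s
    using gamma_ext_add[of \<omega> "(-1) *\<^sub>R \<omega>'" s] gamma_ext_scale[of "-1" \<omega>' s] by simp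
  show ?thesis
    unfolding cone_Q_def killing_Q_def Let_def snd_conv GF
    by (simp add: diff gamma_ext_scale G\<theta> Gf scaleR_scaleR[symmetric] Gd\<Delta> del: scaleR_scaleR) simp
qed

end

theorem mainTheorem1:
  fixes A :: "('m::{t2_space, second_countable_topology}, real^8) atlas"
    and g :: "'m \<Rightarrow> 'm vec \<Rightarrow> 'm vec \<Rightarrow> real"
    and vol :: "'m \<Rightarrow> 'm vec list \<Rightarrow> real"
    and nab :: "'m \<Rightarrow> 'm vec \<Rightarrow> ('m \<Rightarrow> 'm vec) \<Rightarrow> 'm vec"
    and S :: "'m \<Rightarrow> 's::real_normed_vector set"
    and T :: "('m, 's) trivializations"
    and cl :: "'m \<Rightarrow> 'm vec \<Rightarrow> 's \<Rightarrow> 's"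
    and B :: "'m \<Rightarrow> 's \<Rightarrow> 's \<Rightarrow> real"
    and nabS :: "'m \<Rightarrow> 'm vec \<Rightarrow> ('m \<Rightarrow> 's) \<Rightarrow> 's"
    and \<Delta> :: "'m \<Rightarrow> real"
    and f\<^sub>0 F\<^sub>0 :: "'m \<Rightarrow> 'm vec list \<Rightarrow> real"
    and \<kappa> :: real
    and \<xi>\<^sub>1 \<xi>\<^sub>2 :: "real \<times> 'm \<Rightarrow> 's"
  assumes geometry: "pinor_geometry A g vol nab S T cl B nabS"
    and \<kappa>: "\<kappa> > 0"
    and \<Delta>: "smooth_fun A \<Delta>"
    and f: "differential_form A 1 f\<^sub>0"
    and F: "differential_form A 4 F\<^sub>0"
    and dimension: "fun_vs.dim (killing_space A g vol S T cl nabS \<Delta> f\<^sub>0 F\<^sub>0 \<kappa>) = 2"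
    and basis: "\<xi>\<^sub>1 \<noteq> \<xi>\<^sub>2" "fun_vs.independent {\<xi>\<^sub>1, \<xi>\<^sub>2}"
      "fun_vs.span {\<xi>\<^sub>1, \<xi>\<^sub>2} = killing_space A g vol S T cl nabS \<Delta> f\<^sub>0 F\<^sub>0 \<kappa>"
    and orthonormal: "orthonormal_pair B \<xi>\<^sub>1 \<xi>\<^sub>2"
  shows "\<forall>r x e E \<eta>\<^sub>1 \<eta>\<^sub>2.
    r > 0 \<longrightarrow> oriented_frame A g vol x e \<longrightarrow> cone_frame A (r, x) e E \<longrightarrow>
    cone_section A S T \<eta>\<^sub>1 \<longrightarrow> cone_section A S T \<eta>\<^sub>2 \<longrightarrow> orthonormal_pair B \<eta>\<^sub>1 \<eta>\<^sub>2 \<longrightarrow>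
    (let p = (r, x);
         G = gam cl x e;
         V\<^sub>3 = bilinear_form (B x) G 1 (\<eta>\<^sub>1 p) (\<eta>\<^sub>2 p);
         K = bilinear_form (B x) G 2 (\<eta>\<^sub>1 p) (\<eta>\<^sub>2 p);
         \<Psi> = bilinear_form (B x) G 3 (\<eta>\<^sub>1 p) (\<eta>\<^sub>2 p);
         \<Phi>\<^sub>3 = bilinear_form (B x) G 4 (\<eta>\<^sub>1 p) (\<eta>\<^sub>2 p);
         E\<^sub>1\<^sub>2 = (1/32) *\<^sub>R (V\<^sub>3 + K + \<Psi> + \<Phi>\<^sub>3);
         \<theta> = frame_components 1 E (d_fun fst p);
         d\<Delta> = frame_components 1 E (d_fun (\<Delta> \<circ> snd) p);
         f = frame_components 1 E (\<lambda>Vs. r * pullback f\<^sub>0 p Vs);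
         F = frame_components 4 E (\<lambda>Vs. r ^ 4 * pullback F\<^sub>0 p Vs);
         Q = (1/2) *\<^sub>R r *\<^sub>R d\<Delta> - (1/6) *\<^sub>R f \<^bold>\<and> \<theta> - (1/12) *\<^sub>R F - \<kappa> *\<^sub>R \<theta>;
         Rminus = Q \<diamondop>\<^sub>+ E\<^sub>1\<^sub>2 - E\<^sub>1\<^sub>2 \<diamondop>\<^sub>+ reversion Q;
         Rplus = Q \<diamondop>\<^sub>+ E\<^sub>1\<^sub>2 + E\<^sub>1\<^sub>2 \<diamondop>\<^sub>+ reversion Q
     in
       reversion Q = (1/2) *\<^sub>R r *\<^sub>R d\<Delta> + (1/6) *\<^sub>R f \<^bold>\<and> \<theta> - (1/12) *\<^sub>R F - \<kappa> *\<^sub>R \<theta> \<and>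
       (\<forall>\<eta>. cone_section A S T \<eta> \<longrightarrow> cone_Q cl \<Delta> f\<^sub>0 F\<^sub>0 \<kappa> p e \<eta> = gamma_ext G Q (\<eta> p)) \<and>
       (cone_Q cl \<Delta> f\<^sub>0 F\<^sub>0 \<kappa> p e \<eta>\<^sub>1 = 0 \<and> cone_Q cl \<Delta> f\<^sub>0 F\<^sub>0 \<kappa> p e \<eta>\<^sub>2 = 0 \<longleftrightarrow>
          Rminus = 0 \<and> Rplus = 0) \<and>
       amounts_by_rank Rminus
         [\<iota> (f \<^bold>\<and> \<theta>) K,
          r *\<^sub>R \<iota> d\<Delta> K + (1/3) *\<^sub>R \<iota> (f \<^bold>\<and> \<theta>) \<Psi> - (1/6) *\<^sub>R \<iota> \<Psi> F - (2 * \<kappa>) *\<^sub>R \<iota> \<theta> K,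
          (1/3) *\<^sub>R \<iota> (f \<^bold>\<and> \<theta>) \<Phi>\<^sub>3 - (1/6) *\<^sub>R \<triangle> 3 F \<Phi>\<^sub>3 + r *\<^sub>R d\<Delta> \<^bold>\<and> V\<^sub>3 + (2 * \<kappa>) *\<^sub>R V\<^sub>3 \<^bold>\<and> \<theta>,
          r *\<^sub>R \<iota> d\<Delta> \<Phi>\<^sub>3 - (1/3) *\<^sub>R V\<^sub>3 \<^bold>\<and> f \<^bold>\<and> \<theta> + (1/6) *\<^sub>R \<iota> V\<^sub>3 F
            - (1/6) *\<^sub>R hodge (\<triangle> 1 F \<Phi>\<^sub>3) + (1/3) *\<^sub>R hodge (f \<^bold>\<and> \<theta> \<^bold>\<and> \<Phi>\<^sub>3) - (2 * \<kappa>) *\<^sub>R \<iota> \<theta> \<Phi>\<^sub>3,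
          r *\<^sub>R d\<Delta> \<^bold>\<and> \<Psi> - (1/3) *\<^sub>R f \<^bold>\<and> \<theta> \<^bold>\<and> K - (1/6) *\<^sub>R \<triangle> 1 K F
            - (1/3) *\<^sub>R hodge (f \<^bold>\<and> \<theta> \<^bold>\<and> \<Psi>) + (1/6) *\<^sub>R hodge (\<triangle> 1 \<Psi> F) + (2 * \<kappa>) *\<^sub>R \<Psi> \<^bold>\<and> \<theta>] \<and>
       amounts_by_rank Rplus
         [- (1/6) *\<^sub>R \<iota> F \<Phi>\<^sub>3 + r *\<^sub>R \<iota> d\<Delta> V\<^sub>3 - (2 * \<kappa>) *\<^sub>R \<iota> \<theta> V\<^sub>3,
          (1/3) *\<^sub>R \<iota> V\<^sub>3 (f \<^bold>\<and> \<theta>) - (1/6) *\<^sub>R hodge (F \<^bold>\<and> \<Phi>\<^sub>3),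
          r *\<^sub>R \<iota> d\<Delta> \<Psi> + (1/3) *\<^sub>R \<triangle> 1 (f \<^bold>\<and> \<theta>) K + (1/6) *\<^sub>R \<iota> K F
            + (1/6) *\<^sub>R hodge (F \<^bold>\<and> \<Psi>) - (2 * \<kappa>) *\<^sub>R \<iota> \<theta> \<Psi>,
          (1/3) *\<^sub>R \<triangle> 1 (f \<^bold>\<and> \<theta>) \<Psi> + (1/6) *\<^sub>R \<triangle> 2 \<Psi> F + (1/6) *\<^sub>R hodge (K \<^bold>\<and> F)
            + r *\<^sub>R d\<Delta> \<^bold>\<and> K - (2 * \<kappa>) *\<^sub>R K \<^bold>\<and> \<theta>,
          (1/3) *\<^sub>R \<triangle> 1 (f \<^bold>\<and> \<theta>) \<Phi>\<^sub>3 + (1/6) *\<^sub>R \<triangle> 2 F \<Phi>\<^sub>3 - (1/6) *\<^sub>R hodge (F \<^bold>\<and> V\<^sub>3)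
            + hodge (r *\<^sub>R d\<Delta> \<^bold>\<and> \<Phi>\<^sub>3) - (2 * \<kappa>) *\<^sub>R hodge (\<Phi>\<^sub>3 \<^bold>\<and> \<theta>)] \<and>
       (\<eta>\<^sub>1 = \<xi>\<^sub>1 \<and> \<eta>\<^sub>2 = \<xi>\<^sub>2 \<longrightarrow> Rminus = 0 \<and> Rplus = 0))"
proof (intro allI impI, goal_cases)
  interpret pinor_geometry A g vol nab S T cl B nabS by (rule geometry)
  case (1 r x e E \<eta>\<^sub>1 \<eta>\<^sub>2)
  then have r: "r > 0" and e: "oriented_frame A g vol x e" and E: "cone_frame A (r, x) e E"
    and \<eta>: "cone_section A S T \<eta>\<^sub>1" "cone_section A S T \<eta>\<^sub>2" and on: "orthonormal_pair B \<eta>\<^sub>1 \<eta>\<^sub>2"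
    by auto
  interpret clifford_module "S x" "B x" "gam cl x e" by (rule gam_clifford_module[OF e])
  define V\<^sub>3 K \<Psi> \<Phi>\<^sub>3 where bilinears:
    "V\<^sub>3 = bilinear_form (B x) (gam cl x e) 1 (\<eta>\<^sub>1 (r, x)) (\<eta>\<^sub>2 (r, x))"
    "K = bilinear_form (B x) (gam cl x e) 2 (\<eta>\<^sub>1 (r, x)) (\<eta>\<^sub>2 (r, x))"
    "\<Psi> = bilinear_form (B x) (gam cl x e) 3 (\<eta>\<^sub>1 (r, x)) (\<eta>\<^sub>2 (r, x))"
    "\<Phi>\<^sub>3 = bilinear_form (B x) (gam cl x e) 4 (\<eta>\<^sub>1 (r, x)) (\<eta>\<^sub>2 (r, x))"
  define \<theta> d\<Delta> f F where comps:
    "\<theta> = frame_components 1 E (d_fun fst (r, x))"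
    "d\<Delta> = frame_components 1 E (d_fun (\<Delta> \<circ> snd) (r, x))"
    "f = frame_components 1 E (\<lambda>Vs. r * pullback f\<^sub>0 (r, x) Vs)"
    "F = frame_components 4 E (\<lambda>Vs. r ^ 4 * pullback F\<^sub>0 (r, x) Vs)"
  define E\<^sub>1\<^sub>2 where E12: "E\<^sub>1\<^sub>2 = (1/32) *\<^sub>R (V\<^sub>3 + K + \<Psi> + \<Phi>\<^sub>3)"
  define Q where Q: "Q = (1/2) *\<^sub>R r *\<^sub>R d\<Delta> - (1/6) *\<^sub>R f \<^bold>\<and> \<theta> - (1/12) *\<^sub>R F - \<kappa> *\<^sub>R \<theta>"
  interpret forms: cone_forms d\<Delta> \<theta> f F V\<^sub>3 K \<Psi> \<Phi>\<^sub>3 r \<kappa>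
    by standard (simp_all only: bilinears comps frame_components_rank bilinear_form_rank)
  have forms_eq: "forms.Q = Q" "forms.E = E\<^sub>1\<^sub>2" "forms.W = f \<^bold>\<and> \<theta>"
    by (simp_all only: forms.Q_def forms.E_def forms.W_def Q E12)
  have in_S: "\<eta> (r, x) \<in> S x" if "cone_section A S T \<eta>" for \<eta>
    using that r by (auto simp: cone_section_def)
  have norm: "B x (\<eta>\<^sub>1 (r, x)) (\<eta>\<^sub>1 (r, x)) = 1" "B x (\<eta>\<^sub>2 (r, x)) (\<eta>\<^sub>2 (r, x)) = 1"
    and orth: "B x (\<eta>\<^sub>1 (r, x)) (\<eta>\<^sub>2 (r, x)) = 0"
    using on r by (auto simp: orthonormal_pair_def)
  have action: "cone_Q cl \<Delta> f\<^sub>0 F\<^sub>0 \<kappa> (r, x) e \<eta> = gamma_ext (gam cl x e) Q (\<eta> (r, x))"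
    if "cone_section A S T \<eta>" for \<eta>
    unfolding Q comps by (rule cone_Q_eq_gamma_ext[where \<eta> = \<eta>, OF f F r e E in_S[OF that]])
  have constraints: "cone_Q cl \<Delta> f\<^sub>0 F\<^sub>0 \<kappa> (r, x) e \<eta>\<^sub>1 = 0 \<and> cone_Q cl \<Delta> f\<^sub>0 F\<^sub>0 \<kappa> (r, x) e \<eta>\<^sub>2 = 0 \<longleftrightarrow>
      Q \<diamondop>\<^sub>+ E\<^sub>1\<^sub>2 - E\<^sub>1\<^sub>2 \<diamondop>\<^sub>+ reversion Q = 0 \<and> Q \<diamondop>\<^sub>+ E\<^sub>1\<^sub>2 + E\<^sub>1\<^sub>2 \<diamondop>\<^sub>+ reversion Q = 0"
    unfolding action[OF \<eta>(1)] action[OF \<eta>(2)] E12 bilinears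
    by (rule algebraic_constraints[OF in_S[OF \<eta>(1)] in_S[OF \<eta>(2)] norm orth])
  \<comment> \<open>The basis elements lie in their span, which is the solution space, so the
    constraint holds at this point and in this frame.\<close>
  have killing: "cone_Q cl \<Delta> f\<^sub>0 F\<^sub>0 \<kappa> (r, x) e \<xi> = 0" if "\<xi> \<in> {\<xi>\<^sub>1, \<xi>\<^sub>2}" for \<xi>
    using fun_vs.span_base[OF that] r e unfolding basis(3) killing_space_def by blast
  have vanish: "\<eta>\<^sub>1 = \<xi>\<^sub>1 \<and> \<eta>\<^sub>2 = \<xi>\<^sub>2 \<longrightarrow>
      Q \<diamondop>\<^sub>+ E\<^sub>1\<^sub>2 - E\<^sub>1\<^sub>2 \<diamondop>\<^sub>+ reversion Q = 0 \<and> Q \<diamondop>\<^sub>+ E\<^sub>1\<^sub>2 + E\<^sub>1\<^sub>2 \<diamondop>\<^sub>+ reversion Q = 0"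
    using constraints killing by blast
  note separation = forms.reversion_Q forms.amounts_Rminus forms.amounts_Rplus
  note facts = separation[unfolded forms_eq wedge_assoc]
  show ?case
    unfolding Let_def bilinears[symmetric] comps[symmetric] E12[symmetric] Q[symmetric]
    using facts action constraints vanish by (intro conjI allI impI) blast+
qed

end
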